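(* There exists a universal constant $C>0$ such that the following holds. Let $m,n\geq 1$ be integers, let $\delta>0$ and $\eta\in(0,1)$, and let $\mathcal C_1,\mathcal C_2\subset\mathbb R^n$ be nonempty closed convex sets of finite Chebyshev radius with $\mathcal C_1\cap\mathcal C_2=\emptyset$. Let $r:=\mathrm{rad}(\mathcal C_1)+\mathrm{rad}(\mathcal C_2)$, let $\mathcal C^-:=\mathcal C_1-\mathcal C_2=\{\boldsymbol x_1-\boldsymbol x_2:\boldsymbol x_1\in\mathcal C_1,\boldsymbol x_2\in\mathcal C_2\}$, let $\sigma:=\min_{\boldsymbol z\in\mathcal C^-}\|\boldsymbol z\|_2$, and let $w_\cap:=w\big((\mathbb R_+\mathcal C^-)\cap\mathbb S_2^{n-1}\big)$. Let $\mathsf A:\mathbb R^n\to\delta\mathbb Z^m$ be the random map $\mathsf A(\boldsymbol x):=\mathcal Q_\delta(\boldsymbol\Phi\boldsymbol x+\boldsymbol\xi)$, where $\boldsymbol\Phi\in\mathbb R^{m\times n}$ has i.i.d. standard normal $\mathcal N(0,1)$ entries and $\boldsymbol\xi\in\mathbb R^m$, independent of $\boldsymbol\Phi$, has i.i.d. entries uniformly distributed on $[0,\delta]$. If $$m\ \geq\ C\,\Big(w_\cap^2+n\frac{\delta^2}{\sigma^2}\Big)\Big(1+\log\Big(1+\frac{r\,m}{\delta\,n}\Big)+w_\cap^{-2}\log\frac1\eta\Big),$$ then $$\mathbb P\big[\mathsf A(\mathcal C_1)\cap\mathsf A(\mathcal C_2)=\emptyset\big]\ \geq\ 1-\eta 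.$$
   Context: The quantiser $\mathcal Q_\delta(t):=\delta\lfloor t/\delta\rfloor$ is applied component-wise to vectors. The image of a set $\mathcal C$ under a map $\mathsf A$ is $\mathsf A(\mathcal C)=\{\mathsf A(\boldsymbol x):\boldsymbol x\in\mathcal C\}$. The Chebyshev radius of $\mathcal C\subset\mathbb R^n$ is $\mathrm{rad}(\mathcal C):=\inf\{\rho>0:\exists\,\boldsymbol c\in\mathbb R^n,\ \mathcal C\subset\boldsymbol c+\rho\,\mathbb B_2^n\}$, where $\mathbb B_2^n$ is the Euclidean unit ball; $\mathbb S_2^{n-1}$ is the Euclidean unit sphere of $\mathbb R^n$. The Gaussian mean width of $\mathcal C\subset\mathbb R^n$ is $w(\mathcal C):=\mathbb E\sup_{\boldsymbol x\in\mathcal C}|\boldsymbol g^\top\boldsymbol x|$ with $\boldsymbol g\in\mathbb R^n$ having i.i.d. $\mathcal N(0,1)$ entries. $\mathbb R_+\mathcal C^-$ is the cone $\{t\boldsymbol z:t\geq0,\ \boldsymbol z\in\mathcal C^-\}$. *)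

theory Defs
  imports "HOL-Probability.Probability"
begin

text \<open>Since a constant uniform over all dimensions is asserted, vectors of R^n are not typed by their
  dimension: they are the points of \<^const>\<open>Euclidean_space\<close> n, i.e. functions from nat to real
  vanishing at all indices i with n \<le> i.\<close>

abbreviation RR :: "nat \<Rightarrow> (nat \<Rightarrow> real) set"
  where "RR n \<equiv> topspace (Euclidean_space n)"

definition dot :: "nat \<Rightarrow> (nat \<Rightarrow> real) \<Rightarrow> (nat \<Rightarrow> real) \<Rightarrow> real"
  where "dot n x y = (\<Sum>i<n. x i * y i)"

definition enorm :: "nat \<Rightarrow> (nat \<Rightarrow> real) \<Rightarrow> real"
  where "enorm n x = L2_set x {..<n}"

definition unit_ball :: "nat \<Rightarrow> (nat \<Rightarrow> real) set"
  where "unit_ball n = {x \<in> RR n. enorm n x \<le> 1}"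

definition unit_sphere :: "nat \<Rightarrow> (nat \<Rightarrow> real) set"
  where "unit_sphere n = {x \<in> RR n. enorm n x = 1}"

text \<open>The function type carries no \<open>real_vector\<close> instance, so \<^const>\<open>convex\<close> does not apply.\<close>

definition convex_fun :: "(nat \<Rightarrow> real) set \<Rightarrow> bool"
  where "convex_fun S \<longleftrightarrow>
    (\<forall>x\<in>S. \<forall>y\<in>S. \<forall>u\<ge>0. \<forall>v\<ge>0. u + v = 1 \<longrightarrow> (\<lambda>i. u * x i + v * y i) \<in> S)"

definition diff_set :: "(nat \<Rightarrow> real) set \<Rightarrow> (nat \<Rightarrow> real) set \<Rightarrow> (nat \<Rightarrow> real) set"
  where "diff_set S T = {\<lambda>i. x i - y i | x y. x \<in> S \<and> y \<in> T}"

definition cone_over :: "(nat \<Rightarrow> real) set \<Rightarrow> (nat \<Rightarrow> real) set"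
  where "cone_over S = {\<lambda>i. t * z i | t z. 0 \<le> t \<and> z \<in> S}"

text \<open>The radius takes the value \<open>\<infinity>\<close> exactly on the unbounded sets (infimum of the empty set).\<close>

definition cheb_rad :: "nat \<Rightarrow> (nat \<Rightarrow> real) set \<Rightarrow> ennreal"
  where "cheb_rad n S =
    (INF \<rho>\<in>{\<rho>. 0 < \<rho> \<and> (\<exists>c\<in>RR n. S \<subseteq> {\<lambda>i. c i + \<rho> * b i | b. b \<in> unit_ball n})}. ennreal \<rho>)"

definition gauss_vec :: "nat \<Rightarrow> (nat \<Rightarrow> real) measure"
  where "gauss_vec n = (\<Pi>\<^sub>M i\<in>{..<n}. std_normal_distribution)"

definition mean_width :: "nat \<Rightarrow> (nat \<Rightarrow> real) set \<Rightarrow> ennreal"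
  where "mean_width n S = (\<integral>\<^sup>+ g. (SUP x\<in>S. ennreal \<bar>dot n g x\<bar>) \<partial>gauss_vec n)"

definition quant :: "real \<Rightarrow> real \<Rightarrow> real"
  where "quant \<delta> t = \<delta> * of_int \<lfloor>t / \<delta>\<rfloor>"

text \<open>Joint law of the m by n matrix (its (i,j) entry is the coordinate (i,j)) and the dither.\<close>

definition map_law :: "nat \<Rightarrow> nat \<Rightarrow> real \<Rightarrow> ((nat \<times> nat \<Rightarrow> real) \<times> (nat \<Rightarrow> real)) measure"
  where "map_law m n \<delta> =
    (\<Pi>\<^sub>M ij\<in>{..<m} \<times> {..<n}. std_normal_distribution) \<Otimes>\<^sub>M
    (\<Pi>\<^sub>M i\<in>{..<m}. uniform_measure lborel {0..\<delta>})"

definition quant_map ::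
  "nat \<Rightarrow> nat \<Rightarrow> real \<Rightarrow> (nat \<times> nat \<Rightarrow> real) \<times> (nat \<Rightarrow> real) \<Rightarrow> (nat \<Rightarrow> real) \<Rightarrow> (nat \<Rightarrow> real)"
  where "quant_map m n \<delta> \<omega> x =
    (\<lambda>i. if i < m then quant \<delta> ((\<Sum>j<n. fst \<omega> (i, j) * x j) + snd \<omega> i) else 0)"

end

theory Submission
  imports Defs
begin

text \<open>
  If \<open>A x = A y\<close>, then every row \<open>\<phi>\<close> satisfies \<open>\<bar>\<langle>\<phi>, x - y\<rangle>\<bar> < \<delta>\<close>. When \<open>8 \<delta> \<le> \<sigma>\<close> this already
  contradicts a small ball estimate that is uniform over the directions \<open>(x - y) / \<parallel>x - y\<parallel>\<close>; the
  dither plays no role. When \<open>\<sigma> < 8 \<delta>\<close>, take nets of the two sets of precision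
  \<open>\<epsilon> \<approx> \<sigma>\<^sup>2 / \<delta>\<close>. For a pair of net points at distance at least \<open>\<sigma> / 2\<close> the dither places a
  quantisation threshold robustly between the two measurements with probability of order
  \<open>\<sigma> / \<delta>\<close>, independently in each row, so all net pairs are robustly separated by a
  proportion \<open>\<sigma> / \<delta>\<close> of the rows; and all displacements of norm at most \<open>\<epsilon>\<close> perturb fewer rows
  than that.

  Both uniform statements bound \<open>sup\<^sub>z \<Sum>\<^sub>i \<psi> \<langle>\<phi>\<^sub>i, z\<rangle>\<close> for a Lipschitz \<open>\<psi>\<close> with values in \<open>[0, 1]\<close>: the
  expectation by symmetrisation and contraction, the fluctuation by bounded differences.
\<close>

section \<open>Contraction and bounded differences\<close>

text \<open>Quantisation is discontinuous, so separation of two net points says nothing by itself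
  about their neighbours. Net pairs are therefore separated with a margin
  \<open>t = \<sigma> / 16\<close> on both sides, and rows in which a displacement exceeds
  \<open>t\<close> are counted rather than excluded. Outside the exceptional events more than
  \<open>m \<sigma> / (128 \<delta>)\<close> rows separate a net pair, while each of the two
  displacements spoils at most \<open>4 m \<epsilon> / t\<close> rows. Balancing,
  \<open>8 \<epsilon> / t = \<sigma> / (128 \<delta>)\<close>, gives
  \<open>\<epsilon> = \<sigma>^2 / (2^14 \<delta>)\<close>. The displacement bound then fails with
  probability at most \<open>exp (- 2 m (\<sigma> / (1024 \<delta>))^2)\<close>; this is the source
  of the factor \<open>\<delta>^2 / \<sigma>^2\<close> and of the constant \<open>2 ^ 20\<close>.
  The net has log-cardinality of order \<open>n log (1 + r / \<epsilon>)\<close>, and the hypothesis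
  on \<open>m\<close> yields \<open>1 / \<epsilon> \<le> m / (\<delta> n)\<close>, which explains
  the logarithm in the theorem. For \<open>\<sigma> < 8 \<delta>\<close> the bound
  \<open>w^2 \<le> n\<close> replaces the width by the dimension.\<close>

lemma integrable_Max_image:
  fixes f :: "'z \<Rightarrow> 'a \<Rightarrow> real"
  assumes "finite T" "T \<noteq> {}" "\<And>z. z \<in> T \<Longrightarrow> integrable M (f z)"
  shows "integrable M (\<lambda>x. Max ((\<lambda>z. f z x) ` T))"
  using assms
proof (induction T rule: finite_ne_induct)
  case (insert z T)
  have "(\<lambda>x. Max ((\<lambda>z. f z x) ` insert z T)) = (\<lambda>x. max (f z x) (Max ((\<lambda>z. f z x) ` T)))"
    using insert by (auto simp: fun_eq_iff)
  then show ?case using insert by auto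
qed simp

text \<open>This is the one-coordinate case of the contraction principle for Rademacher averages.
  Take maximisers \<open>u\<close> and \<open>v\<close> of the two left-hand maxima, bound the
  difference of the \<open>\<psi>\<close> terms by \<open>L * \<bar>x u - x v\<bar>\<close>, and
  test the right-hand maxima at \<open>u\<close> and \<open>v\<close>, exchanged when
  \<open>x u < x v\<close>.\<close>

lemma Max_contraction:
  fixes h x :: "'z \<Rightarrow> real"
  assumes "finite T" "T \<noteq> {}" and lip: "\<And>a b. \<bar>\<psi> a - \<psi> b\<bar> \<le> L * \<bar>a - b\<bar>"
  shows "Max ((\<lambda>z. h z + 2 * \<psi> (x z)) ` T) + Max ((\<lambda>z. h z - 2 * \<psi> (x z)) ` T)
    \<le> Max ((\<lambda>z. h z + 2 * L * x z) ` T) + Max ((\<lambda>z. h z - 2 * L * x z) ` T)"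
proof -
  obtain u where u: "u \<in> T" "Max ((\<lambda>z. h z + 2 * \<psi> (x z)) ` T) = h u + 2 * \<psi> (x u)"
    using Max_in[of "(\<lambda>z. h z + 2 * \<psi> (x z)) ` T"] assms(1,2) by (metis (no_types, lifting) finite_imageI image_iff image_is_empty)
  obtain v where v: "v \<in> T" "Max ((\<lambda>z. h z - 2 * \<psi> (x z)) ` T) = h v - 2 * \<psi> (x v)"
    using Max_in[of "(\<lambda>z. h z - 2 * \<psi> (x z)) ` T"] assms(1,2) by (metis (no_types, lifting) finite_imageI image_iff image_is_empty)
  have P: "h z + 2 * L * x z \<le> Max ((\<lambda>z. h z + 2 * L * x z) ` T)" if "z \<in> T" for z
    using assms that by (intro Max_ge) auto
  have M: "h z - 2 * L * x z \<le> Max ((\<lambda>z. h z - 2 * L * x z) ` T)" if "z \<in> T" for z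
    using assms that by (intro Max_ge) auto
  have "2 * \<psi> (x u) - 2 * \<psi> (x v) \<le> 2 * (L * \<bar>x u - x v\<bar>)"
    using lip[of "x u" "x v"] by linarith
  also have "\<dots> \<le> max (2 * L * x u - 2 * L * x v) (2 * L * x v - 2 * L * x u)"
    by (cases "x u \<le> x v") (auto simp: algebra_simps)
  finally show ?thesis
    using P[of u] P[of v] M[of u] M[of v] u v by linarith
qed

text \<open>Averaging the two halves of \<open>h + \<psi> - \<kappa> \<le> (h + 2 \<psi>) / 2 + E (h - 2 \<psi>) / 2\<close> over the sign symmetry
  of \<open>X\<close> replaces the usual introduction of Rademacher signs.\<close>

lemma expectation_Max_step:
  fixes X :: "'a \<Rightarrow> 'z \<Rightarrow> real"
  assumes "prob_space M" and T: "finite T" "T \<noteq> {}"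
    and int: "\<And>z. z \<in> T \<Longrightarrow> integrable M (\<lambda>g. X g z)"
    and sym: "\<And>h. (\<integral>g. Max ((\<lambda>z. h z - 2 * L * X g z) ` T) \<partial>M) = (\<integral>g. Max ((\<lambda>z. h z + 2 * L * X g z) ` T) \<partial>M)"
    and meas[measurable]: "\<psi> \<in> borel_measurable borel"
    and lip: "\<And>a b. \<bar>\<psi> a - \<psi> b\<bar> \<le> L * \<bar>a - b\<bar>"
    and bnd: "\<And>a. 0 \<le> \<psi> a" "\<And>a. \<psi> a \<le> 1"
    and kap: "\<And>z. z \<in> T \<Longrightarrow> (\<integral>g. \<psi> (X g z) \<partial>M) \<le> \<kappa>"
  shows "(\<integral>g. Max ((\<lambda>z. h z + (\<psi> (X g z) - \<kappa>)) ` T) \<partial>M) \<le> (\<integral>g. Max ((\<lambda>z. h z + 2 * L * X g z) ` T) \<partial>M)"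
proof -
  interpret prob_space M by fact
  have [measurable]: "(\<lambda>g. X g z) \<in> borel_measurable M" if "z \<in> T" for z using int[OF that] by auto
  have ipsi: "integrable M (\<lambda>g. \<psi> (X g z))" if "z \<in> T" for z
    using that bnd by (intro integrable_const_bound[where B=1]) auto
  have i0: "integrable M (\<lambda>g. Max ((\<lambda>z. h z + (\<psi> (X g z) - \<kappa>)) ` T))"
    using T ipsi by (intro integrable_Max_image) auto
  have i1: "integrable M (\<lambda>g. Max ((\<lambda>z. h z + 2 * \<psi> (X g z)) ` T))"
    using T ipsi by (intro integrable_Max_image) auto
  have i2: "integrable M (\<lambda>g. Max ((\<lambda>z. h z - 2 * \<psi> (X g z)) ` T))"
    using T ipsi by (intro integrable_Max_image) auto
  have i3: "integrable M (\<lambda>g. Max ((\<lambda>z. h z + 2 * L * X g z) ` T))"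
    using T int by (intro integrable_Max_image) auto
  have i4: "integrable M (\<lambda>g. Max ((\<lambda>z. h z - 2 * L * X g z) ` T))"
    using T int by (intro integrable_Max_image) auto
  let ?E = "\<integral>g. Max ((\<lambda>z. h z - 2 * \<psi> (X g z)) ` T) \<partial>M"
  \<comment> \<open>The centring constant is absorbed into an expected maximum, since a single
    \<open>z\<close> lies below the maximum; \<open>?E\<close> takes the part of the independent
    copy in symmetrisation.\<close>
  have A: "h z - 2 * \<kappa> \<le> ?E" if "z \<in> T" for z
  proof -
    have "h z - 2 * \<kappa> \<le> (\<integral>g. h z - 2 * \<psi> (X g z) \<partial>M)"
      using ipsi[OF that] kap[OF that] by (simp add: prob_space)
    also have "\<dots> \<le> ?E"
      using T that by (intro integral_mono i2) (auto intro!: ipsi)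
    finally show ?thesis .
  qed
  have "(\<integral>g. Max ((\<lambda>z. h z + (\<psi> (X g z) - \<kappa>)) ` T) \<partial>M) \<le> (\<integral>g. Max ((\<lambda>z. h z + 2 * \<psi> (X g z)) ` T) / 2 + ?E / 2 \<partial>M)"
  proof (intro integral_mono i0)
    fix g
    have "h z + (\<psi> (X g z) - \<kappa>) \<le> Max ((\<lambda>z. h z + 2 * \<psi> (X g z)) ` T) / 2 + ?E / 2" if "z \<in> T" for z
    proof -
      have "h z + 2 * \<psi> (X g z) \<le> Max ((\<lambda>z. h z + 2 * \<psi> (X g z)) ` T)"
        using T that by (intro Max_ge) auto
      then show ?thesis using A[OF that] by argo
    qed
    then show "Max ((\<lambda>z. h z + (\<psi> (X g z) - \<kappa>)) ` T) \<le> Max ((\<lambda>z. h z + 2 * \<psi> (X g z)) ` T) / 2 + ?E / 2"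
      using T by auto
  qed (use i1 in auto)
  also have "\<dots> = ((\<integral>g. Max ((\<lambda>z. h z + 2 * \<psi> (X g z)) ` T) + Max ((\<lambda>z. h z - 2 * \<psi> (X g z)) ` T) \<partial>M)) / 2"
    using i1 i2 by (simp add: prob_space add_divide_distrib)
  also have "\<dots> \<le> ((\<integral>g. Max ((\<lambda>z. h z + 2 * L * X g z) ` T) + Max ((\<lambda>z. h z - 2 * L * X g z) ` T) \<partial>M)) / 2"
    using i1 i2 i3 i4 by (intro divide_right_mono integral_mono Max_contraction T lip) auto
  also have "\<dots> = (\<integral>g. Max ((\<lambda>z. h z + 2 * L * X g z) ` T) \<partial>M)"
    using i3 i4 sym by (simp add: prob_space)
  finally show ?thesis .
qed

lemma integrable_PiM_component:
  fixes f :: "'a \<Rightarrow> real"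
  assumes "\<And>i. i \<in> I \<Longrightarrow> prob_space (M i)" "i \<in> I" "integrable (M i) f"
  shows "integrable (PiM I M) (\<lambda>v. f (v i))"
proof -
  have "integrable (distr (PiM I M) (M i) (\<lambda>v. v i)) f"
    using assms by (subst distr_PiM_component) auto
  then show ?thesis
    by (rule integrable_distr[rotated]) (use assms in measurable)
qed

text \<open>Both orders of integration serve below: with the other coordinates fixed the one-row
  comparison applies, with the new coordinate fixed the induction hypothesis does.\<close>

lemma product_integral_insert_swap:
  fixes f :: "('i \<Rightarrow> 'a) \<Rightarrow> real"
  assumes "product_prob_space M" "finite I" "i \<notin> I" "integrable (PiM (insert i I) M) f"
  shows "integral\<^sup>L (PiM (insert i I) M) f = (\<integral>y. (\<integral>v. f (v(i := y)) \<partial>PiM I M) \<partial>M i)"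
    and "integrable (PiM I M) (\<lambda>v. \<integral>y. f (v(i := y)) \<partial>M i)"
    and "integrable (M i) (\<lambda>y. \<integral>v. f (v(i := y)) \<partial>PiM I M)"
proof -
  interpret product_prob_space M by fact
  interpret PI: prob_space "PiM I M" by (intro prob_space_PiM prob_space)
  interpret PP: pair_prob_space "M i" "PiM I M" ..
  have eq: "PiM (insert i I) M = distr (M i \<Otimes>\<^sub>M PiM I M) (PiM (insert i I) M) (\<lambda>(y, v). v(i := y))"
    by (intro distr_pair_PiM_eq_PiM[symmetric] prob_space)
  have "integrable (distr (M i \<Otimes>\<^sub>M PiM I M) (PiM (insert i I) M) (\<lambda>(y, v). v(i := y))) f"
    using assms(4) eq by simp
  then have *: "integrable (M i \<Otimes>\<^sub>M PiM I M) (\<lambda>(y, v). f (v(i := y)))"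
    by (subst (asm) integrable_distr_eq) (auto simp: case_prod_unfold intro: borel_measurable_integrable assms(4))
  show "integral\<^sup>L (PiM (insert i I) M) f = (\<integral>y. (\<integral>v. f (v(i := y)) \<partial>PiM I M) \<partial>M i)"
    using PP.Fubini_integral[OF *] product_integral_insert[OF assms(2-4)] by simp
  show "integrable (PiM I M) (\<lambda>v. \<integral>y. f (v(i := y)) \<partial>M i)"
    using PP.integrable_snd[OF *] by simp
  show "integrable (M i) (\<lambda>y. \<integral>v. f (v(i := y)) \<partial>PiM I M)"
    using PP.integrable_fst'[OF *] by simp
qed

text \<open>The offset \<open>h\<close> is arbitrary so that rows can be exchanged one at a time.
  \<open>F2\<close> is the hybrid in which row \<open>i\<close> is already linear while the rows in
  \<open>I\<close> still carry \<open>\<psi>\<close>: in the step to \<open>F2\<close> the rows of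
  \<open>I\<close> are absorbed into the offset, in the step to \<open>F3\<close> row
  \<open>i\<close> is.\<close>

lemma expectation_Max_PiM:
  fixes X :: "'a \<Rightarrow> 'z \<Rightarrow> real" and I :: "'i set"
  assumes "prob_space M" and T: "finite T" "T \<noteq> {}"
    and int: "\<And>z. z \<in> T \<Longrightarrow> integrable M (\<lambda>g. X g z)"
    and sym: "\<And>h. (\<integral>g. Max ((\<lambda>z. h z - 2 * L * X g z) ` T) \<partial>M) = (\<integral>g. Max ((\<lambda>z. h z + 2 * L * X g z) ` T) \<partial>M)"
    and meas[measurable]: "\<psi> \<in> borel_measurable borel"
    and lip: "\<And>a b. \<bar>\<psi> a - \<psi> b\<bar> \<le> L * \<bar>a - b\<bar>"
    and bnd: "\<And>a. 0 \<le> \<psi> a" "\<And>a. \<psi> a \<le> 1"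
    and kap: "\<And>z. z \<in> T \<Longrightarrow> (\<integral>g. \<psi> (X g z) \<partial>M) \<le> \<kappa>"
    and "finite I"
  shows "(\<integral>v. Max ((\<lambda>z. h z + (\<Sum>i\<in>I. \<psi> (X (v i) z) - \<kappa>)) ` T) \<partial>PiM I (\<lambda>_. M))
    \<le> (\<integral>v. Max ((\<lambda>z. h z + 2 * L * (\<Sum>i\<in>I. X (v i) z)) ` T) \<partial>PiM I (\<lambda>_. M))"
  using \<open>finite I\<close>
proof (induction I arbitrary: h rule: finite_induct)
  case (insert i I)
  interpret prob_space M by fact
  interpret PP: product_prob_space "\<lambda>_. M" by standard
  have [measurable]: "(\<lambda>g. X g z) \<in> borel_measurable M" if "z \<in> T" for z using int[OF that] by auto
  have ipsi: "integrable M (\<lambda>g. \<psi> (X g z))" if "z \<in> T" for z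
    using that bnd by (intro integrable_const_bound[where B=1]) auto
  let ?P = "PiM (insert i I) (\<lambda>_. M)"
  have iX: "integrable ?P (\<lambda>v. X (v j) z)" if "z \<in> T" "j \<in> insert i I" for z j
    using integrable_PiM_component[of "insert i I" "\<lambda>_. M" j "\<lambda>g. X g z"] that int prob_space_axioms by auto
  have iP: "integrable ?P (\<lambda>v. \<psi> (X (v j) z))" if "z \<in> T" "j \<in> insert i I" for z j
    using integrable_PiM_component[of "insert i I" "\<lambda>_. M" j "\<lambda>g. \<psi> (X g z)"] that ipsi prob_space_axioms by auto
  interpret Q: prob_space ?P by (intro prob_space_PiM prob_space_axioms)
  define F1 where "F1 = (\<lambda>v. Max ((\<lambda>z. h z + (\<Sum>i\<in>insert i I. \<psi> (X (v i) z) - \<kappa>)) ` T))"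
  define F2 where "F2 = (\<lambda>v. Max ((\<lambda>z. h z + (\<Sum>i\<in>I. \<psi> (X (v i) z) - \<kappa>) + 2 * L * X (v i) z) ` T))"
  define F3 where "F3 = (\<lambda>v. Max ((\<lambda>z. h z + 2 * L * (\<Sum>i\<in>insert i I. X (v i) z)) ` T))"
  have i1: "integrable ?P F1" unfolding F1_def
    by (intro integrable_Max_image T) (auto intro!: Bochner_Integration.integrable_sum Bochner_Integration.integrable_add iP Bochner_Integration.integrable_diff)
  have i2: "integrable ?P F2" unfolding F2_def
    by (intro integrable_Max_image T) (auto intro!: Bochner_Integration.integrable_sum Bochner_Integration.integrable_add iP iX Bochner_Integration.integrable_diff)
  have i3: "integrable ?P F3" unfolding F3_def
    by (intro integrable_Max_image T) (auto intro!: Bochner_Integration.integrable_sum Bochner_Integration.integrable_add iX)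
  have s: "(\<Sum>j\<in>I. f ((v(i := y)) j)) = (\<Sum>j\<in>I. f (v j))" for f :: "'a \<Rightarrow> real" and v y
    using insert.hyps by (intro sum.cong) auto
  have e1: "F1 (v(i := y)) = Max ((\<lambda>z. (h z + (\<Sum>i\<in>I. \<psi> (X (v i) z) - \<kappa>)) + (\<psi> (X y z) - \<kappa>)) ` T)" for v y
    using insert.hyps s[of "\<lambda>g. \<psi> (X g _) - \<kappa>"] unfolding F1_def by (simp add: add_ac)
  have e2: "F2 (v(i := y)) = Max ((\<lambda>z. (h z + (\<Sum>i\<in>I. \<psi> (X (v i) z) - \<kappa>)) + 2 * L * X y z) ` T)" for v y
    using insert.hyps s[of "\<lambda>g. \<psi> (X g _) - \<kappa>"] unfolding F2_def by (simp add: add_ac)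
  have e2': "F2 (v(i := y)) = Max ((\<lambda>z. (h z + 2 * L * X y z) + (\<Sum>i\<in>I. \<psi> (X (v i) z) - \<kappa>)) ` T)" for v y
    unfolding e2 by (simp add: add_ac)
  have e3: "F3 (v(i := y)) = Max ((\<lambda>z. (h z + 2 * L * X y z) + 2 * L * (\<Sum>i\<in>I. X (v i) z)) ` T)" for v y
    using insert.hyps s[of "\<lambda>g. X g _"] unfolding F3_def by (simp add: add_ac distrib_left)
  note sw = product_integral_insert_swap[OF PP.product_prob_space_axioms insert.hyps]
  have "integral\<^sup>L ?P F1 = (\<integral>v. \<integral>y. F1 (v(i := y)) \<partial>M \<partial>PiM I (\<lambda>_. M))"
    by (rule PP.product_integral_insert[OF insert.hyps i1])
  also have "\<dots> \<le> (\<integral>v. \<integral>y. F2 (v(i := y)) \<partial>M \<partial>PiM I (\<lambda>_. M))"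
    unfolding e1 e2
    by (intro integral_mono sw(2)[OF i1, unfolded e1] sw(2)[OF i2, unfolded e2]
        expectation_Max_step[OF \<open>prob_space M\<close> T int sym meas lip bnd kap])
  also have "\<dots> = integral\<^sup>L ?P F2"
    by (rule PP.product_integral_insert[OF insert.hyps i2, symmetric])
  also have "\<dots> = (\<integral>y. \<integral>v. F2 (v(i := y)) \<partial>PiM I (\<lambda>_. M) \<partial>M)"
    by (rule sw(1)[OF i2])
  also have "\<dots> \<le> (\<integral>y. \<integral>v. F3 (v(i := y)) \<partial>PiM I (\<lambda>_. M) \<partial>M)"
    unfolding e2' e3
    by (intro integral_mono sw(3)[OF i2, unfolded e2'] sw(3)[OF i3, unfolded e3] insert.IH)
  also have "\<dots> = integral\<^sup>L ?P F3"
    by (rule sw(1)[OF i3, symmetric])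
  finally show ?case unfolding F1_def F3_def .
qed simp

text \<open>McDiarmid's martingale argument as an induction on coordinates: averaging out coordinate
  \<open>i\<close> gives \<open>G\<close>, which keeps both the bound and the unit differences, and
  Hoeffding's lemma for \<open>F - G\<close> with the remaining coordinates fixed contributes a
  factor \<open>exp (l^2 / 8)\<close>.\<close>

lemma bounded_differences_mgf:
  fixes F :: "('i \<Rightarrow> 'a) \<Rightarrow> real"
  assumes "product_prob_space M" "finite I" "F \<in> borel_measurable (PiM I M)" "l > 0"
    and bdd: "\<And>v. v \<in> space (PiM I M) \<Longrightarrow> \<bar>F v\<bar> \<le> B"
    and diff: "\<And>v i y. v \<in> space (PiM I M) \<Longrightarrow> i \<in> I \<Longrightarrow> y \<in> space (M i) \<Longrightarrow> \<bar>F (v(i := y)) - F v\<bar> \<le> 1"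
  shows "(\<integral>\<^sup>+v. ennreal (exp (l * (F v - (\<integral>v. F v \<partial>PiM I M)))) \<partial>PiM I M) \<le> ennreal (exp (l\<^sup>2 * card I / 8))"
  using assms(2,3,5,6)
proof (induction I arbitrary: F rule: finite_induct)
  case empty
  then show ?case by (simp add: PiM_empty nn_integral_count_space_finite lebesgue_integral_count_space_finite)
next
  case (insert i I)
  interpret product_prob_space M by fact
  interpret PI: prob_space "PiM I M" by (intro prob_space_PiM prob_space)
  interpret PJ: prob_space "PiM (insert i I) M" by (intro prob_space_PiM prob_space)
  note [measurable] = insert.prems(1)
  have sp: "v(i := y) \<in> space (PiM (insert i I) M)" if "v \<in> space (PiM I M)" "y \<in> space (M i)" for v y
    using that by (auto simp: space_PiM PiE_iff extensional_def)
  have iF: "integrable (PiM (insert i I) M) F"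
    using insert.prems by (intro PJ.integrable_const_bound[where B=B]) auto
  note sw = product_integral_insert_swap[OF assms(1) insert.hyps iF]
  define G where "G = (\<lambda>v. \<integral>y. F (v(i := y)) \<partial>M i)"
  have mF[measurable]: "(\<lambda>y. F (v(i := y))) \<in> borel_measurable (M i)" if "v \<in> space (PiM I M)" for v
    using that by measurable
  have iFy: "integrable (M i) (\<lambda>y. F (v(i := y)))" if "v \<in> space (PiM I M)" for v
    using that insert.prems sp by (intro finite_measure.integrable_const_bound[OF prob_space.finite_measure[OF prob_space], where B=B]) auto
  have GF: "integral\<^sup>L (PiM (insert i I) M) F = integral\<^sup>L (PiM I M) G"
    using product_integral_insert[OF insert.hyps iF] unfolding G_def by simp
  have Gb: "\<bar>G v\<bar> \<le> B" if "v \<in> space (PiM I M)" for v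
  proof -
    have "\<bar>G v\<bar> \<le> (\<integral>y. \<bar>F (v(i := y))\<bar> \<partial>M i)" unfolding G_def by (rule integral_abs_bound)
    also have "\<dots> \<le> (\<integral>y. B \<partial>M i)"
      using iFy[OF that] insert.prems(2) sp[OF that] by (intro integral_mono) auto
    finally show ?thesis by (simp add: prob_space.prob_space[OF prob_space])
  qed
  have Gd: "\<bar>G (v(j := y)) - G v\<bar> \<le> 1" if v: "v \<in> space (PiM I M)" and j: "j \<in> I" and y: "y \<in> space (M j)" for v j y
  proof -
    have v': "v(j := y) \<in> space (PiM I M)" using v j y by (auto simp: space_PiM PiE_iff extensional_def)
    have "i \<noteq> j" using insert.hyps j by auto
    have "\<bar>G (v(j := y)) - G v\<bar> = \<bar>\<integral>x. F (v(j := y, i := x)) - F (v(i := x)) \<partial>M i\<bar>"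
      unfolding G_def using iFy[OF v] iFy[OF v'] by simp
    also have "\<dots> \<le> (\<integral>x. \<bar>F (v(j := y, i := x)) - F (v(i := x))\<bar> \<partial>M i)" by (rule integral_abs_bound)
    also have "\<dots> \<le> (\<integral>x. 1 \<partial>M i)"
    proof (intro integral_mono)
      fix x assume x: "x \<in> space (M i)"
      have "v(j := y, i := x) = (v(i := x))(j := y)" using \<open>i \<noteq> j\<close> by (rule fun_upd_twist[symmetric])
      then show "\<bar>F (v(j := y, i := x)) - F (v(i := x))\<bar> \<le> 1"
        using insert.prems(3)[OF sp[OF v x], of j y] j y by (simp del: fun_upd_apply)
    qed (use iFy[OF v] iFy[OF v'] in auto)
    finally show ?thesis by (simp add: prob_space.prob_space[OF prob_space])
  qed
  have mG[measurable]: "G \<in> borel_measurable (PiM I M)" using sw(2) unfolding G_def by auto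
  have H: "(\<integral>\<^sup>+y. ennreal (exp (l * (F (v(i := y)) - G v))) \<partial>M i) \<le> ennreal (exp (l\<^sup>2 / 8))"
    if v: "v \<in> space (PiM I M)" for v
  proof -
    obtain y0 where y0: "y0 \<in> space (M i)" using prob_space.not_empty[OF prob_space] by blast
    \<comment> \<open>Values of \<open>F\<close> that differ only in coordinate \<open>i\<close> are
      at most 1 apart, so all of them lie in an interval of length 1 starting at their infimum; the
      bound \<open>B\<close> makes this infimum meaningful.\<close>
    define a where "a = (INF y\<in>space (M i). F (v(i := y)))"
    have bb: "bdd_below ((\<lambda>y. F (v(i := y))) ` space (M i))"
      using insert.prems(2) sp[OF v] by (intro bdd_belowI2[where m="-B"]) (meson abs_le_D2 minus_le_iff)
    have "interval_bounded_random_variable (M i) (\<lambda>y. F (v(i := y))) a (a + 1)"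
    proof
      show "AE y in M i. F (v(i := y)) \<in> {a..a + 1}"
      proof (rule AE_I2)
        fix y assume y: "y \<in> space (M i)"
        have "F (v(i := y)) - 1 \<le> F (v(i := x))" if "x \<in> space (M i)" for x
          using insert.prems(3)[OF sp[OF v y], of i x] that by (simp del: fun_upd_apply add: abs_le_iff)
        then have "F (v(i := y)) - 1 \<le> a" unfolding a_def using y0 by (intro cINF_greatest) auto
        moreover have "a \<le> F (v(i := y))" unfolding a_def by (intro cINF_lower bb y)
        ultimately show "F (v(i := y)) \<in> {a..a + 1}" by auto
      qed
    qed (use mF[OF v] in auto)
    from interval_bounded_random_variable.Hoeffdings_lemma_nn_integral[OF this \<open>l > 0\<close>]
    show ?thesis unfolding G_def by simp
  qed
  let ?E = "integral\<^sup>L (PiM I M) G"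
  have "(\<integral>\<^sup>+v. ennreal (exp (l * (F v - integral\<^sup>L (PiM (insert i I) M) F))) \<partial>PiM (insert i I) M)
    = (\<integral>\<^sup>+v. \<integral>\<^sup>+y. ennreal (exp (l * (F (v(i := y)) - ?E))) \<partial>M i \<partial>PiM I M)"
    unfolding GF by (intro product_nn_integral_insert insert.hyps) measurable
  also have "\<dots> = (\<integral>\<^sup>+v. ennreal (exp (l * (G v - ?E))) * (\<integral>\<^sup>+y. ennreal (exp (l * (F (v(i := y)) - G v))) \<partial>M i) \<partial>PiM I M)"
  proof (intro nn_integral_cong)
    fix v assume v: "v \<in> space (PiM I M)"
    have "exp (l * (F (v(i := y)) - ?E)) = exp (l * (G v - ?E)) * exp (l * (F (v(i := y)) - G v))" for y
      by (simp add: exp_add[symmetric] algebra_simps)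
    then show "(\<integral>\<^sup>+y. ennreal (exp (l * (F (v(i := y)) - ?E))) \<partial>M i)
      = ennreal (exp (l * (G v - ?E))) * (\<integral>\<^sup>+y. ennreal (exp (l * (F (v(i := y)) - G v))) \<partial>M i)"
      using mF[OF v] by (simp add: ennreal_mult nn_integral_cmult)
  qed
  also have "\<dots> \<le> (\<integral>\<^sup>+v. ennreal (exp (l * (G v - ?E))) * ennreal (exp (l\<^sup>2 / 8)) \<partial>PiM I M)"
    by (intro nn_integral_mono mult_left_mono H) auto
  also have "\<dots> = (\<integral>\<^sup>+v. ennreal (exp (l * (G v - ?E))) \<partial>PiM I M) * ennreal (exp (l\<^sup>2 / 8))"
    by (intro nn_integral_multc) measurable
  also have "\<dots> \<le> ennreal (exp (l\<^sup>2 * card I / 8)) * ennreal (exp (l\<^sup>2 / 8))"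
    by (intro mult_right_mono insert.IH mG Gb Gd) auto
  also have "\<dots> = ennreal (exp (l\<^sup>2 * card (insert i I) / 8))"
    using insert.hyps by (simp add: ennreal_mult[symmetric] exp_add[symmetric] algebra_simps add_divide_distrib)
  finally show ?case .
qed

lemma bounded_differences_tail:
  fixes F :: "('i \<Rightarrow> 'a) \<Rightarrow> real"
  assumes "product_prob_space M" "finite I" "I \<noteq> {}" and [measurable]: "F \<in> borel_measurable (PiM I M)" and "a > 0"
    and bdd: "\<And>v. v \<in> space (PiM I M) \<Longrightarrow> \<bar>F v\<bar> \<le> B"
    and diff: "\<And>v i y. v \<in> space (PiM I M) \<Longrightarrow> i \<in> I \<Longrightarrow> y \<in> space (M i) \<Longrightarrow> \<bar>F (v(i := y)) - F v\<bar> \<le> 1"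
  shows "measure (PiM I M) {v \<in> space (PiM I M). (\<integral>v. F v \<partial>PiM I M) + a \<le> F v} \<le> exp (- 2 * a\<^sup>2 / card I)"
proof -
  interpret product_prob_space M by fact
  interpret PI: prob_space "PiM I M" by (intro prob_space_PiM prob_space)
  define k where "k = real (card I)"
  have "k > 0" using assms(2,3) by (simp add: k_def card_gt_0_iff)
  \<comment> \<open>This choice minimises the Chernoff exponent
    \<open>- l * a + l^2 * k / 8\<close>.\<close>
  define l where "l = 4 * a / k"
  have "l > 0" using \<open>k > 0\<close> \<open>a > 0\<close> by (simp add: l_def)
  let ?E = "\<integral>v. F v \<partial>PiM I M"
  let ?A = "{v \<in> space (PiM I M). ?E + a \<le> F v}"
  have "emeasure (PiM I M) ?A = (\<integral>\<^sup>+v. indicator ?A v \<partial>PiM I M)"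
    by (intro nn_integral_indicator[symmetric]) measurable
  also have "\<dots> \<le> (\<integral>\<^sup>+v. ennreal (exp (- l * a)) * ennreal (exp (l * (F v - ?E))) \<partial>PiM I M)"
  proof (intro nn_integral_mono)
    fix v
    have "1 \<le> exp (- l * a) * exp (l * (F v - ?E))" if "?E + a \<le> F v"
    proof -
      have "0 \<le> l * (F v - ?E - a)" using that \<open>l > 0\<close> by simp
      then show ?thesis by (simp add: exp_add[symmetric] algebra_simps)
    qed
    then have "ennreal 1 \<le> ennreal (exp (- l * a) * exp (l * (F v - ?E)))" if "?E + a \<le> F v"
      using that by (intro ennreal_leI) auto
    then show "indicator ?A v \<le> ennreal (exp (- l * a)) * ennreal (exp (l * (F v - ?E)))"
      by (auto simp: indicator_def ennreal_mult split: if_splits)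
  qed
  also have "\<dots> = ennreal (exp (- l * a)) * (\<integral>\<^sup>+v. ennreal (exp (l * (F v - ?E))) \<partial>PiM I M)"
    by (intro nn_integral_cmult) measurable
  also have "\<dots> \<le> ennreal (exp (- l * a)) * ennreal (exp (l\<^sup>2 * card I / 8))"
    by (intro mult_left_mono bounded_differences_mgf[OF assms(1,2,4) \<open>l > 0\<close> bdd diff]) auto
  also have "\<dots> = ennreal (exp (- l * a + l\<^sup>2 * k / 8))"
    by (simp add: ennreal_mult[symmetric] exp_add[symmetric] k_def)
  also have "- l * a + l\<^sup>2 * k / 8 = - 2 * a\<^sup>2 / k"
    using \<open>k > 0\<close> by (simp add: l_def field_simps power2_eq_square)
  finally show ?thesis
    by (simp add: finite_measure.emeasure_eq_measure[OF prob_space.finite_measure[OF prob_space_PiM[OF prob_space]]] k_def)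
qed

section \<open>Gaussian vectors\<close>

abbreviation std :: "real measure" where "std \<equiv> std_normal_distribution"

lemma prob_space_std: "prob_space std"
  by (simp add: prob_space_normal_density)

lemma distr_lborel_std: "distr M lborel f = distr M std f"
  by (intro distr_cong) auto

lemma prob_space_PiM_std: "prob_space (PiM I (\<lambda>_. std))"
  by (intro prob_space_PiM prob_space_std)

lemma indep_vars_PiM_std:
  assumes "I \<noteq> {}"
  shows "prob_space.indep_vars (PiM I (\<lambda>_. std)) (\<lambda>_. std) (\<lambda>i v. v i) I"
proof -
  interpret P: prob_space "PiM I (\<lambda>_. std)" by (rule prob_space_PiM_std)
  have "distr (PiM I (\<lambda>_. std)) (PiM I (\<lambda>_. std)) (\<lambda>v. \<lambda>i\<in>I. v i) = distr (PiM I (\<lambda>_. std)) (PiM I (\<lambda>_. std)) (\<lambda>v. v)"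
    by (intro distr_cong) (auto simp: space_PiM)
  also have "\<dots> = PiM I (\<lambda>_. std)" by (rule distr_id2) simp
  also have "\<dots> = (\<Pi>\<^sub>M i\<in>I. distr (PiM I (\<lambda>_. std)) std (\<lambda>v. v i))"
    by (intro PiM_cong distr_PiM_component[symmetric] prob_space_std) auto
  finally show ?thesis
    using assms by (subst P.indep_vars_iff_distr_eq_PiM') auto
qed

lemma distributed_linear_std:
  fixes c :: "'i \<Rightarrow> real"
  assumes I: "finite I" and pos: "(\<Sum>i\<in>I. (c i)\<^sup>2) > 0"
  shows "distributed (PiM I (\<lambda>_. std)) lborel (\<lambda>v. \<Sum>i\<in>I. c i * v i) (normal_density 0 (sqrt (\<Sum>i\<in>I. (c i)\<^sup>2)))"
proof -
  interpret P: prob_space "PiM I (\<lambda>_. std)" by (rule prob_space_PiM_std)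
  \<comment> \<open>The rule for sums of independent normal variables asks for positive standard
    deviations, so zero coefficients are dropped first.\<close>
  define J where "J = {i \<in> I. c i \<noteq> 0}"
  have J: "finite J" "J \<subseteq> I" using I by (auto simp: J_def)
  have s2: "(\<Sum>i\<in>I. (c i)\<^sup>2) = (\<Sum>i\<in>J. (c i)\<^sup>2)" and s1: "(\<Sum>i\<in>I. c i * v i) = (\<Sum>i\<in>J. c i * v i)" for v
    by (intro sum.mono_neutral_right; use I in \<open>auto simp: J_def\<close>)+
  have "J \<noteq> {}" using pos s2 by auto
  then have "I \<noteq> {}" using J by auto
  have d0: "distributed (PiM I (\<lambda>_. std)) lborel (\<lambda>v. v i) std_normal_density" if "i \<in> I" for i
  proof (subst distributed_def, intro conjI)
    have "distr (PiM I (\<lambda>_. std)) lborel (\<lambda>v. v i) = distr (PiM I (\<lambda>_. std)) std (\<lambda>v. v i)"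
      by (intro distr_cong) auto
    also have "\<dots> = std" using that by (intro distr_PiM_component prob_space_std)
    finally show "distr (PiM I (\<lambda>_. std)) lborel (\<lambda>v. v i) = density lborel (\<lambda>x. ennreal (std_normal_density x))" .
  qed (use that in auto)
  have d: "distributed (PiM I (\<lambda>_. std)) lborel (\<lambda>v. c i * v i) (normal_density 0 \<bar>c i\<bar>)" if "i \<in> J" for i
    using P.normal_density_affine[OF d0, of i "c i" 0] that J by (auto simp: J_def)
  have "P.indep_vars (\<lambda>_. borel) (\<lambda>i v. c i * v i) J"
    by (intro P.indep_vars_compose2[OF P.indep_vars_subset[OF indep_vars_PiM_std[OF \<open>I \<noteq> {}\<close>] J(2)]]) auto
  from P.sum_indep_normal[OF J(1) \<open>J \<noteq> {}\<close> this _ d]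
  show ?thesis unfolding s1 s2 by (simp add: J_def)
qed

lemma enorm_eq: "enorm n z = sqrt (\<Sum>i<n. (z i)\<^sup>2)"
  by (simp add: enorm_def L2_set_def)

lemma enorm_nonneg [simp]: "0 \<le> enorm n z"
  by (simp add: enorm_def)

lemma sets_gauss_vec [measurable_cong]: "sets (gauss_vec n) = sets (PiM {..<n} (\<lambda>_. borel))"
  unfolding gauss_vec_def by (intro sets_PiM_cong) auto

lemma prob_space_gauss_vec: "prob_space (gauss_vec n)"
  unfolding gauss_vec_def by (rule prob_space_PiM_std)

lemma measurable_dot [measurable]: "(\<lambda>g. dot n g z) \<in> borel_measurable (gauss_vec n)"
  unfolding dot_def by measurable

lemma measurable_enorm [measurable]: "enorm n \<in> borel_measurable (gauss_vec n)"
  unfolding enorm_eq[abs_def] by measurable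

lemma distributed_dot:
  assumes "enorm n z > 0"
  shows "distributed (gauss_vec n) lborel (\<lambda>g. dot n g z) (normal_density 0 (enorm n z))"
  using distributed_linear_std[of "{..<n}" z] assms
  by (simp add: enorm_eq gauss_vec_def dot_def mult.commute)

lemma dot_eq_0: "enorm n z = 0 \<Longrightarrow> dot n g z = 0"
  unfolding enorm_def dot_def by (subst (asm) L2_set_eq_0_iff) auto

lemma integrable_abs_dot: "integrable (gauss_vec n) (\<lambda>g. \<bar>dot n g z\<bar>)" (is ?A)
  and expectation_abs_dot: "(\<integral>g. \<bar>dot n g z\<bar> \<partial>gauss_vec n) = enorm n z * sqrt (2 / pi)" (is ?B)
proof -
  have "?A \<and> ?B"
  proof (cases "enorm n z = 0")
    case False
    then have p: "enorm n z > 0" using enorm_nonneg[of n z] by linarith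
    note d = distributed_dot[OF p]
    have h: "has_bochner_integral lborel (\<lambda>x. normal_density 0 (enorm n z) x * \<bar>x\<bar>) (enorm n z * sqrt (2 / pi))"
      using normal_moment_abs_odd[OF p, of 0 0] by simp
    show ?thesis
      using distributed_integrable[OF d, of abs] distributed_integral[OF d, of abs] h
      by (auto simp: has_bochner_integral_iff)
  qed (simp add: dot_eq_0)
  then show ?A ?B by auto
qed

lemma integrable_dot: "integrable (gauss_vec n) (\<lambda>g. dot n g z)"
  using integrable_abs_dot[of n z] by (rule integrable_abs_iff[THEN iffD1, rotated]) simp

lemma expectation_abs_dot_le: "(\<integral>g. \<bar>dot n g z\<bar> \<partial>gauss_vec n) \<le> enorm n z"
proof -
  have "sqrt (2 / pi) \<le> 1" using pi_gt3 by simp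
  then show ?thesis using mult_left_mono[of "sqrt (2/pi)" 1 "enorm n z"] by (simp add: expectation_abs_dot)
qed

text \<open>Since \<open>sqrt (2 * pi) \<ge> 2\<close>, the density of \<open>dot n g z\<close> is
  at most \<open>1 / (2 * enorm n z)\<close>, and the interval has length
  \<open>2 * a\<close>.\<close>

lemma small_ball_dot:
  assumes "enorm n z > 0" "a \<ge> 0"
  shows "measure (gauss_vec n) {g \<in> space (gauss_vec n). \<bar>dot n g z\<bar> \<le> a} \<le> a / enorm n z"
proof -
  interpret prob_space "gauss_vec n" by (rule prob_space_gauss_vec)
  let ?r = "enorm n z"
  have "emeasure (gauss_vec n) {g \<in> space (gauss_vec n). \<bar>dot n g z\<bar> \<le> a}
    = emeasure (gauss_vec n) ((\<lambda>g. dot n g z) -` {-a..a} \<inter> space (gauss_vec n))"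
    by (intro arg_cong[where f="emeasure (gauss_vec n)"]) auto
  also have "\<dots> = (\<integral>\<^sup>+x. ennreal (normal_density 0 ?r x) * indicator {-a..a} x \<partial>lborel)"
    by (intro distributed_emeasure[OF distributed_dot[OF assms(1)]]) auto
  also have "\<dots> \<le> (\<integral>\<^sup>+x. ennreal (1 / (2 * ?r)) * indicator {-a..a} x \<partial>lborel)"
  proof (intro nn_integral_mono mult_right_mono ennreal_leI)
    fix x :: real
    have "2 * ?r = sqrt 4 * sqrt (?r\<^sup>2)" using assms by simp
    also have "\<dots> \<le> sqrt (2 * pi) * sqrt (?r\<^sup>2)"
      using pi_gt3 by (intro mult_right_mono real_sqrt_le_mono) auto
    also have "\<dots> = sqrt (2 * pi * ?r\<^sup>2)" by (simp add: real_sqrt_mult)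
    finally have le: "2 * ?r \<le> sqrt (2 * pi * ?r\<^sup>2)" .
    have "normal_density 0 ?r x = exp (- (x\<^sup>2 / (2 * ?r\<^sup>2))) / sqrt (2 * pi * ?r\<^sup>2)"
      by (simp add: normal_density_def)
    also have "\<dots> \<le> 1 / (2 * ?r)" using le assms by (intro frac_le) auto
    finally show "normal_density 0 ?r x \<le> 1 / (2 * ?r)" .
  qed auto
  also have "\<dots> = ennreal (1 / (2 * ?r)) * ennreal (2 * a)"
    using assms by (subst nn_integral_cmult_indicator) auto
  also have "\<dots> = ennreal (a / ?r)"
    using assms by (subst ennreal_mult[symmetric]) (auto simp: field_simps)
  finally show ?thesis
    using assms by (simp add: emeasure_eq_measure)
qed

lemma abs_dot_le: "\<bar>dot n x y\<bar> \<le> enorm n x * enorm n y"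
proof -
  have "\<bar>dot n x y\<bar> \<le> (\<Sum>i<n. \<bar>x i\<bar> * \<bar>y i\<bar>)"
    unfolding dot_def by (rule order_trans[OF sum_abs]) (simp add: abs_mult)
  also have "\<dots> \<le> enorm n x * enorm n y" unfolding enorm_def by (rule L2_set_mult_ineq)
  finally show ?thesis .
qed

lemma expectation_enorm_le:
  assumes "n \<ge> 1"
  shows "integrable (gauss_vec n) (enorm n)" "(\<integral>g. enorm n g \<partial>gauss_vec n) \<le> sqrt n"
proof -
  interpret prob_space "gauss_vec n" by (rule prob_space_gauss_vec)
  have h: "has_bochner_integral std (\<lambda>x. x\<^sup>2) 1"
  proof -
    have "has_bochner_integral lborel (\<lambda>x. std_normal_density x * x\<^sup>2) 1"
      using std_normal_moment_even[of 1] by simp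
    then show ?thesis by (intro has_bochner_integral_density[where f="\<lambda>x. x\<^sup>2"]) auto
  qed
  have c: "integrable (gauss_vec n) (\<lambda>g. (g i)\<^sup>2)" "(\<integral>g. (g i)\<^sup>2 \<partial>gauss_vec n) = 1" if "i < n" for i
  proof -
    show "integrable (gauss_vec n) (\<lambda>g. (g i)\<^sup>2)"
      unfolding gauss_vec_def using that h by (intro integrable_PiM_component[where f="\<lambda>x. x\<^sup>2"] prob_space_std) (auto simp: has_bochner_integral_iff)
    have "(\<integral>g. (g i)\<^sup>2 \<partial>gauss_vec n) = (\<integral>x. x\<^sup>2 \<partial>distr (gauss_vec n) std (\<lambda>g. g i))"
      unfolding gauss_vec_def using that by (subst integral_distr) auto
    also have "\<dots> = (\<integral>x. x\<^sup>2 \<partial>std)"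
      unfolding gauss_vec_def using that by (subst distr_PiM_component) (auto simp: prob_space_std)
    finally show "(\<integral>g. (g i)\<^sup>2 \<partial>gauss_vec n) = 1" using h by (simp add: has_bochner_integral_iff)
  qed
  have i2: "integrable (gauss_vec n) (\<lambda>g. (enorm n g)\<^sup>2)"
    by (simp add: enorm_eq sum_nonneg) (intro Bochner_Integration.integrable_sum c, simp)
  have e2: "(\<integral>g. (enorm n g)\<^sup>2 \<partial>gauss_vec n) = n"
    by (simp add: enorm_eq sum_nonneg c)
  \<comment> \<open>The arithmetic-geometric mean inequality, tuned to equality at
    \<open>enorm n g = sqrt n\<close>, takes the place of Jensen's inequality: the second moment is
    exactly \<open>n\<close>.\<close>
  have le: "enorm n g \<le> (enorm n g)\<^sup>2 / (2 * sqrt n) + sqrt n / 2" for g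
  proof -
    have "0 \<le> (enorm n g - sqrt n)\<^sup>2 / (2 * sqrt n)" by simp
    also have "\<dots> = (enorm n g)\<^sup>2 / (2 * sqrt n) + sqrt n / 2 - enorm n g"
      using assms by (simp add: power2_diff field_simps)
    finally show ?thesis by simp
  qed
  show i: "integrable (gauss_vec n) (enorm n)"
    by (rule Bochner_Integration.integrable_bound[where f="\<lambda>g. (enorm n g)\<^sup>2 / (2 * sqrt n) + sqrt n / 2"])
       (use i2 le in \<open>auto intro!: AE_I2 simp: abs_of_nonneg\<close>)
  have "(\<integral>g. enorm n g \<partial>gauss_vec n) \<le> (\<integral>g. (enorm n g)\<^sup>2 / (2 * sqrt n) + sqrt n / 2 \<partial>gauss_vec n)"
    using i i2 le by (intro integral_mono) auto
  also have "\<dots> = sqrt n" using i2 e2 assms by (simp add: prob_space field_simps)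
  finally show "(\<integral>g. enorm n g \<partial>gauss_vec n) \<le> sqrt n" .
qed

lemma distr_neg_gauss_vec:
  "distr (gauss_vec n) (gauss_vec n) (compose {..<n} uminus) = gauss_vec n"
proof -
  have "distr std std uminus = std"
  proof -
    interpret prob_space std by (rule prob_space_std)
    have "distributed std lborel (\<lambda>x. x) std_normal_density"
      by (auto simp: distributed_def intro!: measurable_ident_sets[simplified id_def]) (subst distr_id2, auto)
    from normal_density_affine[OF this, of "-1" 0]
    have "distr std lborel uminus = std" by (simp add: distributed_def)
    then show ?thesis by (simp add: distr_lborel_std)
  qed
  then show ?thesis
    unfolding gauss_vec_def
    by (subst distr_PiM_finite_prob_space) (auto simp: product_prob_space_def product_prob_space_axioms_def product_sigma_finite_def prob_space_std prob_space_imp_sigma_finite)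
qed

section \<open>Regrouping of iterated product measures\<close>

lemma measurable_PiM_flatten:
  assumes "\<And>k. k \<in> K \<Longrightarrow> p k \<in> I" "\<And>k. k \<in> K \<Longrightarrow> q k \<in> J"
  shows "(\<lambda>v. \<lambda>k\<in>K. v (p k) (q k)) \<in> measurable (PiM I (\<lambda>_. PiM J (\<lambda>_. N))) (PiM K (\<lambda>_. N))"
proof (intro measurable_restrict)
  fix k assume k: "k \<in> K"
  have "(\<lambda>v. v (p k)) \<in> measurable (PiM I (\<lambda>_. PiM J (\<lambda>_. N))) (PiM J (\<lambda>_. N))"
    using assms k by (intro measurable_component_singleton) auto
  moreover have "(\<lambda>w. w (q k)) \<in> measurable (PiM J (\<lambda>_. N)) N"
    using assms k by (intro measurable_component_singleton[where M="\<lambda>_. N"]) auto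
  ultimately show "(\<lambda>v. v (p k) (q k)) \<in> measurable (PiM I (\<lambda>_. PiM J (\<lambda>_. N))) N"
    by (rule measurable_compose)
qed

text \<open>The bijection leaves the order of the two indices open, so the same statement reads a
  matrix by rows and, with \<open>p\<close> and \<open>q\<close> exchanged, by columns. The two
  measures agree on boxes, whose preimages are iterated boxes.\<close>

lemma distr_PiM_flatten:
  fixes p :: "'k \<Rightarrow> 'i" and q :: "'k \<Rightarrow> 'j"
  assumes fin: "finite I" "finite J" and N: "prob_space N"
    and bij: "bij_betw (\<lambda>k. (p k, q k)) K (I \<times> J)"
  shows "distr (PiM I (\<lambda>_. PiM J (\<lambda>_. N))) (PiM K (\<lambda>_. N)) (\<lambda>v. \<lambda>k\<in>K. v (p k) (q k)) = PiM K (\<lambda>_. N)"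
proof -
  have pq: "p k \<in> I" "q k \<in> J" if "k \<in> K" for k using bij that by (auto dest!: bij_betwE)
  have [measurable]: "(\<lambda>v. \<lambda>k\<in>K. v (p k) (q k)) \<in> measurable (PiM I (\<lambda>_. PiM J (\<lambda>_. N))) (PiM K (\<lambda>_. N))"
    using pq by (rule measurable_PiM_flatten)
  interpret N: prob_space N by fact
  interpret PK: product_prob_space "\<lambda>_::'k. N" K by standard
  interpret PN: product_prob_space "\<lambda>_::'j. N" J by standard
  interpret PJ: product_prob_space "\<lambda>_::'i. PiM J (\<lambda>_. N)"
    by (intro product_prob_spaceI prob_space_PiM N)
  have "finite K" using bij fin bij_betw_finite by blast
  define f where "f = inv_into K (\<lambda>k. (p k, q k))"
  have bf: "bij_betw f (I \<times> J) K" unfolding f_def by (rule bij_betw_inv_into[OF bij])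
  have fpq: "f (p k, q k) = k" if "k \<in> K" for k
    unfolding f_def using bij_betw_inv_into_left[OF bij that] by simp
  have fK: "f (i, j) \<in> K" "p (f (i, j)) = i" "q (f (i, j)) = j" if "i \<in> I" "j \<in> J" for i j
    using bij_betw_inv_into_right[OF bij, of "(i, j)"] bf that by (auto simp: f_def dest!: bij_betwE)
  show ?thesis
  proof (rule PK.PiM_eqI)
    fix A assume A: "\<And>k. k \<in> K \<Longrightarrow> A k \<in> sets N"
    have "(\<lambda>v. \<lambda>k\<in>K. v (p k) (q k)) -` Pi\<^sub>E K A \<inter> space (PiM I (\<lambda>_. PiM J (\<lambda>_. N)))
      = (\<Pi>\<^sub>E i\<in>I. \<Pi>\<^sub>E j\<in>J. A (f (i, j)))" (is "?L = ?R")
    proof (intro equalityI subsetI)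
      fix v assume "v \<in> ?L"
      then have v: "v \<in> space (PiM I (\<lambda>_. PiM J (\<lambda>_. N)))" "\<And>k. k \<in> K \<Longrightarrow> v (p k) (q k) \<in> A k" by (auto simp: PiE_iff)
      have "v i j \<in> A (f (i, j))" if "i \<in> I" "j \<in> J" for i j using v(2)[of "f (i, j)"] fK that by auto
      then show "v \<in> ?R" using v(1) by (auto simp: space_PiM PiE_iff)
    next
      fix v assume v: "v \<in> ?R"
      have "v (p k) (q k) \<in> A k" if "k \<in> K" for k
        using v pq[OF that] fpq[OF that] by (fastforce simp: PiE_iff)
      moreover have "v \<in> space (PiM I (\<lambda>_. PiM J (\<lambda>_. N)))"
        using v A[THEN sets.sets_into_space] fK by (fastforce simp: space_PiM PiE_iff)
      ultimately show "v \<in> ?L" by auto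
    qed
    then have "emeasure (distr (PiM I (\<lambda>_. PiM J (\<lambda>_. N))) (PiM K (\<lambda>_. N)) (\<lambda>v. \<lambda>k\<in>K. v (p k) (q k))) (Pi\<^sub>E K A)
      = emeasure (PiM I (\<lambda>_. PiM J (\<lambda>_. N))) ?R"
      using A \<open>finite K\<close> by (subst emeasure_distr) (auto intro!: sets_PiM_I_finite)
    also have "\<dots> = (\<Prod>i\<in>I. \<Prod>j\<in>J. emeasure N (A (f (i, j))))"
      using A fK fin by (subst PJ.emeasure_PiM) (auto intro!: prod.cong PN.emeasure_PiM sets_PiM_I_finite)
    also have "\<dots> = (\<Prod>x\<in>I \<times> J. emeasure N (A (f x)))"
      by (subst prod.cartesian_product) (simp add: case_prod_unfold)
    also have "\<dots> = (\<Prod>k\<in>K. emeasure N (A k))"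
      by (rule prod.reindex_bij_betw[OF bf])
    finally show "emeasure (distr (PiM I (\<lambda>_. PiM J (\<lambda>_. N))) (PiM K (\<lambda>_. N)) (\<lambda>v. \<lambda>k\<in>K. v (p k) (q k))) (Pi\<^sub>E K A)
      = (\<Prod>k\<in>K. emeasure N (A k))" .
  qed (use \<open>finite K\<close> in auto)
qed

lemma distr_sum_std:
  assumes "finite I" "I \<noteq> {}"
  shows "distr (PiM I (\<lambda>_. std)) std (\<lambda>v. \<Sum>i\<in>I. v i) = distr std std (\<lambda>x. sqrt (card I) * x)"
proof -
  interpret prob_space std by (rule prob_space_std)
  have c: "card I > 0" using assms by (simp add: card_gt_0_iff)
  have "distributed std lborel (\<lambda>x. x) std_normal_density"
    by (auto simp: distributed_def intro!: measurable_ident_sets[simplified id_def]) (subst distr_id2, auto)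
  from normal_density_affine[OF this, of "sqrt (card I)" 0] c
  have "distr std lborel (\<lambda>x. sqrt (card I) * x) = density lborel (normal_density 0 (sqrt (card I)))"
    by (simp add: distributed_def)
  moreover have "distr (PiM I (\<lambda>_. std)) lborel (\<lambda>v. \<Sum>i\<in>I. v i) = density lborel (normal_density 0 (sqrt (card I)))"
    using distributed_linear_std[OF assms(1), of "\<lambda>_. 1"] c by (simp add: distributed_def)
  ultimately show ?thesis by (simp add: distr_lborel_std)
qed

text \<open>In columns the sum over rows acts on each coordinate separately, so
  \<open>distr_sum_std\<close> applies there. Block \<open>A\<close> passes from rows to single
  entries, block \<open>B\<close> from entries to columns. The gain is that a sum of
  \<open>m\<close> rows costs a factor \<open>sqrt m\<close> and not \<open>m\<close>.\<close>

lemma expectation_sum_gauss_vec: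
  fixes F :: "(nat \<Rightarrow> real) \<Rightarrow> real"
  assumes I: "finite I" "I \<noteq> {}" and F[measurable]: "F \<in> borel_measurable (gauss_vec n)"
  shows "(\<integral>v. F (\<lambda>j\<in>{..<n}. \<Sum>i\<in>I. v i j) \<partial>PiM I (\<lambda>_. gauss_vec n))
    = (\<integral>g. F (\<lambda>j\<in>{..<n}. sqrt (card I) * g j) \<partial>gauss_vec n)"
proof -
  let ?J = "{..<n}"
  have [measurable]: "F \<in> borel_measurable (PiM ?J (\<lambda>_. std))" using F by (simp add: gauss_vec_def)
  have pp: "product_prob_space (\<lambda>_::nat. std)" "product_prob_space (\<lambda>_::nat. PiM I (\<lambda>_. std))"
    by (auto intro!: product_prob_spaceI prob_space_std prob_space_PiM_std)
  let ?G = "\<lambda>v. F (\<lambda>j\<in>?J. \<Sum>i\<in>I. v (i, j))"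
  have G: "?G \<in> borel_measurable (PiM (I \<times> ?J) (\<lambda>_. std))"
  proof -
    have "(\<lambda>v. \<lambda>j\<in>?J. \<Sum>i\<in>I. v (i, j)) \<in> measurable (PiM (I \<times> ?J) (\<lambda>_. std)) (PiM ?J (\<lambda>_. std))"
    proof (rule measurable_restrict)
      fix j assume "j \<in> ?J"
      then have "(\<lambda>v. \<Sum>i\<in>I. v (i, j)) \<in> borel_measurable (PiM (I \<times> ?J) (\<lambda>_. std))"
        by (intro borel_measurable_sum) auto
      then show "(\<lambda>v. \<Sum>i\<in>I. v (i, j)) \<in> measurable (PiM (I \<times> ?J) (\<lambda>_. std)) std" by simp
    qed
    from measurable_compose[OF this \<open>F \<in> borel_measurable (PiM ?J (\<lambda>_. std))\<close>] show ?thesis .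
  qed
  have A: "(\<integral>v. F (\<lambda>j\<in>?J. \<Sum>i\<in>I. v i j) \<partial>PiM I (\<lambda>_. gauss_vec n)) = integral\<^sup>L (PiM (I \<times> ?J) (\<lambda>_. std)) ?G"
  proof -
    have bij: "bij_betw (\<lambda>k. (fst k, snd k)) (I \<times> ?J) (I \<times> ?J)" by (simp add: bij_betw_def inj_on_def)
    have "integral\<^sup>L (PiM (I \<times> ?J) (\<lambda>_. std)) ?G
      = integral\<^sup>L (distr (PiM I (\<lambda>_. PiM ?J (\<lambda>_. std))) (PiM (I \<times> ?J) (\<lambda>_. std)) (\<lambda>v. \<lambda>k\<in>I \<times> ?J. v (fst k) (snd k))) ?G"
      by (subst distr_PiM_flatten[OF _ _ prob_space_std bij]) (use I in auto)
    also have "\<dots> = (\<integral>v. ?G (\<lambda>k\<in>I \<times> ?J. v (fst k) (snd k)) \<partial>PiM I (\<lambda>_. PiM ?J (\<lambda>_. std)))"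
      by (intro integral_distr measurable_PiM_flatten G) auto
    also have "\<dots> = (\<integral>v. F (\<lambda>j\<in>?J. \<Sum>i\<in>I. v i j) \<partial>PiM I (\<lambda>_. gauss_vec n))"
      unfolding gauss_vec_def
      by (intro Bochner_Integration.integral_cong refl arg_cong[where f=F] restrict_ext sum.cong) auto
    finally show ?thesis ..
  qed
  have B: "(\<integral>v. F (\<lambda>j\<in>?J. \<Sum>i\<in>I. v j i) \<partial>PiM ?J (\<lambda>_. PiM I (\<lambda>_. std))) = integral\<^sup>L (PiM (I \<times> ?J) (\<lambda>_. std)) ?G"
  proof -
    have bij: "bij_betw (\<lambda>k. (snd k, fst k)) (I \<times> ?J) (?J \<times> I)" by (rule bij_betwI[where g="\<lambda>(a, b). (b, a)"]) auto
    have "integral\<^sup>L (PiM (I \<times> ?J) (\<lambda>_. std)) ?G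
      = integral\<^sup>L (distr (PiM ?J (\<lambda>_. PiM I (\<lambda>_. std))) (PiM (I \<times> ?J) (\<lambda>_. std)) (\<lambda>v. \<lambda>k\<in>I \<times> ?J. v (snd k) (fst k))) ?G"
      by (subst distr_PiM_flatten[OF _ _ prob_space_std bij]) (use I in auto)
    also have "\<dots> = (\<integral>v. ?G (\<lambda>k\<in>I \<times> ?J. v (snd k) (fst k)) \<partial>PiM ?J (\<lambda>_. PiM I (\<lambda>_. std)))"
      by (intro integral_distr measurable_PiM_flatten G) auto
    also have "\<dots> = (\<integral>v. F (\<lambda>j\<in>?J. \<Sum>i\<in>I. v j i) \<partial>PiM ?J (\<lambda>_. PiM I (\<lambda>_. std)))"
      by (intro Bochner_Integration.integral_cong refl arg_cong[where f=F] restrict_ext sum.cong) auto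
    finally show ?thesis ..
  qed
  have C: "(\<integral>v. F (\<lambda>j\<in>?J. \<Sum>i\<in>I. v j i) \<partial>PiM ?J (\<lambda>_. PiM I (\<lambda>_. std)))
    = (\<integral>g. F g \<partial>distr (PiM ?J (\<lambda>_. PiM I (\<lambda>_. std))) (PiM ?J (\<lambda>_. std)) (compose ?J (\<lambda>w. \<Sum>i\<in>I. w i)))"
  proof -
    have "(\<lambda>v. \<lambda>j\<in>?J. \<Sum>i\<in>I. v j i) \<in> measurable (PiM ?J (\<lambda>_. PiM I (\<lambda>_. std))) (PiM ?J (\<lambda>_. std))"
    proof (rule measurable_restrict)
      fix j assume j: "j \<in> ?J"
      have "(\<lambda>w. \<Sum>i\<in>I. w i) \<in> measurable (PiM I (\<lambda>_. std)) std" by simp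
      from measurable_compose[OF measurable_component_singleton[OF j] this]
      show "(\<lambda>v. \<Sum>i\<in>I. v j i) \<in> measurable (PiM ?J (\<lambda>_. PiM I (\<lambda>_. std))) std" .
    qed
    then show ?thesis
      unfolding compose_def
      by (rule integral_distr[OF _ \<open>F \<in> borel_measurable (PiM ?J (\<lambda>_. std))\<close>, symmetric])
  qed
  have D: "(\<integral>g. F (\<lambda>j\<in>?J. sqrt (card I) * g j) \<partial>PiM ?J (\<lambda>_. std))
    = (\<integral>g. F g \<partial>distr (PiM ?J (\<lambda>_. std)) (PiM ?J (\<lambda>_. std)) (compose ?J (\<lambda>x. sqrt (card I) * x)))"
    unfolding compose_def
    by (rule integral_distr[OF _ \<open>F \<in> borel_measurable (PiM ?J (\<lambda>_. std))\<close>, symmetric]) measurable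
  show ?thesis
    unfolding A B[symmetric] C
    unfolding gauss_vec_def D
    by (subst (1 2) distr_PiM_finite_prob_space) (auto simp: pp distr_sum_std[OF I])
qed

section \<open>Uniform deviation\<close>

lemma dot_add_left: "dot n (\<lambda>j\<in>{..<n}. \<Sum>i\<in>I. v i j) z = (\<Sum>i\<in>I. dot n (v i) z)"
  unfolding dot_def by (subst sum.swap) (auto simp: sum_distrib_right)

lemma dot_scale_left: "dot n (\<lambda>j\<in>{..<n}. c * g j) z = c * dot n g z"
  unfolding dot_def by (simp add: sum_distrib_left mult.assoc)

lemma dot_neg_left: "dot n (compose {..<n} uminus g) z = - dot n g z"
  unfolding dot_def compose_def by (simp add: sum_negf)

lemma Max_dot_symmetric:
  assumes T: "finite T" "T \<noteq> {}"
  shows "(\<integral>g. Max ((\<lambda>z. h z - c * dot n g z) ` T) \<partial>gauss_vec n) = (\<integral>g. Max ((\<lambda>z. h z + c * dot n g z) ` T) \<partial>gauss_vec n)"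
proof -
  have [measurable]: "compose {..<n} uminus \<in> measurable (gauss_vec n) (gauss_vec n)"
    unfolding compose_def gauss_vec_def by measurable
  have [measurable]: "(\<lambda>g. Max ((\<lambda>z. h z + c * dot n g z) ` T)) \<in> borel_measurable (gauss_vec n)"
    using T by measurable
  have "(\<integral>g. Max ((\<lambda>z. h z + c * dot n g z) ` T) \<partial>distr (gauss_vec n) (gauss_vec n) (compose {..<n} uminus))
    = (\<integral>g. Max ((\<lambda>z. h z - c * dot n g z) ` T) \<partial>gauss_vec n)"
    by (subst integral_distr) (auto simp: dot_neg_left)
  then show ?thesis by (simp add: distr_neg_gauss_vec)
qed

lemma measurable_dot_row [measurable]:
  assumes "i \<in> I"
  shows "(\<lambda>v. dot n (v i) z) \<in> borel_measurable (PiM I (\<lambda>_. gauss_vec n))"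
  using measurable_compose[OF measurable_component_singleton[OF assms] measurable_dot] .

text \<open>By \<open>expectation_Max_PiM\<close> the expected maximum exceeds
  \<open>m * \<kappa>\<close> by at most a Gaussian maximum over the sum of the \<open>m\<close>
  rows, hence by \<open>2 * L * sqrt m * W\<close>. The excess \<open>m * s\<close> pays for the
  fluctuation, with unit differences because each row contributes a value in
  \<open>[0, 1]\<close>.\<close>

lemma uniform_deviation_finite:
  fixes T :: "(nat \<Rightarrow> real) set" and m :: nat and s \<kappa> L W :: real
  assumes T: "finite T" "T \<noteq> {}" and "m \<ge> 1" "s > 0"
    and meas[measurable]: "\<psi> \<in> borel_measurable borel"
    and lip: "\<And>a b. \<bar>\<psi> a - \<psi> b\<bar> \<le> L * \<bar>a - b\<bar>"
    and bnd: "\<And>a. 0 \<le> \<psi> a" "\<And>a. \<psi> a \<le> 1"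
    and kap: "\<And>z. z \<in> T \<Longrightarrow> (\<integral>g. \<psi> (dot n g z) \<partial>gauss_vec n) \<le> \<kappa>"
    and W: "(\<integral>g. Max ((\<lambda>z. \<bar>dot n g z\<bar>) ` T) \<partial>gauss_vec n) \<le> W"
  shows "measure (PiM {..<m} (\<lambda>_. gauss_vec n)) {v \<in> space (PiM {..<m} (\<lambda>_. gauss_vec n)).
      \<exists>z\<in>T. m * (\<kappa> + s) + 2 * L * sqrt m * W < (\<Sum>i<m. \<psi> (dot n (v i) z))} \<le> exp (- 2 * real m * s\<^sup>2)"
proof -
  interpret G: prob_space "gauss_vec n" by (rule prob_space_gauss_vec)
  have pp: "product_prob_space (\<lambda>_::nat. gauss_vec n)" by (intro product_prob_spaceI prob_space_gauss_vec)
  let ?P = "PiM {..<m} (\<lambda>_. gauss_vec n)"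
  interpret Q: prob_space ?P by (intro prob_space_PiM prob_space_gauss_vec)
  have "L \<ge> 0" using lip[of 1 0] by simp
  define F where "F = (\<lambda>v. Max ((\<lambda>z. \<Sum>i<m. \<psi> (dot n (v i) z)) ` T))"
  have [measurable]: "F \<in> borel_measurable ?P"
    unfolding F_def using T(1) by measurable
  have Fex: "\<exists>z\<in>T. F v = (\<Sum>i<m. \<psi> (dot n (v i) z))" for v
  proof -
    have "F v \<in> (\<lambda>z. \<Sum>i<m. \<psi> (dot n (v i) z)) ` T" unfolding F_def using T by (intro Max_in) auto
    then show ?thesis by auto
  qed
  have Fge: "(\<Sum>i<m. \<psi> (dot n (v i) z)) \<le> F v" if "z \<in> T" for v z
    unfolding F_def using T that by (intro Max_ge) auto
  have Fb: "\<bar>F v\<bar> \<le> m" for v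
  proof -
    obtain z where "F v = (\<Sum>i<m. \<psi> (dot n (v i) z))" using Fex by blast
    moreover have "0 \<le> (\<Sum>i<m. \<psi> (dot n (v i) z))" using bnd by (intro sum_nonneg) auto
    moreover have "(\<Sum>i<m. \<psi> (dot n (v i) z)) \<le> m" using bnd sum_bounded_above[of "{..<m}" "\<lambda>i. \<psi> (dot n (v i) z)" 1] by auto
    ultimately show ?thesis by auto
  qed
  have upd: "F (v(i := y)) \<le> F v + 1" if "i < m" for v i y
  proof -
    obtain z where z: "z \<in> T" "F (v(i := y)) = (\<Sum>j<m. \<psi> (dot n ((v(i := y)) j) z))" using Fex by blast
    have s: "(\<Sum>j<m. f ((v(i := y)) j)) = f y + (\<Sum>j\<in>{..<m} - {i}. f (v j))" for f :: "(nat \<Rightarrow> real) \<Rightarrow> real"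
      using that by (subst sum.remove[of _ i]) auto
    have s': "(\<Sum>j<m. f (v j)) = f (v i) + (\<Sum>j\<in>{..<m} - {i}. f (v j))" for f :: "(nat \<Rightarrow> real) \<Rightarrow> real"
      using that by (subst sum.remove[of _ i]) auto
    have "F (v(i := y)) \<le> (\<Sum>j<m. \<psi> (dot n (v j) z)) + 1"
      unfolding z(2) s[of "\<lambda>w. \<psi> (dot n w z)"] s'[of "\<lambda>w. \<psi> (dot n w z)"]
      using bnd(1)[of "dot n (v i) z"] bnd(2)[of "dot n y z"] by simp
    then show ?thesis using Fge[OF z(1), of v] by linarith
  qed
  \<comment> \<open>The reverse inequality comes from undoing the change: updating
    \<open>v(i := y)\<close> at \<open>i\<close> with \<open>v i\<close> gives \<open>v\<close>
    back.\<close>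
  have Fd: "\<bar>F (v(i := y)) - F v\<bar> \<le> 1" if "i < m" for v i y
    using upd[OF that, of v y] upd[OF that, of "v(i := y)" "v i"] by simp
  have "(\<integral>v. F v \<partial>?P) = (\<integral>v. Max ((\<lambda>z. m * \<kappa> + (\<Sum>i<m. \<psi> (dot n (v i) z) - \<kappa>)) ` T) \<partial>?P)"
    unfolding F_def by (simp add: sum_subtractf)
  also have "\<dots> \<le> (\<integral>v. Max ((\<lambda>z. m * \<kappa> + 2 * L * (\<Sum>i<m. dot n (v i) z)) ` T) \<partial>?P)"
    by (rule expectation_Max_PiM[OF prob_space_gauss_vec T integrable_dot Max_dot_symmetric[OF T] meas lip bnd kap]) auto
  also have "\<dots> = (\<integral>g. Max ((\<lambda>z. m * \<kappa> + 2 * L * (sqrt m * dot n g z)) ` T) \<partial>gauss_vec n)"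
  proof -
    have "(\<lambda>g. Max ((\<lambda>z. m * \<kappa> + 2 * L * dot n g z) ` T)) \<in> borel_measurable (gauss_vec n)"
      using T(1) by measurable
    from expectation_sum_gauss_vec[OF _ _ this, of "{..<m}"] \<open>m \<ge> 1\<close>
    show ?thesis by (simp add: dot_add_left dot_scale_left lessThan_empty_iff)
  qed
  also have "\<dots> \<le> (\<integral>g. m * \<kappa> + 2 * L * sqrt m * Max ((\<lambda>z. \<bar>dot n g z\<bar>) ` T) \<partial>gauss_vec n)"
  proof (intro integral_mono)
    show "integrable (gauss_vec n) (\<lambda>g. Max ((\<lambda>z. m * \<kappa> + 2 * L * (sqrt m * dot n g z)) ` T))"
      using T by (intro integrable_Max_image) (auto intro!: integrable_dot)
    show "integrable (gauss_vec n) (\<lambda>g. m * \<kappa> + 2 * L * sqrt m * Max ((\<lambda>z. \<bar>dot n g z\<bar>) ` T))"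
      using T integrable_Max_image[of T "gauss_vec n" "\<lambda>z g. \<bar>dot n g z\<bar>"] integrable_abs_dot by auto
    fix g
    have "m * \<kappa> + 2 * L * (sqrt m * dot n g z) \<le> m * \<kappa> + 2 * L * sqrt m * Max ((\<lambda>z. \<bar>dot n g z\<bar>) ` T)" if "z \<in> T" for z
    proof -
      have "dot n g z \<le> \<bar>dot n g z\<bar>" by simp
      also have "\<dots> \<le> Max ((\<lambda>z. \<bar>dot n g z\<bar>) ` T)" using that T by (intro Max_ge) auto
      finally show ?thesis using mult_left_mono[of "dot n g z" _ "2 * L * sqrt m"] \<open>L \<ge> 0\<close> by simp
    qed
    then show "Max ((\<lambda>z. m * \<kappa> + 2 * L * (sqrt m * dot n g z)) ` T) \<le> m * \<kappa> + 2 * L * sqrt m * Max ((\<lambda>z. \<bar>dot n g z\<bar>) ` T)"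
      using T by auto
  qed
  also have "\<dots> = m * \<kappa> + 2 * L * sqrt m * (\<integral>g. Max ((\<lambda>z. \<bar>dot n g z\<bar>) ` T) \<partial>gauss_vec n)"
    using T integrable_Max_image[of T "gauss_vec n" "\<lambda>z g. \<bar>dot n g z\<bar>"] integrable_abs_dot by (simp add: G.prob_space)
  also have "\<dots> \<le> m * \<kappa> + 2 * L * sqrt m * W"
    using W \<open>L \<ge> 0\<close> by (intro add_left_mono mult_left_mono) auto
  finally have E: "(\<integral>v. F v \<partial>?P) \<le> m * \<kappa> + 2 * L * sqrt m * W" .
  have "measure ?P {v \<in> space ?P. \<exists>z\<in>T. m * (\<kappa> + s) + 2 * L * sqrt m * W < (\<Sum>i<m. \<psi> (dot n (v i) z))}
    \<le> measure ?P {v \<in> space ?P. (\<integral>v. F v \<partial>?P) + m * s \<le> F v}"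
  proof (intro Q.finite_measure_mono subsetI)
    fix v assume "v \<in> {v \<in> space ?P. \<exists>z\<in>T. m * (\<kappa> + s) + 2 * L * sqrt m * W < (\<Sum>i<m. \<psi> (dot n (v i) z))}"
    then obtain z where v: "v \<in> space ?P" and z: "z \<in> T" "m * (\<kappa> + s) + 2 * L * sqrt m * W < (\<Sum>i<m. \<psi> (dot n (v i) z))" by auto
    then have "m * (\<kappa> + s) + 2 * L * sqrt m * W < F v" using Fge[OF z(1), of v] by linarith
    then show "v \<in> {v \<in> space ?P. (\<integral>v. F v \<partial>?P) + m * s \<le> F v}" using v E by (auto simp: algebra_simps)
  qed measurable
  also have "\<dots> \<le> exp (- 2 * (m * s)\<^sup>2 / card {..<m})"
    using \<open>m \<ge> 1\<close> \<open>s > 0\<close> by (intro bounded_differences_tail[OF pp, where B=m] Fb Fd) (auto simp: lessThan_empty_iff)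
  also have "- 2 * (m * s)\<^sup>2 / card {..<m} = - 2 * real m * s\<^sup>2"
    using \<open>m \<ge> 1\<close> by (simp add: power2_eq_square)
  finally show ?thesis .
qed

text \<open>Finiteness carries weight here: \<open>enn2real\<close> of an infinite width is
  0.\<close>

lemma expectation_Max_le_mean_width:
  assumes T: "finite T" "T \<noteq> {}" "T \<subseteq> S" and fin: "mean_width n S < \<infinity>"
  shows "(\<integral>g. Max ((\<lambda>z. \<bar>dot n g z\<bar>) ` T) \<partial>gauss_vec n) \<le> enn2real (mean_width n S)"
proof -
  have i: "integrable (gauss_vec n) (\<lambda>g. Max ((\<lambda>z. \<bar>dot n g z\<bar>) ` T))"
    using T by (intro integrable_Max_image integrable_abs_dot)
  have nn: "0 \<le> Max ((\<lambda>z. \<bar>dot n g z\<bar>) ` T)" for g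
    using T by (auto simp: Max_ge_iff)
  have "ennreal (\<integral>g. Max ((\<lambda>z. \<bar>dot n g z\<bar>) ` T) \<partial>gauss_vec n) = (\<integral>\<^sup>+g. ennreal (Max ((\<lambda>z. \<bar>dot n g z\<bar>) ` T)) \<partial>gauss_vec n)"
    using nn by (intro nn_integral_eq_integral[symmetric] i) auto
  also have "\<dots> \<le> mean_width n S"
    unfolding mean_width_def
  proof (intro nn_integral_mono)
    fix g
    have "Max ((\<lambda>z. \<bar>dot n g z\<bar>) ` T) \<in> (\<lambda>z. \<bar>dot n g z\<bar>) ` T" using T by (intro Max_in) auto
    then show "ennreal (Max ((\<lambda>z. \<bar>dot n g z\<bar>) ` T)) \<le> (SUP x\<in>S. ennreal \<bar>dot n g x\<bar>)"
      using T(3) by (auto intro!: SUP_upper)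
  qed
  finally have "enn2real (ennreal (\<integral>g. Max ((\<lambda>z. \<bar>dot n g z\<bar>) ` T) \<partial>gauss_vec n)) \<le> enn2real (mean_width n S)"
    using fin by (intro enn2real_mono) (auto simp: infinity_ennreal_def)
  then show ?thesis using nn by (simp add: integral_nonneg_AE)
qed

lemma continuous_dot: "continuous_on UNIV (\<lambda>z. dot n g z)"
  unfolding dot_def by (intro continuous_intros continuous_on_product_coordinates)

text \<open>The strict inequality is an open condition in \<open>z\<close>, so it may be tested on a
  countable dense subset \<open>D\<close> of \<open>S\<close>; this gives measurability. The finite
  bound is independent of the number of points, so it passes to \<open>D\<close> by continuity of
  the measure along its initial pieces.\<close>

lemma uniform_deviation:
  fixes S :: "(nat \<Rightarrow> real) set" and m :: nat and s \<kappa> L a :: real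
  assumes "S \<noteq> {}" "m \<ge> 1" "s > 0"
    and lip: "\<And>a b. \<bar>\<psi> a - \<psi> b\<bar> \<le> L * \<bar>a - b\<bar>"
    and bnd: "\<And>a. 0 \<le> \<psi> a" "\<And>a. \<psi> a \<le> 1"
    and kap: "\<And>z. z \<in> S \<Longrightarrow> (\<integral>g. \<psi> (dot n g z) \<partial>gauss_vec n) \<le> \<kappa>"
    and fin: "mean_width n S < \<infinity>"
    and a: "m * (\<kappa> + s) + 2 * L * sqrt m * enn2real (mean_width n S) \<le> a"
  shows "{v \<in> space (PiM {..<m} (\<lambda>_. gauss_vec n)). \<exists>z\<in>S. a < (\<Sum>i<m. \<psi> (dot n (v i) z))}
      \<in> sets (PiM {..<m} (\<lambda>_. gauss_vec n))" (is "?B \<in> _")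
    and "measure (PiM {..<m} (\<lambda>_. gauss_vec n)) {v \<in> space (PiM {..<m} (\<lambda>_. gauss_vec n)).
      \<exists>z\<in>S. a < (\<Sum>i<m. \<psi> (dot n (v i) z))} \<le> exp (- 2 * real m * s\<^sup>2)"
proof -
  let ?P = "PiM {..<m} (\<lambda>_. gauss_vec n)"
  interpret Q: prob_space ?P by (intro prob_space_PiM prob_space_gauss_vec)
  have "L \<ge> 0" using lip[of 1 0] by simp
  have "L-lipschitz_on UNIV \<psi>"
    using lip \<open>L \<ge> 0\<close> by (intro lipschitz_onI) (auto simp: dist_real_def)
  then have cont: "continuous_on UNIV \<psi>" by (rule lipschitz_on_continuous_on)
  then have [measurable]: "\<psi> \<in> borel_measurable borel" by (rule borel_measurable_continuous_onI)
  have cf: "continuous_on UNIV (\<lambda>z. \<Sum>i<m. \<psi> (dot n (v i) z))" for v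
    by (intro continuous_on_sum continuous_on_compose2[OF cont continuous_dot]) auto
  obtain D where D: "countable D" "D \<subseteq> S" "S \<subseteq> closure D" by (rule separable)
  have "D \<noteq> {}" using D \<open>S \<noteq> {}\<close> by auto
  define A where "A k = {v \<in> space ?P. \<exists>z\<in>from_nat_into D ` {..k}. a < (\<Sum>i<m. \<psi> (dot n (v i) z))}" for k
  have mA[measurable]: "A k \<in> sets ?P" for k unfolding A_def by measurable
  have "\<exists>z\<in>D. a < (\<Sum>i<m. \<psi> (dot n (v i) z))" if z: "z \<in> S" "a < (\<Sum>i<m. \<psi> (dot n (v i) z))" for v z
  proof -
    have "open {z. a < (\<Sum>i<m. \<psi> (dot n (v i) z))}"
      using open_Collect_less[OF continuous_on_const cf[of v], of a] by simp
    then show ?thesis using z D(3) open_Int_closure_eq_empty[of "{z. a < (\<Sum>i<m. \<psi> (dot n (v i) z))}" D] by blast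
  qed
  then have "?B = {v \<in> space ?P. \<exists>z\<in>D. a < (\<Sum>i<m. \<psi> (dot n (v i) z))}" using D(2) by blast
  also have "\<dots> = (\<Union>k. A k)"
    unfolding A_def by (subst range_from_nat_into[OF \<open>D \<noteq> {}\<close> D(1), symmetric]) blast
  finally have BA: "?B = (\<Union>k. A k)" .
  show "?B \<in> sets ?P" unfolding BA by measurable
  have "measure ?P (A k) \<le> exp (- 2 * real m * s\<^sup>2)" for k
  proof -
    let ?T = "from_nat_into D ` {..k}"
    have T: "finite ?T" "?T \<noteq> {}" "?T \<subseteq> S" using from_nat_into[OF \<open>D \<noteq> {}\<close>] D(2) by auto
    have "measure ?P (A k) \<le> measure ?P {v \<in> space ?P.
      \<exists>z\<in>?T. m * (\<kappa> + s) + 2 * L * sqrt m * enn2real (mean_width n S) < (\<Sum>i<m. \<psi> (dot n (v i) z))}"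
      unfolding A_def using a by (intro Q.finite_measure_mono) (auto intro: le_less_trans)
    also have "\<dots> \<le> exp (- 2 * real m * s\<^sup>2)"
      using T by (intro uniform_deviation_finite assms expectation_Max_le_mean_width) auto
    finally show ?thesis .
  qed
  moreover have "(\<lambda>k. measure ?P (A k)) \<longlonglongrightarrow> measure ?P (\<Union>k. A k)"
    by (intro Q.finite_Lim_measure_incseq) (auto simp: A_def incseq_def intro: order_trans)
  ultimately show "measure ?P ?B \<le> exp (- 2 * real m * s\<^sup>2)"
    unfolding BA by (intro LIMSEQ_le_const2) auto
qed

lemma mean_width_le:
  assumes "n \<ge> 1" "\<rho> \<ge> 0" "\<And>z. z \<in> S \<Longrightarrow> enorm n z \<le> \<rho>"
  shows "mean_width n S \<le> ennreal (\<rho> * sqrt n)"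
proof -
  have "mean_width n S \<le> (\<integral>\<^sup>+g. ennreal (\<rho> * enorm n g) \<partial>gauss_vec n)"
    unfolding mean_width_def
  proof (intro nn_integral_mono SUP_least ennreal_leI)
    fix g z assume "z \<in> S"
    then show "\<bar>dot n g z\<bar> \<le> \<rho> * enorm n g"
      using abs_dot_le[of n g z] mult_left_mono[OF assms(3), of z "enorm n g"] by (simp add: mult.commute)
  qed
  also have "\<dots> = ennreal (\<integral>g. \<rho> * enorm n g \<partial>gauss_vec n)"
    using assms expectation_enorm_le(1)[of n] by (intro nn_integral_eq_integral) auto
  also have "\<dots> \<le> ennreal (\<rho> * sqrt n)"
    using assms expectation_enorm_le(2)[of n] by (intro ennreal_leI) (auto intro: mult_left_mono)
  finally show ?thesis .
qed

text \<open>Positivity matters because the theorem contains \<open>inverse (w^2)\<close>: since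
  \<open>inverse 0 = 0\<close>, a vanishing width would erase the term in
  \<open>\<eta>\<close>.\<close>

lemma mean_width_pos:
  assumes "z \<in> S" "enorm n z > 0"
  shows "mean_width n S > 0"
proof -
  have "0 < ennreal (\<integral>g. \<bar>dot n g z\<bar> \<partial>gauss_vec n)"
    using assms by (simp add: expectation_abs_dot)
  also have "\<dots> = (\<integral>\<^sup>+g. ennreal \<bar>dot n g z\<bar> \<partial>gauss_vec n)"
    by (intro nn_integral_eq_integral[symmetric] integrable_abs_dot) auto
  also have "\<dots> \<le> mean_width n S"
    unfolding mean_width_def using assms by (intro nn_integral_mono SUP_upper)
  finally show ?thesis .
qed

section \<open>Nets of Euclidean balls\<close>

lemma sum_geometric_two_sided:
  assumes "R > 0"
  shows "(\<Sum>j\<in>{-int b..int b}. exp (- real_of_int \<bar>j\<bar> / R)) \<le> 1 + 2 * R"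
proof -
  define q where "q = exp (- 1 / R)"
  have q: "q > 0" by (simp add: q_def)
  \<comment> \<open>This yields \<open>q / (1 - q) \<le> R\<close>, the ratio that controls both
    geometric tails. The induction keeps the remainder \<open>q ^ b\<close> explicit so that its
    step closes.\<close>
  have "1 + 1 / R \<le> exp (1 / R)" by (rule exp_ge_add_one_self)
  then have "q * (1 + 1 / R) \<le> q * exp (1 / R)" using q by (intro mult_left_mono) auto
  also have "\<dots> = 1" by (simp add: q_def exp_add[symmetric])
  finally have qR: "q \<le> R * (1 - q)" using assms by (simp add: field_simps)
  have e: "exp (- real_of_int \<bar>j\<bar> / R) = q ^ nat \<bar>j\<bar>" for j
    by (simp add: q_def exp_of_nat_mult[symmetric] field_simps)
  have "(\<Sum>j\<in>{-int b..int b}. q ^ nat \<bar>j\<bar>) \<le> 1 + 2 * R * (1 - q ^ b)"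
  proof (induction b)
    case (Suc b)
    have "{-int (Suc b)..int (Suc b)} = insert (int (Suc b)) (insert (- int (Suc b)) {-int b..int b})" by auto
    then have "(\<Sum>j\<in>{-int (Suc b)..int (Suc b)}. q ^ nat \<bar>j\<bar>) = 2 * q ^ Suc b + (\<Sum>j\<in>{-int b..int b}. q ^ nat \<bar>j\<bar>)"
      by (simp add: nat_add_distrib)
    also have "\<dots> \<le> 2 * (q ^ b * (R * (1 - q))) + (1 + 2 * R * (1 - q ^ b))"
    proof (rule add_mono[OF _ Suc])
      show "2 * q ^ Suc b \<le> 2 * (q ^ b * (R * (1 - q)))"
        using q mult_left_mono[OF qR, of "q ^ b"] by (simp add: mult.commute)
    qed
    also have "\<dots> = 1 + 2 * R * (1 - q ^ Suc b)" by (simp add: algebra_simps)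
    finally show ?case .
  qed simp
  also have "\<dots> \<le> 1 + 2 * R" using assms q by (simp add: algebra_simps)
  finally show ?thesis by (simp only: e)
qed

text \<open>Every lattice point counted has weight at least \<open>exp (- n)\<close> under the product weight
  \<open>exp (- \<bar>k\<^sub>i\<bar> / R)\<close>, whose total mass is a product of geometric series.\<close>

lemma card_lattice_l1_ball:
  fixes R :: real and n :: nat
  assumes "R > 0"
  defines "K \<equiv> {k \<in> {..<n} \<rightarrow>\<^sub>E (UNIV :: int set). (\<Sum>i<n. \<bar>k i\<bar>) \<le> R * n}"
  shows "finite K" "real (card K) \<le> (exp 1 * (1 + 2 * R)) ^ n"
proof -
  define b where "b = nat \<lceil>R * n\<rceil>"
  let ?P = "{..<n} \<rightarrow>\<^sub>E {-int b..int b}"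
  have "K \<subseteq> ?P"
  proof
    fix k assume k: "k \<in> K"
    have "k i \<in> {-int b..int b}" if "i < n" for i
    proof -
      have "\<bar>k i\<bar> \<le> (\<Sum>i<n. \<bar>k i\<bar>)" using that by (intro member_le_sum) auto
      also have "real_of_int \<dots> \<le> R * n" using k by (simp add: K_def)
      finally have "\<bar>k i\<bar> \<le> \<lceil>R * n\<rceil>" by linarith
      moreover have "0 \<le> \<lceil>R * n\<rceil>"
      proof -
        have "0 \<le> R * n" using assms(1) by simp
        then show ?thesis by linarith
      qed
      ultimately show ?thesis by (auto simp: b_def)
    qed
    then show "k \<in> ?P" using k by (auto simp: K_def PiE_iff)
  qed
  moreover have fP: "finite ?P" by (intro finite_PiE) auto
  ultimately show fK: "finite K" by (rule finite_subset)
  have "real (card K) = (\<Sum>k\<in>K. 1)" by simp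
  also have "\<dots> \<le> (\<Sum>k\<in>K. exp n * (\<Prod>i<n. exp (- real_of_int \<bar>k i\<bar> / R)))"
  proof (intro sum_mono)
    fix k assume "k \<in> K"
    then have "(\<Sum>i<n. real_of_int \<bar>k i\<bar>) / R \<le> n" using assms(1) by (simp add: K_def field_simps)
    then have "1 \<le> exp (n + - ((\<Sum>i<n. real_of_int \<bar>k i\<bar>) / R))" by simp
    also have "\<dots> = exp n * (\<Prod>i<n. exp (- real_of_int \<bar>k i\<bar> / R))"
      by (simp only: exp_add sum_negf[symmetric] sum_divide_distrib minus_divide_left exp_sum[OF finite_lessThan])
    finally show "1 \<le> exp n * (\<Prod>i<n. exp (- real_of_int \<bar>k i\<bar> / R))" .
  qed
  also have "\<dots> \<le> (\<Sum>k\<in>?P. exp n * (\<Prod>i<n. exp (- real_of_int \<bar>k i\<bar> / R)))"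
    using \<open>K \<subseteq> ?P\<close> fP by (intro sum_mono2) (auto intro!: mult_nonneg_nonneg prod_nonneg)
  also have "\<dots> = exp n * (\<Prod>i<n. \<Sum>j\<in>{-int b..int b}. exp (- real_of_int \<bar>j\<bar> / R))"
    using infsetsum_prod_PiE[of "{..<n}" "\<lambda>_. {-int b..int b}" "\<lambda>_ j. exp (- real_of_int \<bar>j\<bar> / R)"]
    by (simp add: sum_distrib_left[symmetric] infsetsum_finite fP)
  also have "\<dots> \<le> exp n * (\<Prod>i<n. 1 + 2 * R)"
    by (intro mult_left_mono prod_mono conjI sum_geometric_two_sided assms(1)) (auto intro: sum_nonneg)
  also have "\<dots> = (exp 1 * (1 + 2 * R)) ^ n"
    by (simp add: power_mult_distrib exp_of_nat_mult[symmetric])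
  finally show "real (card K) \<le> (exp 1 * (1 + 2 * R)) ^ n" .
qed

lemma sum_abs_le_enorm: "(\<Sum>i<n. \<bar>x i\<bar>) \<le> sqrt n * enorm n x"
  using L2_set_mult_ineq[of "\<lambda>_. 1" x "{..<n}"] by (simp add: enorm_def L2_set_def)

text \<open>The net is a cubic lattice around \<open>c\<close> of mesh
  \<open>\<epsilon> / sqrt n\<close>, so rounding costs at most \<open>\<epsilon>\<close> in norm.
  By Cauchy-Schwarz the integer coordinates have absolute sum at most
  \<open>n * \<rho> / \<epsilon>\<close>, and rounding adds at most \<open>n\<close>. This is the
  lattice count with \<open>R = \<rho> / \<epsilon> + 1\<close>, and \<open>1 + 2 * R\<close> is the
  base of the power. Net points may lie outside the ball.\<close>

lemma ball_net:
  assumes "n \<ge> 1" "\<rho> \<ge> 0" "\<epsilon> > 0"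
  obtains N :: "(nat \<Rightarrow> real) set" where "finite N" "real (card N) \<le> (exp 1 * (3 + 2 * \<rho> / \<epsilon>)) ^ n"
    "\<And>x. enorm n (\<lambda>i. x i - c i) \<le> \<rho> \<Longrightarrow> \<exists>p\<in>N. enorm n (\<lambda>i. x i - p i) \<le> \<epsilon>"
proof -
  define R where "R = \<rho> / \<epsilon> + 1"
  have R: "R > 0" using assms by (simp add: R_def add_nonneg_pos)
  define h where "h = \<epsilon> / sqrt n"
  have h: "h > 0" using assms by (simp add: h_def)
  define K where "K = {k \<in> {..<n} \<rightarrow>\<^sub>E (UNIV :: int set). (\<Sum>i<n. \<bar>k i\<bar>) \<le> R * n}"
  note cK = card_lattice_l1_ball[OF R, of n, folded K_def]
  define N where "N = (\<lambda>k i. c i + h * real_of_int (k i)) ` K"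
  have "real (card N) \<le> real (card K)" unfolding N_def using cK(1) by (simp add: card_image_le)
  also note cK(2)
  also have "1 + 2 * R = 3 + 2 * \<rho> / \<epsilon>" by (simp add: R_def)
  finally have "real (card N) \<le> (exp 1 * (3 + 2 * \<rho> / \<epsilon>)) ^ n" .
  moreover have "finite N" unfolding N_def using cK(1) by simp
  moreover have "\<exists>p\<in>N. enorm n (\<lambda>i. x i - p i) \<le> \<epsilon>" if x: "enorm n (\<lambda>i. x i - c i) \<le> \<rho>" for x
  proof -
    define k where "k = (\<lambda>i\<in>{..<n}. \<lfloor>(x i - c i) / h\<rfloor>)"
    have "(\<Sum>i<n. real_of_int \<bar>k i\<bar>) \<le> (\<Sum>i<n. \<bar>x i - c i\<bar> / h + 1)"
    proof (intro sum_mono)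
      fix i assume "i \<in> {..<n}"
      moreover have "\<bar>real_of_int \<lfloor>y\<rfloor>\<bar> \<le> \<bar>y\<bar> + 1" for y :: real by linarith
      ultimately have "real_of_int \<bar>k i\<bar> \<le> \<bar>(x i - c i) / h\<bar> + 1" by (simp only: k_def of_int_abs restrict_apply')
      then show "real_of_int \<bar>k i\<bar> \<le> \<bar>x i - c i\<bar> / h + 1" using h by simp
    qed
    also have "\<dots> = (\<Sum>i<n. \<bar>x i - c i\<bar>) / h + n" by (simp add: sum.distrib sum_divide_distrib)
    also have "\<dots> \<le> sqrt n * \<rho> / h + n"
      using h order_trans[OF sum_abs_le_enorm[of "\<lambda>i. x i - c i" n] mult_left_mono[OF x, of "sqrt n"]]
      by (intro add_right_mono divide_right_mono) auto
    also have "\<dots> = R * n" using assms by (simp add: R_def h_def field_simps)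
    finally have "k \<in> K" by (simp add: K_def k_def)
    moreover have "enorm n (\<lambda>i. x i - (c i + h * real_of_int (k i))) \<le> \<epsilon>"
    proof -
      have "\<bar>x i - (c i + h * real_of_int (k i))\<bar> \<le> h" if "i < n" for i
      proof -
        have "x i - (c i + h * real_of_int (k i)) = h * ((x i - c i) / h - real_of_int (k i))"
          using h by (simp add: field_simps)
        moreover have "0 \<le> (x i - c i) / h - real_of_int (k i)" "(x i - c i) / h - real_of_int (k i) \<le> 1"
          using that by (simp_all add: k_def) linarith
        ultimately show ?thesis using h by (simp add: abs_mult)
      qed
      then have "enorm n (\<lambda>i. x i - (c i + h * real_of_int (k i))) \<le> L2_set (\<lambda>_. h) {..<n}"
        unfolding enorm_def L2_set_def using h by (intro real_sqrt_le_mono sum_mono) (simp add: abs_le_square_iff[symmetric])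
      also have "\<dots> = \<epsilon>" using h assms by (simp add: L2_set_def h_def real_sqrt_mult)
      finally show ?thesis .
    qed
    ultimately show ?thesis unfolding N_def by (intro bexI[OF _ imageI])
  qed
  ultimately show ?thesis using that by blast
qed

section \<open>Dithered separation of a pair\<close>

lemma prob_space_dither: "\<delta> > 0 \<Longrightarrow> prob_space (uniform_measure lborel {0..\<delta>::real})"
  by (rule prob_space_uniform_measure) auto

text \<open>While the dither runs through \<open>[0, \<delta>]\<close>, a multiple of
  \<open>\<delta>\<close> lies between the shifted points on a set of length at least
  \<open>l\<close>. This set may wrap around the end of the range; keeping a single piece of length
  at least \<open>l / 2\<close> costs the factor 2.\<close>

lemma floor_separation:
  assumes "\<delta> > 0" "0 < l" "l \<le> \<delta>" and le: "y + l \<le> z"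
  shows "l / (2 * \<delta>) \<le> measure (uniform_measure lborel {0..\<delta>}) {x. \<lfloor>(y + x) / \<delta>\<rfloor> < \<lfloor>(z + x) / \<delta>\<rfloor>}"
proof -
  let ?U = "uniform_measure lborel {0..\<delta>}" and ?A = "{x. \<lfloor>(y + x) / \<delta>\<rfloor> < \<lfloor>(z + x) / \<delta>\<rfloor>}"
  interpret prob_space ?U using assms by (intro prob_space_dither)
  define k where "k = \<lfloor>y / \<delta>\<rfloor>"
  \<comment> \<open>At dither \<open>x0\<close> the lower point reaches the next threshold
    \<open>(k + 1) * \<delta>\<close>; dithers slightly below \<open>x0\<close> separate.\<close>
  define x0 where "x0 = (k + 1) * \<delta> - y"
  have "k \<le> y / \<delta>" "y / \<delta> < k + 1" unfolding k_def by linarith+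
  then have x0: "0 < x0" "x0 \<le> \<delta>" using assms by (auto simp: x0_def field_simps)
  have sep: "x \<in> ?A" if "y + x < j * \<delta>" "j * \<delta> \<le> z + x" for x and j :: int
  proof -
    have "(y + x) / \<delta> < j" "j \<le> (z + x) / \<delta>" using that assms by (auto simp: field_simps)
    then have "\<lfloor>(y + x) / \<delta>\<rfloor> < j" "j \<le> \<lfloor>(z + x) / \<delta>\<rfloor>" by (auto simp: floor_less_iff le_floor_iff)
    then show ?thesis by simp
  qed
  have [measurable]: "?A \<in> sets borel" by measurable
  have main: "l / (2 * \<delta>) \<le> measure ?U ?A" if ab: "{p<..<q} \<subseteq> ?A" "0 \<le> p" "q \<le> \<delta>" "l / 2 \<le> q - p" for p q
  proof -
    have "measure ?U {p<..<q} = measure lborel ({0..\<delta>} \<inter> {p<..<q}) / measure lborel {0..\<delta>}"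
      using assms by (intro measure_uniform_measure) auto
    also have "{0..\<delta>} \<inter> {p<..<q} = {p<..<q}" using ab by auto
    finally have "measure ?U {p<..<q} = (q - p) / \<delta>" using assms ab by simp
    moreover have "measure ?U {p<..<q} \<le> measure ?U ?A" using ab by (intro finite_measure_mono) auto
    moreover have "l / 2 / \<delta> \<le> (q - p) / \<delta>" using ab assms by (intro divide_right_mono) auto
    ultimately show ?thesis by simp
  qed
  show ?thesis
  proof (cases "l / 2 \<le> x0")
    case True
    show ?thesis
    proof (rule main[of "max 0 (x0 - l)" x0])
      show "{max 0 (x0 - l)<..<x0} \<subseteq> ?A"
        by (intro subsetI sep[of _ "k + 1"]) (use le in \<open>auto simp: x0_def\<close>)
    qed (use True x0 assms in \<open>auto simp: max_def\<close>)
  next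
    case False
    \<comment> \<open>Now \<open>x0 < l / 2\<close>, so more than half of the set has wrapped to the
      upper end of the range, where the separating threshold is
      \<open>(k + 2) * \<delta>\<close>.\<close>
    show ?thesis
    proof (rule main[of "x0 + \<delta> - l" \<delta>])
      show "{x0 + \<delta> - l<..<\<delta>} \<subseteq> ?A"
        by (intro subsetI sep[of _ "k + 2"]) (use le x0 in \<open>auto simp: x0_def algebra_simps\<close>)
    qed (use False x0 assms in auto)
  qed
qed

text \<open>Rows and dithers live in two separate products, so independence of the pairs (row,
  dither) across indices is recovered here by Fubini.\<close>

lemma nn_integral_prod_PiM_pair:
  fixes M :: "'a measure" and N :: "'b measure" and I :: "'i set"
  assumes "prob_space M" "prob_space N" "finite I" and [measurable]: "f \<in> borel_measurable (M \<Otimes>\<^sub>M N)"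
  shows "(\<integral>\<^sup>+x. (\<Prod>i\<in>I. f (fst x i, snd x i)) \<partial>(PiM I (\<lambda>_. M) \<Otimes>\<^sub>M PiM I (\<lambda>_. N))) = (\<integral>\<^sup>+x. f x \<partial>(M \<Otimes>\<^sub>M N)) ^ card I"
proof -
  interpret M: prob_space M by fact
  interpret N: prob_space N by fact
  interpret PM: product_sigma_finite "\<lambda>_::'i. M" by standard
  interpret PN: product_sigma_finite "\<lambda>_::'i. N" by standard
  interpret QN: prob_space "PiM I (\<lambda>_. N)" by (intro prob_space_PiM assms)
  have "(\<integral>\<^sup>+x. (\<Prod>i\<in>I. f (fst x i, snd x i)) \<partial>(PiM I (\<lambda>_. M) \<Otimes>\<^sub>M PiM I (\<lambda>_. N)))
    = (\<integral>\<^sup>+v. \<integral>\<^sup>+w. (\<Prod>i\<in>I. f (v i, w i)) \<partial>PiM I (\<lambda>_. N) \<partial>PiM I (\<lambda>_. M))"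
    by (subst QN.nn_integral_fst[symmetric]) auto
  also have "\<dots> = (\<integral>\<^sup>+v. (\<Prod>i\<in>I. \<integral>\<^sup>+y. f (v i, y) \<partial>N) \<partial>PiM I (\<lambda>_. M))"
  proof (intro nn_integral_cong PN.product_nn_integral_prod assms)
    fix v i assume "v \<in> space (PiM I (\<lambda>_. M))" "i \<in> I"
    then have "v i \<in> space M" by (auto simp: space_PiM)
    then show "(\<lambda>y. f (v i, y)) \<in> borel_measurable N" by measurable
  qed
  also have "\<dots> = (\<Prod>i\<in>I. \<integral>\<^sup>+x. \<integral>\<^sup>+y. f (x, y) \<partial>N \<partial>M)"
    by (intro PM.product_nn_integral_prod assms) measurable
  also have "\<dots> = (\<integral>\<^sup>+x. f x \<partial>(M \<Otimes>\<^sub>M N)) ^ card I"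
    by (subst N.nn_integral_fst) auto
  finally show ?thesis .
qed

text \<open>Chernoff's bound with exponent -1: per row,
  \<open>E exp (- indicator S) \<le> 1 - q / 2 \<le> exp (- q / 2)\<close>, so Markov's inequality
  gives \<open>exp (m q / 4 - m q / 2)\<close>.\<close>

lemma lower_tail_count:
  fixes M :: "'a measure" and N :: "'b measure" and m :: nat and q :: real
  assumes "prob_space M" "prob_space N" and S[measurable]: "S \<in> sets (M \<Otimes>\<^sub>M N)"
    and q: "0 \<le> q" "q \<le> measure (M \<Otimes>\<^sub>M N) S"
  defines "P \<equiv> PiM {..<m} (\<lambda>_. M) \<Otimes>\<^sub>M PiM {..<m} (\<lambda>_. N)"
  shows "measure P {x \<in> space P. (\<Sum>i<m. indicator S (fst x i, snd x i)) \<le> m * q / 4} \<le> exp (- (m * q / 4))"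
proof -
  interpret M: prob_space M by fact
  interpret N: prob_space N by fact
  interpret MN: pair_prob_space M N ..
  interpret PM: prob_space "PiM {..<m} (\<lambda>_. M)" by (intro prob_space_PiM assms)
  interpret PN: prob_space "PiM {..<m} (\<lambda>_. N)" by (intro prob_space_PiM assms)
  interpret PP: pair_prob_space "PiM {..<m} (\<lambda>_. M)" "PiM {..<m} (\<lambda>_. N)" ..
  let ?g = "\<lambda>x. exp (- indicator S x) :: real"
  let ?A = "{x \<in> space P. (\<Sum>i<m. indicator S (fst x i, snd x i)) \<le> m * q / 4}"
  have [measurable]: "?A \<in> sets P" unfolding P_def by measurable
  have "(\<integral>\<^sup>+x. ennreal (?g x) \<partial>(M \<Otimes>\<^sub>M N)) \<le> (\<integral>\<^sup>+x. ennreal (1 - indicator S x / 2) \<partial>(M \<Otimes>\<^sub>M N))"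
  proof (intro nn_integral_mono ennreal_leI)
    fix x
    have "2 \<le> exp (1::real)" using exp_ge_add_one_self[of "1::real"] by simp
    then have "exp (- 1 :: real) \<le> 1 / 2" by (simp add: exp_minus field_simps)
    then show "?g x \<le> 1 - indicator S x / 2" by (auto simp: indicator_def)
  qed
  also have "\<dots> = ennreal (\<integral>x. 1 - indicator S x / 2 \<partial>(M \<Otimes>\<^sub>M N))"
  proof (intro nn_integral_eq_integral)
    show "AE x in M \<Otimes>\<^sub>M N. 0 \<le> 1 - indicator S x / (2::real)" by (auto simp: indicator_def)
  qed (simp add: less_top[symmetric])
  also have "(\<integral>x. 1 - indicator S x / 2 \<partial>(M \<Otimes>\<^sub>M N)) = 1 - measure (M \<Otimes>\<^sub>M N) S / 2"
    using MN.prob_space by (simp add: less_top[symmetric])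
  also have "ennreal \<dots> \<le> ennreal (exp (- q / 2))"
  proof (intro ennreal_leI)
    show "1 - measure (M \<Otimes>\<^sub>M N) S / 2 \<le> exp (- q / 2)"
      using q exp_ge_add_one_self[of "- q / 2"] by linarith
  qed
  finally have g: "(\<integral>\<^sup>+x. ennreal (?g x) \<partial>(M \<Otimes>\<^sub>M N)) \<le> ennreal (exp (- q / 2))" .
  have "emeasure P ?A = (\<integral>\<^sup>+x. indicator ?A x \<partial>P)" by (rule nn_integral_indicator[symmetric]) measurable
  also have "\<dots> \<le> (\<integral>\<^sup>+x. ennreal (exp (m * q / 4)) * (\<Prod>i<m. ennreal (?g (fst x i, snd x i))) \<partial>P)"
  proof (intro nn_integral_mono)
    fix x
    have "(\<Prod>i<m. ennreal (?g (fst x i, snd x i))) = ennreal (exp (- (\<Sum>i<m. indicator S (fst x i, snd x i))))"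
      by (simp add: prod_ennreal exp_sum[symmetric] sum_negf)
    then have e: "ennreal (exp (m * q / 4)) * (\<Prod>i<m. ennreal (?g (fst x i, snd x i)))
      = ennreal (exp (m * q / 4 - (\<Sum>i<m. indicator S (fst x i, snd x i))))"
      by (simp add: ennreal_mult[symmetric] exp_add[symmetric])
    show "indicator ?A x \<le> ennreal (exp (m * q / 4)) * (\<Prod>i<m. ennreal (?g (fst x i, snd x i)))"
    proof (cases "x \<in> ?A")
      case True
      then have "ennreal 1 \<le> ennreal (exp (m * q / 4 - (\<Sum>i<m. indicator S (fst x i, snd x i))))"
        by (intro ennreal_leI) simp
      then show ?thesis using True unfolding e by simp
    qed simp
  qed
  also have "\<dots> = ennreal (exp (m * q / 4)) * (\<integral>\<^sup>+x. ennreal (?g x) \<partial>(M \<Otimes>\<^sub>M N)) ^ m"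
    unfolding P_def
    by (subst nn_integral_cmult) (auto simp: nn_integral_prod_PiM_pair[OF assms(1,2), where f="\<lambda>x. ennreal (?g x)"])
  also have "\<dots> \<le> ennreal (exp (m * q / 4)) * ennreal (exp (- q / 2)) ^ m"
    by (intro mult_left_mono power_mono g) auto
  also have "\<dots> = ennreal (exp (- (m * q / 4)))"
    by (simp add: ennreal_power ennreal_mult[symmetric] exp_of_nat_mult[symmetric] exp_add[symmetric])
  finally show ?thesis
    unfolding P_def by (simp add: PP.emeasure_eq_measure)
qed

section \<open>Measurability and geometry\<close>

text \<open>The randomness of \<open>map_law\<close> with the matrix entries grouped into rows, so
  that independence of the rows is part of the product structure.\<close>

definition rows_law :: "nat \<Rightarrow> nat \<Rightarrow> real \<Rightarrow> ((nat \<Rightarrow> nat \<Rightarrow> real) \<times> (nat \<Rightarrow> real)) measure"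
  where "rows_law m n \<delta> = PiM {..<m} (\<lambda>_. gauss_vec n) \<Otimes>\<^sub>M PiM {..<m} (\<lambda>_. uniform_measure lborel {0..\<delta>})"

lemma prob_space_rows_law: "\<delta> > 0 \<Longrightarrow> prob_space (rows_law m n \<delta>)"
  unfolding rows_law_def
  by (intro prob_space_pair prob_space_PiM prob_space_gauss_vec prob_space_dither)

lemma map_law_eq_distr:
  assumes "\<delta> > 0"
  shows "map_law m n \<delta> = distr (rows_law m n \<delta>) (map_law m n \<delta>)
    (\<lambda>(v, w). (\<lambda>k\<in>{..<m} \<times> {..<n}. v (fst k) (snd k), w))"
proof -
  let ?K = "{..<m} \<times> {..<n}" and ?f = "\<lambda>v. \<lambda>k\<in>{..<m} \<times> {..<n}. v (fst k) (snd k)"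
  let ?D = "PiM {..<m} (\<lambda>_. uniform_measure lborel {0..\<delta>})" and ?G = "PiM {..<m} (\<lambda>_. gauss_vec n)"
  interpret D: prob_space ?D using assms by (intro prob_space_PiM prob_space_dither)
  have bij: "bij_betw (\<lambda>k. (fst k, snd k)) ?K ({..<m} \<times> {..<n})" by (simp add: bij_betw_def inj_on_def)
  have 1: "distr ?G (PiM ?K (\<lambda>_. std)) ?f = PiM ?K (\<lambda>_. std)"
    unfolding gauss_vec_def by (rule distr_PiM_flatten[OF _ _ prob_space_std bij]) auto
  have 2: "distr ?D ?D (\<lambda>w. w) = ?D" by (rule distr_id2) simp
  have [measurable]: "?f \<in> measurable ?G (PiM ?K (\<lambda>_. std))"
    unfolding gauss_vec_def by (rule measurable_PiM_flatten) auto
  have "distr ?G (PiM ?K (\<lambda>_. std)) ?f \<Otimes>\<^sub>M distr ?D ?D (\<lambda>w. w)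
    = distr (?G \<Otimes>\<^sub>M ?D) (PiM ?K (\<lambda>_. std) \<Otimes>\<^sub>M ?D) (\<lambda>(v, w). (?f v, w))"
    unfolding 2 by (subst pair_measure_distr[of _ _ _ "\<lambda>w. w" ?D ?D, unfolded 2]) (auto simp: D.sigma_finite_measure_axioms)
  then show ?thesis unfolding 1 2 by (simp add: map_law_def rows_law_def)
qed

lemma dot_rows:
  assumes "i < m"
  shows "(\<Sum>j<n. (\<lambda>k\<in>{..<m} \<times> {..<n}. v (fst k) (snd k)) (i, j) * x j) = dot n (v i) x"
  unfolding dot_def using assms by (intro sum.cong) auto

section \<open>Measurability of the event in the theorem\<close>

lemma quant_map_eq_iff:
  assumes "\<delta> > 0"
  shows "quant_map m n \<delta> \<omega> x = quant_map m n \<delta> \<omega> y \<longleftrightarrow>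
    (\<forall>i<m. \<lfloor>((\<Sum>j<n. fst \<omega> (i, j) * x j) + snd \<omega> i) / \<delta>\<rfloor> = \<lfloor>((\<Sum>j<n. fst \<omega> (i, j) * y j) + snd \<omega> i) / \<delta>\<rfloor>)"
  using assms by (auto simp: quant_map_def quant_def fun_eq_iff)

text \<open>The quantifier over an uncountable set is traded for countable ones: relax the
  constraints by \<open>1 / Suc k\<close>, ask for a solution in a countable dense subset for every
  \<open>k\<close>, and obtain an exact solution as a limit point. Compactness provides the limit,
  and the constraints survive it because they are closed.\<close>

lemma sets_exists_compact:
  fixes S :: "(nat \<Rightarrow> real) set" and f :: "nat \<Rightarrow> 'a \<Rightarrow> (nat \<Rightarrow> real) \<Rightarrow> real"
  assumes S: "compact S"
    and meas: "\<And>i x. i < m \<Longrightarrow> (\<lambda>\<omega>. f i \<omega> x) \<in> borel_measurable M"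
    and cont: "\<And>i \<omega>. i < m \<Longrightarrow> continuous_on UNIV (f i \<omega>)"
  shows "{\<omega> \<in> space M. \<exists>x\<in>S. \<forall>i<m. l i \<le> f i \<omega> x \<and> f i \<omega> x \<le> u i} \<in> sets M"
proof -
  obtain D where D: "countable D" "D \<subseteq> S" "S \<subseteq> closure D" by (rule separable)
  let ?near = "\<lambda>k \<omega> x. \<forall>i<m. l i - 1 / Suc k < f i \<omega> x \<and> f i \<omega> x < u i + 1 / Suc k"
  have eq: "(\<exists>x\<in>S. \<forall>i<m. l i \<le> f i \<omega> x \<and> f i \<omega> x \<le> u i) \<longleftrightarrow> (\<forall>k::nat. \<exists>x\<in>D. ?near k \<omega> x)" (is "?L \<longleftrightarrow> ?R") for \<omega>
  proof
    assume ?L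
    then obtain x where x: "x \<in> S" "\<And>i. i < m \<Longrightarrow> l i \<le> f i \<omega> x \<and> f i \<omega> x \<le> u i" by blast
    show ?R
    proof
      fix k
      let ?O = "\<Inter>i\<in>{..<m}. {x. l i - 1 / Suc k < f i \<omega> x} \<inter> {x. f i \<omega> x < u i + 1 / Suc k}"
      have "open ?O"
        by (intro open_INT ballI open_Int open_Collect_less cont continuous_on_const) auto
      moreover have "x \<in> ?O"
      proof
        fix i assume "i \<in> {..<m}"
        then have "l i \<le> f i \<omega> x" "f i \<omega> x \<le> u i" using x(2) by auto
        moreover have "0 < 1 / real (Suc k)" by simp
        ultimately have "l i - 1 / Suc k < f i \<omega> x" "f i \<omega> x < u i + 1 / Suc k" by linarith+
        then show "x \<in> {x. l i - 1 / Suc k < f i \<omega> x} \<inter> {x. f i \<omega> x < u i + 1 / Suc k}" by simp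
      qed
      ultimately have "?O \<inter> D \<noteq> {}" using x(1) D(3) open_Int_closure_eq_empty[of ?O D] by blast
      then show "\<exists>x\<in>D. ?near k \<omega> x" by auto
    qed
  next
    assume ?R
    then obtain y where y: "\<And>k. y k \<in> D" "\<And>k. ?near k \<omega> (y k)" by metis
    have "seq_compact S" using S by (rule compact_imp_seq_compact)
    then obtain x r where x: "x \<in> S" "strict_mono (r :: nat \<Rightarrow> nat)" "(y \<circ> r) \<longlonglongrightarrow> x"
      using y(1) D(2) by (rule_tac seq_compactE[of S y]) auto
    have "l i \<le> f i \<omega> x \<and> f i \<omega> x \<le> u i" if i: "i < m" for i
    proof -
      have "isCont (f i \<omega>) x" using cont[OF i] by (simp add: continuous_on_eq_continuous_at)
      from isCont_tendsto_compose[OF this x(3)]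
      have lim: "(\<lambda>k. f i \<omega> (y (r k))) \<longlonglongrightarrow> f i \<omega> x" by (simp add: o_def)
      have e: "(\<lambda>k. 1 / real (Suc (r k))) \<longlonglongrightarrow> 0"
        using LIMSEQ_subseq_LIMSEQ[OF LIMSEQ_inverse_real_of_nat x(2)] by (simp add: o_def inverse_eq_divide)
      have l: "(\<lambda>k. l i - 1 / real (Suc (r k))) \<longlonglongrightarrow> l i"
        using tendsto_diff[OF tendsto_const[of "l i"] e] by simp
      have u: "(\<lambda>k. u i + 1 / real (Suc (r k))) \<longlonglongrightarrow> u i"
        using tendsto_add[OF tendsto_const[of "u i"] e] by simp
      have "l i - 1 / real (Suc (r k)) \<le> f i \<omega> (y (r k))" "f i \<omega> (y (r k)) \<le> u i + 1 / real (Suc (r k))" for k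
        using y(2) i by (meson less_imp_le)+
      then show ?thesis using LIMSEQ_le[OF l lim] LIMSEQ_le[OF lim u] by blast
    qed
    then show ?L using x(1) by blast
  qed
  have "{\<omega> \<in> space M. \<exists>x\<in>D. ?near k \<omega> x} \<in> sets M" for k
  proof -
    have "{\<omega> \<in> space M. ?near k \<omega> x} \<in> sets M" for x
    proof -
      have "{\<omega> \<in> space M. ?near k \<omega> x} = {\<omega> \<in> space M. \<forall>i\<in>{..<m}. l i - 1 / Suc k < f i \<omega> x \<and> f i \<omega> x < u i + 1 / Suc k}" by auto
      also have "\<dots> \<in> sets M"
        by (intro sets.sets_Collect_finite_All finite_lessThan) (use meas in measurable)
      finally show ?thesis .
    qed
    then show ?thesis by (rule sets.sets_Collect_countable_Ex'[OF _ D(1)])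
  qed
  then show ?thesis unfolding eq by (intro sets.sets_Collect_countable_All)
qed

text \<open>Quantisation cells are half-open, so they are exhausted by the closed cells ending at
  \<open>q i + 1 - 1 / Suc k\<close>; one \<open>k\<close> serves all rows because there are
  finitely many.\<close>

lemma sets_floor_cell:
  fixes S :: "(nat \<Rightarrow> real) set" and f :: "nat \<Rightarrow> 'a \<Rightarrow> (nat \<Rightarrow> real) \<Rightarrow> real"
  assumes S: "compact S"
    and meas: "\<And>i x. i < m \<Longrightarrow> (\<lambda>\<omega>. f i \<omega> x) \<in> borel_measurable M"
    and cont: "\<And>i \<omega>. i < m \<Longrightarrow> continuous_on UNIV (f i \<omega>)"
  shows "{\<omega> \<in> space M. \<exists>x\<in>S. \<forall>i<m. \<lfloor>f i \<omega> x\<rfloor> = q i} \<in> sets M"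
proof -
  have eq: "(\<exists>x\<in>S. \<forall>i<m. \<lfloor>f i \<omega> x\<rfloor> = q i) \<longleftrightarrow>
    (\<exists>k::nat. \<exists>x\<in>S. \<forall>i<m. real_of_int (q i) \<le> f i \<omega> x \<and> f i \<omega> x \<le> q i + 1 - 1 / Suc k)" (is "?L \<longleftrightarrow> ?R") for \<omega>
  proof
    assume ?L
    then obtain x where x: "x \<in> S" "\<And>i. i < m \<Longrightarrow> \<lfloor>f i \<omega> x\<rfloor> = q i" by blast
    have b: "real_of_int (q i) \<le> f i \<omega> x" "f i \<omega> x < q i + 1" if "i < m" for i using x(2)[OF that] by linarith+
    have "\<exists>k. \<forall>i<m. 1 / real (Suc k) \<le> q i + 1 - f i \<omega> x"
    proof -
      have "\<forall>\<^sub>F k in sequentially. 1 / real (Suc k) \<le> q i + 1 - f i \<omega> x" if "i < m" for i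
      proof -
        have "(\<lambda>k. 1 / real (Suc k)) \<longlonglongrightarrow> 0" using LIMSEQ_inverse_real_of_nat by (simp add: inverse_eq_divide)
        from order_tendstoD(2)[OF this, of "q i + 1 - f i \<omega> x"] b[OF that]
        show ?thesis by (auto elim: eventually_mono)
      qed
      then have "\<forall>\<^sub>F k in sequentially. \<forall>i\<in>{..<m}. 1 / real (Suc k) \<le> q i + 1 - f i \<omega> x"
        by (intro eventually_ball_finite) auto
      then show ?thesis unfolding eventually_sequentially by auto
    qed
    then obtain k where "\<And>i. i < m \<Longrightarrow> 1 / real (Suc k) \<le> q i + 1 - f i \<omega> x" by blast
    then show ?R using x(1) b by (intro exI[of _ k] bexI[of _ x]) (auto simp: algebra_simps)
  next
    assume ?R
    then obtain k :: nat and x where x: "x \<in> S" "\<And>i. i < m \<Longrightarrow> real_of_int (q i) \<le> f i \<omega> x \<and> f i \<omega> x \<le> q i + 1 - 1 / Suc k" by blast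
    have "\<lfloor>f i \<omega> x\<rfloor> = q i" if "i < m" for i
    proof -
      have "0 < 1 / real (Suc k)" by simp
      then show ?thesis using x(2)[OF that] by (intro floor_unique) linarith+
    qed
    then show ?L using x(1) by blast
  qed
  show ?thesis unfolding eq
    by (intro sets.sets_Collect_countable_Ex sets_exists_compact assms)
qed

text \<open>There are only countably many vectors \<open>q\<close> of cell indices, and the two
  images meet exactly when one of them is reached from both sets.\<close>

lemma sets_quant_map_disjoint:
  assumes "\<delta> > 0" "compact C1" "compact C2"
  shows "{\<omega> \<in> space (map_law m n \<delta>). quant_map m n \<delta> \<omega> ` C1 \<inter> quant_map m n \<delta> \<omega> ` C2 = {}} \<in> sets (map_law m n \<delta>)"
proof -
  let ?M = "map_law m n \<delta>"
  let ?f = "\<lambda>i \<omega> x. ((\<Sum>j<n. fst \<omega> (i, j) * x j) + snd \<omega> i) / \<delta>"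
  let ?Q = "{..<m} \<rightarrow>\<^sub>E (UNIV :: int set)"
  have meas: "(\<lambda>\<omega>. ?f i \<omega> x) \<in> borel_measurable ?M" if "i < m" for i x
  proof -
    have "(\<lambda>\<omega>. fst \<omega> (i, j)) \<in> borel_measurable ?M" if "j < n" for j
      unfolding map_law_def
      by (rule measurable_compose[OF measurable_fst]) (use \<open>i < m\<close> that in auto)
    moreover have "(\<lambda>\<omega>. snd \<omega> i) \<in> borel_measurable ?M"
      unfolding map_law_def
      by (rule measurable_compose[OF measurable_snd]) (use \<open>i < m\<close> in auto)
    ultimately show ?thesis
      by (intro borel_measurable_divide borel_measurable_add borel_measurable_sum borel_measurable_times) auto
  qed
  have cont: "continuous_on UNIV (?f i \<omega>)" for i \<omega>
    using assms(1) by (intro continuous_intros continuous_on_product_coordinates) auto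
  have cell: "{\<omega> \<in> space ?M. \<exists>x\<in>C. \<forall>i<m. \<lfloor>?f i \<omega> x\<rfloor> = q i} \<in> sets ?M" if "compact C" for C q
    by (rule sets_floor_cell[OF that, of m ?f]) (use meas cont in auto)
  have "quant_map m n \<delta> \<omega> ` C1 \<inter> quant_map m n \<delta> \<omega> ` C2 = {} \<longleftrightarrow>
    \<not> (\<exists>q\<in>?Q. (\<exists>x\<in>C1. \<forall>i<m. \<lfloor>?f i \<omega> x\<rfloor> = q i) \<and> (\<exists>x\<in>C2. \<forall>i<m. \<lfloor>?f i \<omega> x\<rfloor> = q i))" for \<omega>
  proof -
    have "quant_map m n \<delta> \<omega> ` C1 \<inter> quant_map m n \<delta> \<omega> ` C2 = {} \<longleftrightarrow>
      \<not> (\<exists>x\<in>C1. \<exists>y\<in>C2. \<forall>i<m. \<lfloor>?f i \<omega> x\<rfloor> = \<lfloor>?f i \<omega> y\<rfloor>)"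
      unfolding quant_map_eq_iff[OF assms(1), symmetric] by blast
    also have "(\<exists>x\<in>C1. \<exists>y\<in>C2. \<forall>i<m. \<lfloor>?f i \<omega> x\<rfloor> = \<lfloor>?f i \<omega> y\<rfloor>) \<longleftrightarrow>
      (\<exists>q\<in>?Q. (\<exists>x\<in>C1. \<forall>i<m. \<lfloor>?f i \<omega> x\<rfloor> = q i) \<and> (\<exists>x\<in>C2. \<forall>i<m. \<lfloor>?f i \<omega> x\<rfloor> = q i))"
    proof
      assume "\<exists>x\<in>C1. \<exists>y\<in>C2. \<forall>i<m. \<lfloor>?f i \<omega> x\<rfloor> = \<lfloor>?f i \<omega> y\<rfloor>"
      then obtain x y where "x \<in> C1" "y \<in> C2" "\<forall>i<m. \<lfloor>?f i \<omega> x\<rfloor> = \<lfloor>?f i \<omega> y\<rfloor>" by blast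
      then show "\<exists>q\<in>?Q. (\<exists>x\<in>C1. \<forall>i<m. \<lfloor>?f i \<omega> x\<rfloor> = q i) \<and> (\<exists>x\<in>C2. \<forall>i<m. \<lfloor>?f i \<omega> x\<rfloor> = q i)"
        by (intro bexI[of _ "\<lambda>i\<in>{..<m}. \<lfloor>?f i \<omega> x\<rfloor>"] conjI bexI[of _ x] bexI[of _ y]) auto
    next
      assume "\<exists>q\<in>?Q. (\<exists>x\<in>C1. \<forall>i<m. \<lfloor>?f i \<omega> x\<rfloor> = q i) \<and> (\<exists>x\<in>C2. \<forall>i<m. \<lfloor>?f i \<omega> x\<rfloor> = q i)"
      then obtain q x y where "x \<in> C1" "y \<in> C2" "\<forall>i<m. \<lfloor>?f i \<omega> x\<rfloor> = q i" "\<forall>i<m. \<lfloor>?f i \<omega> y\<rfloor> = q i" by blast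
      then show "\<exists>x\<in>C1. \<exists>y\<in>C2. \<forall>i<m. \<lfloor>?f i \<omega> x\<rfloor> = \<lfloor>?f i \<omega> y\<rfloor>" by (intro bexI[of _ x] bexI[of _ y]) auto
    qed
    finally show ?thesis .
  qed
  moreover have "countable ?Q" by (intro countable_PiE) auto
  ultimately show ?thesis
    by (simp only:) (intro sets.sets_Collect_neg sets.sets_Collect_countable_Ex' sets.sets_Collect_conj cell assms)
qed

section \<open>Compactness and the distance between the two sets\<close>

lemma compact_if_bounded_coordinates:
  fixes S :: "(nat \<Rightarrow> real) set"
  assumes "closed S" "\<And>x i. x \<in> S \<Longrightarrow> \<bar>x i\<bar> \<le> B i"
  shows "compact S"
proof -
  have "compact (PiE UNIV (\<lambda>i. {- B i..B i}))"
    using compactin_PiE[of "\<lambda>_. euclideanreal" UNIV "\<lambda>i. {- B i..B i}"]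
    by (simp add: euclidean_product_topology)
  moreover have "S \<subseteq> PiE UNIV (\<lambda>i. {- B i..B i})" proof
    fix x assume "x \<in> S"
    then have "x i \<in> {- B i..B i}" for i using assms(2)[of x i] by auto
    then show "x \<in> PiE UNIV (\<lambda>i. {- B i..B i})" by auto
  qed
  ultimately show ?thesis using assms(1) compact_Int_closed[of "PiE UNIV (\<lambda>i. {- B i..B i})" S] by (simp add: Int_absorb1)
qed

lemma abs_le_enorm: "i < n \<Longrightarrow> \<bar>x i\<bar> \<le> enorm n x"
  unfolding enorm_eq by (rule real_le_rsqrt) (auto intro: member_le_sum[of i "{..<n}" "\<lambda>i. (x i)\<^sup>2"])

lemma enorm_scale: "enorm n (\<lambda>i. c * x i) = \<bar>c\<bar> * enorm n x"
  unfolding enorm_def L2_set_def by (simp add: power_mult_distrib sum_distrib_left[symmetric] real_sqrt_mult)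

lemma enorm_triangle: "enorm n (\<lambda>i. x i + y i) \<le> enorm n x + enorm n y"
  unfolding enorm_def by (rule L2_set_triangle_ineq)

lemma enorm_minus_commute: "enorm n (\<lambda>i. x i - y i) = enorm n (\<lambda>i. y i - x i)"
  unfolding enorm_eq by (simp add: power2_commute)

text \<open>The slack \<open>e\<close> cannot be dropped: a single point has radius 0, while the
  infimum ranges over positive \<open>\<rho>\<close> only.\<close>

lemma cheb_rad_cover:
  assumes "cheb_rad n S < \<infinity>" "e > 0"
  obtains c \<rho> where "0 \<le> \<rho>" "\<rho> < enn2real (cheb_rad n S) + e" "\<And>x. x \<in> S \<Longrightarrow> enorm n (\<lambda>i. x i - c i) \<le> \<rho>"
proof -
  define R where "R = enn2real (cheb_rad n S) + e"
  have "cheb_rad n S < ennreal R"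
    unfolding R_def using assms by (cases "cheb_rad n S") (auto simp: ennreal_less_iff)
  then obtain \<rho> c where r: "0 < \<rho>" "ennreal \<rho> < ennreal R"
    and S: "S \<subseteq> {\<lambda>i. c i + \<rho> * b i | b. b \<in> unit_ball n}"
    unfolding cheb_rad_def INF_less_iff by auto
  have "enorm n (\<lambda>i. x i - c i) \<le> \<rho>" if x: "x \<in> S" for x
  proof -
    obtain b where b: "x = (\<lambda>i. c i + \<rho> * b i)" "b \<in> unit_ball n" using S x by blast
    then have "enorm n (\<lambda>i. x i - c i) = \<rho> * enorm n b" using r(1) by (simp add: enorm_scale)
    also have "\<dots> \<le> \<rho> * 1" using b r(1) by (intro mult_left_mono) (auto simp: unit_ball_def)
    finally show ?thesis by simp
  qed
  moreover have "\<rho> < enn2real (cheb_rad n S) + e" using r unfolding R_def by (simp add: ennreal_less_iff)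
  ultimately show ?thesis using that[of \<rho> c] r(1) by simp
qed

lemma compact_if_cheb_rad_finite:
  assumes "closedin (Euclidean_space n) S" "cheb_rad n S < \<infinity>"
  shows "compact S"
proof -
  obtain c \<rho> where r: "0 \<le> \<rho>" "\<rho> < enn2real (cheb_rad n S) + 1"
      "\<And>x. x \<in> S \<Longrightarrow> enorm n (\<lambda>i. x i - c i) \<le> \<rho>"
    by (rule cheb_rad_cover[OF assms(2) zero_less_one]) blast
  have cl: "closed S" "S \<subseteq> RR n" using assms(1) by (auto simp: closedin_Euclidean_space_iff)
  show ?thesis
  proof (rule compact_if_bounded_coordinates[OF cl(1), of "\<lambda>i. \<rho> + \<bar>c i\<bar>"])
    fix x i assume x: "x \<in> S"
    show "\<bar>x i\<bar> \<le> \<rho> + \<bar>c i\<bar>"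
    proof (cases "i < n")
      case True
      then show ?thesis using abs_le_enorm[of i n "\<lambda>i. x i - c i"] r(3)[OF x] by linarith
    next
      case False
      then have "x i = 0" using x cl(2) by (auto simp: topspace_Euclidean_space)
      then show ?thesis using r(1) by simp
    qed
  qed
qed

lemma enorm_eq_0_imp:
  assumes "x \<in> RR n" "y \<in> RR n" "enorm n (\<lambda>i. x i - y i) = 0"
  shows "x = y"
proof
  fix i
  show "x i = y i"
    using assms(1,2) abs_le_enorm[of i n "\<lambda>i. x i - y i"] assms(3)
    by (cases "i < n") (auto simp: topspace_Euclidean_space)
qed

text \<open>On the reals \<open>LEAST\<close> denotes the minimum only when it is attained.
  Compactness of \<open>C1 \<times> C2\<close> ensures this, and disjointness makes the minimum
  positive.\<close>

lemma least_distance: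
  assumes C1: "compact C1" "C1 \<noteq> {}" "C1 \<subseteq> RR n" and C2: "compact C2" "C2 \<noteq> {}" "C2 \<subseteq> RR n"
    and "C1 \<inter> C2 = {}"
  defines "\<sigma> \<equiv> (LEAST s. s \<in> enorm n ` diff_set C1 C2)"
  shows "\<sigma> > 0" "\<And>x y. x \<in> C1 \<Longrightarrow> y \<in> C2 \<Longrightarrow> \<sigma> \<le> enorm n (\<lambda>i. x i - y i)"
proof -
  let ?f = "\<lambda>z. enorm n (\<lambda>i. fst z i - snd z i)"
  have cont: "continuous_on (C1 \<times> C2) ?f"
  proof -
    have "continuous_on (C1 \<times> C2) (\<lambda>z. fst z i)" "continuous_on (C1 \<times> C2) (\<lambda>z. snd z i)" for i
      by (fact continuous_on_compose2[OF continuous_on_product_coordinates[of i] continuous_on_fst[OF continuous_on_id] subset_UNIV]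
        continuous_on_compose2[OF continuous_on_product_coordinates[of i] continuous_on_snd[OF continuous_on_id] subset_UNIV])+
    then show ?thesis unfolding enorm_eq by (intro continuous_on_real_sqrt continuous_on_sum continuous_on_power continuous_on_diff)
  qed
  then obtain z where z: "z \<in> C1 \<times> C2" "\<And>y. y \<in> C1 \<times> C2 \<Longrightarrow> ?f z \<le> ?f y"
    using continuous_attains_inf[OF compact_Times[OF C1(1) C2(1)] _ cont] C1(2) C2(2) by blast
  have im: "enorm n ` diff_set C1 C2 = ?f ` (C1 \<times> C2)"
  proof -
    have "diff_set C1 C2 = (\<lambda>z i. fst z i - snd z i) ` (C1 \<times> C2)"
      unfolding diff_set_def image_def by (simp add: Bex_def) fast
    then show ?thesis by (simp add: image_image)
  qed
  have eq: "\<sigma> = ?f z" unfolding \<sigma>_def im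
    by (rule Least_equality) (use z in auto)
  show "\<sigma> \<le> enorm n (\<lambda>i. x i - y i)" if "x \<in> C1" "y \<in> C2" for x y
    using z(2)[of "(x, y)"] that eq by simp
  have "\<sigma> \<noteq> 0"
  proof
    assume "\<sigma> = 0"
    have "fst z \<in> C1" "snd z \<in> C2" using z(1) by auto
    then have "fst z = snd z" using C1(3) C2(3) \<open>\<sigma> = 0\<close> eq by (intro enorm_eq_0_imp[of _ n]) auto
    then show False using \<open>fst z \<in> C1\<close> \<open>snd z \<in> C2\<close> \<open>C1 \<inter> C2 = {}\<close> by auto
  qed
  moreover have "\<sigma> \<ge> 0" unfolding eq by simp
  ultimately show "\<sigma> > 0" by simp
qed

section \<open>Separation of the two sets\<close>

lemma dot_diff_right: "dot n g (\<lambda>i. x i - y i) = dot n g x - dot n g y"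
  unfolding dot_def by (simp add: right_diff_distrib sum_subtractf)

lemma dot_scale_right: "dot n g (\<lambda>i. c * x i) = c * dot n g x"
  unfolding dot_def by (simp add: sum_distrib_left mult.left_commute)

section \<open>Uniform bounds over directions and over small displacements\<close>

text \<open>The test function \<open>\<psi>\<close> is 1 on \<open>[-1/8, 1/8]\<close> and 0 outside
  \<open>[-1/4, 1/4]\<close>, so a direction that violates the conclusion scores the full
  \<open>m\<close>. Outside \<open>A\<close> no direction scores more than \<open>7 / 8 * m\<close>:
  the mean costs \<open>m / 4\<close> by the small ball estimate, the fluctuation
  \<open>m / 2\<close>, and the width term at most \<open>m / 8\<close>.\<close>

lemma cone_escape:
  fixes m :: nat
  assumes "m \<ge> 1" "S \<noteq> {}" "0 < \<eta>" "\<And>z. z \<in> S \<Longrightarrow> enorm n z = 1" "mean_width n S < \<infinity>"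
    and W: "2 ^ 14 * (enn2real (mean_width n S))\<^sup>2 \<le> m" and \<eta>: "2 * ln (1 / \<eta>) \<le> m"
  obtains A where "A \<in> sets (PiM {..<m} (\<lambda>_. gauss_vec n))" "measure (PiM {..<m} (\<lambda>_. gauss_vec n)) A \<le> \<eta>"
    "\<And>v z. v \<in> space (PiM {..<m} (\<lambda>_. gauss_vec n)) \<Longrightarrow> v \<notin> A \<Longrightarrow> z \<in> S \<Longrightarrow> \<exists>i<m. 1 / 8 < \<bar>dot n (v i) z\<bar>"
proof -
  interpret G: prob_space "gauss_vec n" by (rule prob_space_gauss_vec)
  define \<psi> where "\<psi> = (\<lambda>x::real. max 0 (min 1 (2 - 8 * \<bar>x\<bar>)))"
  have lip: "\<bar>\<psi> a - \<psi> b\<bar> \<le> 8 * \<bar>a - b\<bar>" for a b unfolding \<psi>_def by (simp add: max_def min_def abs_if)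
  have bnd: "0 \<le> \<psi> a" "\<psi> a \<le> 1" for a by (auto simp: \<psi>_def)
  have [measurable]: "\<psi> \<in> borel_measurable borel" unfolding \<psi>_def by measurable
  let ?w = "enn2real (mean_width n S)"
  have kap: "(\<integral>g. \<psi> (dot n g z) \<partial>gauss_vec n) \<le> 1 / 4" if z: "z \<in> S" for z
  proof -
    let ?H = "{g \<in> space (gauss_vec n). \<bar>dot n g z\<bar> \<le> 1 / 4}"
    have "(\<integral>g. \<psi> (dot n g z) \<partial>gauss_vec n) \<le> (\<integral>g. indicator ?H g \<partial>gauss_vec n)"
    proof (intro integral_mono)
      show "integrable (gauss_vec n) (\<lambda>g. \<psi> (dot n g z))"
        using bnd by (intro G.integrable_const_bound[where B=1]) auto
      show "integrable (gauss_vec n) (indicator ?H :: _ \<Rightarrow> real)" by (simp add: less_top[symmetric])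
      show "\<psi> (dot n g z) \<le> indicator ?H g" if "g \<in> space (gauss_vec n)" for g
        using that by (auto simp: \<psi>_def indicator_def)
    qed
    also have "\<dots> = measure (gauss_vec n) ?H" by simp
    also have "\<dots> \<le> 1 / 4" using small_ball_dot[of n z "1/4"] assms(4)[OF z] by simp
    finally show ?thesis .
  qed
  have "?w \<le> sqrt (m / 2 ^ 14)" using W by (intro real_le_rsqrt) simp
  also have "\<dots> = sqrt m / 128" by (simp add: real_sqrt_divide real_sqrt_eq_iff)
  finally have "sqrt m * ?w \<le> sqrt m * (sqrt m / 128)" by (intro mult_left_mono) auto
  then have w: "sqrt m * ?w \<le> m / 128" by simp
  have a: "m * (1 / 4 + 1 / 2) + 2 * 8 * sqrt m * ?w \<le> 7 / 8 * real m" using w by simp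
  note ud = uniform_deviation[OF assms(2,1) _ lip bnd kap assms(5) a]
  let ?A = "{v \<in> space (PiM {..<m} (\<lambda>_. gauss_vec n)). \<exists>z\<in>S. 7 / 8 * real m < (\<Sum>i<m. \<psi> (dot n (v i) z))}"
  have "measure (PiM {..<m} (\<lambda>_. gauss_vec n)) ?A \<le> exp (- 2 * real m * (1 / 2)\<^sup>2)" by (rule ud(2)) simp_all
  also have "\<dots> \<le> exp (- ln (1 / \<eta>))" using \<eta> by (simp add: power2_eq_square)
  also have "\<dots> = \<eta>" using \<open>0 < \<eta>\<close> by (simp add: ln_div)
  finally have "measure (PiM {..<m} (\<lambda>_. gauss_vec n)) ?A \<le> \<eta>" .
  moreover have "?A \<in> sets (PiM {..<m} (\<lambda>_. gauss_vec n))" by (rule ud(1)) simp_all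
  moreover have "\<exists>i<m. 1 / 8 < \<bar>dot n (v i) z\<bar>" if v: "v \<in> space (PiM {..<m} (\<lambda>_. gauss_vec n))" "v \<notin> ?A" and z: "z \<in> S" for v z
  proof (rule ccontr)
    assume "\<not> ?thesis"
    then have le: "\<bar>dot n (v i) z\<bar> \<le> 1 / 8" if "i < m" for i using that by (meson not_less)
    have "\<psi> (dot n (v i) z) = 1" if "i < m" for i using le[OF that] by (auto simp: \<psi>_def max_def min_def)
    then have "(\<Sum>i<m. \<psi> (dot n (v i) z)) = m" by simp
    then show False using v z \<open>m \<ge> 1\<close> by force
  qed
  ultimately show ?thesis using that by blast
qed

text \<open>Since \<open>min 1 (\<bar>x\<bar> / t) = 1\<close> once
  \<open>\<bar>x\<bar> > t\<close>, the sum dominates the number of rows in which a displacement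
  moves the measurement by more than \<open>t\<close>. Mean and fluctuation cost
  \<open>\<epsilon> / t\<close> per row each. The ball has width at most
  \<open>\<epsilon> * sqrt n\<close>, so \<open>n \<le> m\<close> bounds the width term by
  \<open>2 * \<epsilon> / t\<close> per row.\<close>

lemma ball_deviation:
  fixes m n :: nat
  assumes "1 \<le> n" "n \<le> m" "0 < \<epsilon>" "0 < t"
  obtains A where "A \<in> sets (PiM {..<m} (\<lambda>_. gauss_vec n))"
    "measure (PiM {..<m} (\<lambda>_. gauss_vec n)) A \<le> exp (- 2 * real m * (\<epsilon> / t)\<^sup>2)"
    "\<And>v e. v \<in> space (PiM {..<m} (\<lambda>_. gauss_vec n)) \<Longrightarrow> v \<notin> A \<Longrightarrow> enorm n e \<le> \<epsilon> \<Longrightarrow>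
      (\<Sum>i<m. min 1 (\<bar>dot n (v i) e\<bar> / t)) \<le> 4 * real m * (\<epsilon> / t)"
proof -
  interpret G: prob_space "gauss_vec n" by (rule prob_space_gauss_vec)
  define \<psi> where "\<psi> = (\<lambda>x::real. min 1 (\<bar>x\<bar> / t))"
  define S where "S = {e. enorm n e \<le> \<epsilon>}"
  have lip: "\<bar>\<psi> a - \<psi> b\<bar> \<le> 1 / t * \<bar>a - b\<bar>" for a b
  proof -
    have "\<bar>min 1 x - min 1 y\<bar> \<le> \<bar>x - y\<bar>" for x y :: real by (simp add: min_def)
    from this[of "\<bar>a\<bar> / t" "\<bar>b\<bar> / t"] have "\<bar>\<psi> a - \<psi> b\<bar> \<le> \<bar>\<bar>a\<bar> - \<bar>b\<bar>\<bar> / t"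
      using \<open>0 < t\<close> by (simp add: \<psi>_def diff_divide_distrib[symmetric])
    also have "\<dots> \<le> \<bar>a - b\<bar> / t" using \<open>0 < t\<close> by (intro divide_right_mono abs_triangle_ineq3) auto
    finally show ?thesis by simp
  qed
  have bnd: "0 \<le> \<psi> a" "\<psi> a \<le> 1" for a using \<open>0 < t\<close> by (auto simp: \<psi>_def)
  have kap: "(\<integral>g. \<psi> (dot n g z) \<partial>gauss_vec n) \<le> \<epsilon> / t" if z: "z \<in> S" for z
  proof -
    have "(\<integral>g. \<psi> (dot n g z) \<partial>gauss_vec n) \<le> (\<integral>g. \<bar>dot n g z\<bar> / t \<partial>gauss_vec n)"
    proof (intro integral_mono)
      show "integrable (gauss_vec n) (\<lambda>g. \<bar>dot n g z\<bar> / t)" using integrable_abs_dot by auto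
      then show "integrable (gauss_vec n) (\<lambda>g. \<psi> (dot n g z))"
        by (rule Bochner_Integration.integrable_bound) (use \<open>0 < t\<close> in \<open>auto simp: \<psi>_def\<close>)
    qed (simp add: \<psi>_def)
    also have "\<dots> = (\<integral>g. \<bar>dot n g z\<bar> \<partial>gauss_vec n) / t" by simp
    also have "\<dots> \<le> \<epsilon> / t"
      using expectation_abs_dot_le[of n z] z \<open>0 < t\<close> by (intro divide_right_mono) (auto simp: S_def)
    finally show ?thesis .
  qed
  have mw: "mean_width n S \<le> ennreal (\<epsilon> * sqrt n)"
    using assms by (intro mean_width_le) (auto simp: S_def)
  then have fin: "mean_width n S < \<infinity>" by (rule le_less_trans) simp
  have "enn2real (mean_width n S) \<le> enn2real (ennreal (\<epsilon> * sqrt n))" by (intro enn2real_mono mw) simp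
  then have w: "enn2real (mean_width n S) \<le> \<epsilon> * sqrt n" using assms by simp
  have "sqrt n \<le> sqrt m" using assms by simp
  then have "sqrt m * sqrt n \<le> sqrt m * sqrt m" by (intro mult_left_mono) auto
  then have mn: "sqrt m * sqrt n \<le> m" by simp
  have "2 * (1 / t) * sqrt m * enn2real (mean_width n S) \<le> 2 * (1 / t) * sqrt m * (\<epsilon> * sqrt n)"
    using w \<open>0 < t\<close> by (intro mult_left_mono) auto
  also have "\<dots> = 2 * (\<epsilon> / t) * (sqrt m * sqrt n)" by simp
  also have "\<dots> \<le> 2 * (\<epsilon> / t) * m" using mn assms by (intro mult_left_mono) auto
  finally have a: "m * (\<epsilon> / t + \<epsilon> / t) + 2 * (1 / t) * sqrt m * enn2real (mean_width n S) \<le> 4 * real m * (\<epsilon> / t)"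
    by argo
  have "(\<lambda>_. 0) \<in> S" using \<open>0 < \<epsilon>\<close> by (simp add: S_def enorm_eq)
  then have "S \<noteq> {}" by blast
  have "1 \<le> m" "0 < \<epsilon> / t" using assms by auto
  note ud = uniform_deviation[OF \<open>S \<noteq> {}\<close> this lip bnd kap fin a]
  show ?thesis
  proof (rule that[OF ud])
    fix v e assume "v \<in> space (PiM {..<m} (\<lambda>_. gauss_vec n))" "enorm n e \<le> \<epsilon>"
      "v \<notin> {v \<in> space (PiM {..<m} (\<lambda>_. gauss_vec n)). \<exists>z\<in>S. 4 * real m * (\<epsilon> / t) < (\<Sum>i<m. \<psi> (dot n (v i) z))}"
    then have "\<not> 4 * real m * (\<epsilon> / t) < (\<Sum>i<m. \<psi> (dot n (v i) e))" by (auto simp: S_def)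
    then show "(\<Sum>i<m. min 1 (\<bar>dot n (v i) e\<bar> / t)) \<le> 4 * real m * (\<epsilon> / t)" by (simp add: \<psi>_def)
  qed
qed

text \<open>\<open>min\<close> and \<open>max\<close> make the event symmetric in \<open>p\<close>
  and \<open>q\<close>. The margin \<open>t\<close> on both sides keeps the cells distinct for all
  points whose measurements are within \<open>t\<close> of those of \<open>p\<close> and
  \<open>q\<close>.\<close>

definition robustly_separated :: "nat \<Rightarrow> real \<Rightarrow> real \<Rightarrow> (nat \<Rightarrow> real) \<Rightarrow> (nat \<Rightarrow> real) \<Rightarrow> ((nat \<Rightarrow> real) \<times> real) set"
  where "robustly_separated n \<delta> t p q = {(g, x) \<in> space (gauss_vec n \<Otimes>\<^sub>M uniform_measure lborel {0..\<delta>}).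
    \<lfloor>(min (dot n g p) (dot n g q) + t + x) / \<delta>\<rfloor> < \<lfloor>(max (dot n g p) (dot n g q) - t + x) / \<delta>\<rfloor>}"

lemma sets_robustly_separated [measurable]:
  "robustly_separated n \<delta> t p q \<in> sets (gauss_vec n \<Otimes>\<^sub>M uniform_measure lborel {0..\<delta>})"
proof -
  let ?M = "gauss_vec n \<Otimes>\<^sub>M uniform_measure lborel {0..\<delta>}"
  have "robustly_separated n \<delta> t p q = {z \<in> space ?M.
    \<lfloor>(min (dot n (fst z) p) (dot n (fst z) q) + t + snd z) / \<delta>\<rfloor> < \<lfloor>(max (dot n (fst z) p) (dot n (fst z) q) - t + snd z) / \<delta>\<rfloor>}"
    unfolding robustly_separated_def by auto
  also have "\<dots> \<in> sets ?M" by measurable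
  finally show ?thesis .
qed

text \<open>With probability at least 1/2 the measurements of \<open>p\<close> and \<open>q\<close>
  differ by more than \<open>\<sigma> / 4\<close>. Removing both margins
  \<open>\<sigma> / 16\<close> leaves a gap of at least \<open>\<sigma> / 8 < \<delta>\<close>, and
  the dither then separates with probability at least
  \<open>(\<sigma> / 8) / (2 * \<delta>)\<close>.\<close>

lemma robustly_separated_prob:
  assumes \<delta>: "0 < \<sigma>" "\<sigma> < 8 * \<delta>" and pq: "\<sigma> / 2 \<le> enorm n (\<lambda>i. p i - q i)"
  shows "\<sigma> / (32 * \<delta>) \<le> measure (gauss_vec n \<Otimes>\<^sub>M uniform_measure lborel {0..\<delta>}) (robustly_separated n \<delta> (\<sigma> / 16) p q)"
proof -
  let ?U = "uniform_measure lborel {0..\<delta>}" and ?G = "gauss_vec n" and ?S = "robustly_separated n \<delta> (\<sigma> / 16) p q"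
  let ?z = "\<lambda>i. p i - q i"
  have "\<delta> > 0" using \<delta> by simp
  interpret G: prob_space ?G by (rule prob_space_gauss_vec)
  interpret U: prob_space ?U using \<open>\<delta> > 0\<close> by (rule prob_space_dither)
  interpret GU: pair_prob_space ?G ?U ..
  let ?H = "{g \<in> space ?G. \<bar>dot n g ?z\<bar> \<le> \<sigma> / 4}"
  have "measure ?G ?H \<le> (\<sigma> / 4) / enorm n ?z" using pq \<delta> by (intro small_ball_dot) auto
  also have "\<dots> \<le> (\<sigma> / 4) / (\<sigma> / 2)" using pq \<delta> by (intro divide_left_mono) auto
  finally have H: "measure ?G ?H \<le> 1 / 2" using \<delta> by simp
  have sep: "\<sigma> / (16 * \<delta>) \<le> measure ?U (Pair g -` ?S)" if g: "g \<in> space ?G - ?H" for g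
  proof -
    have "min (dot n g p) (dot n g q) + \<sigma> / 16 + \<sigma> / 8 \<le> max (dot n g p) (dot n g q) - \<sigma> / 16"
      using g by (auto simp: dot_diff_right min_def max_def)
    from floor_separation[OF \<open>\<delta> > 0\<close> _ _ this] \<delta>
    have "\<sigma> / 8 / (2 * \<delta>) \<le> measure ?U {x. \<lfloor>(min (dot n g p) (dot n g q) + \<sigma> / 16 + x) / \<delta>\<rfloor> < \<lfloor>(max (dot n g p) (dot n g q) - \<sigma> / 16 + x) / \<delta>\<rfloor>}"
      by simp
    also have "{x. \<lfloor>(min (dot n g p) (dot n g q) + \<sigma> / 16 + x) / \<delta>\<rfloor> < \<lfloor>(max (dot n g p) (dot n g q) - \<sigma> / 16 + x) / \<delta>\<rfloor>} = Pair g -` ?S"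
      using g by (auto simp: robustly_separated_def space_pair_measure)
    finally show ?thesis by simp
  qed
  have "ennreal (\<sigma> / (32 * \<delta>)) \<le> ennreal (\<sigma> / (16 * \<delta>) * measure ?G (space ?G - ?H))"
  proof (intro ennreal_leI)
    have "measure ?G (space ?G - ?H) = 1 - measure ?G ?H" by (intro G.prob_compl) measurable
    then have "\<sigma> / (16 * \<delta>) * (1 / 2) \<le> \<sigma> / (16 * \<delta>) * measure ?G (space ?G - ?H)"
      using H \<delta> \<open>\<delta> > 0\<close> by (intro mult_left_mono) auto
    then show "\<sigma> / (32 * \<delta>) \<le> \<sigma> / (16 * \<delta>) * measure ?G (space ?G - ?H)" by simp
  qed
  also have "\<dots> = (\<integral>\<^sup>+g. ennreal (\<sigma> / (16 * \<delta>)) * indicator (space ?G - ?H) g \<partial>?G)"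
  proof -
    have "space ?G - ?H \<in> sets ?G" by measurable
    moreover have "0 \<le> \<sigma> / (16 * \<delta>)" using \<delta> by simp
    ultimately show ?thesis by (simp only: nn_integral_cmult_indicator G.emeasure_eq_measure ennreal_mult measure_nonneg)
  qed
  also have "\<dots> \<le> (\<integral>\<^sup>+g. emeasure ?U (Pair g -` ?S) \<partial>?G)"
  proof (intro nn_integral_mono)
    fix g
    show "ennreal (\<sigma> / (16 * \<delta>)) * indicator (space ?G - ?H) g \<le> emeasure ?U (Pair g -` ?S)"
      using sep[of g] by (cases "g \<in> space ?G - ?H") (auto simp: U.emeasure_eq_measure intro: ennreal_leI)
  qed
  also have "\<dots> = emeasure (?G \<Otimes>\<^sub>M ?U) ?S" by (intro U.emeasure_pair_measure_alt[symmetric]) measurable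
  finally show ?thesis by (simp add: GU.emeasure_eq_measure)
qed

lemma robustly_separated_floor:
  assumes "\<delta> > 0" "(g, x) \<in> robustly_separated n \<delta> t p q"
    "\<bar>dot n g (\<lambda>i. a i - p i)\<bar> \<le> t" "\<bar>dot n g (\<lambda>i. b i - q i)\<bar> \<le> t"
  shows "\<lfloor>(dot n g a + x) / \<delta>\<rfloor> \<noteq> \<lfloor>(dot n g b + x) / \<delta>\<rfloor>"
proof -
  have mono: "\<lfloor>(y + x) / \<delta>\<rfloor> \<le> \<lfloor>(z + x) / \<delta>\<rfloor>" if "y \<le> z" for y z
    using that \<open>\<delta> > 0\<close> by (intro floor_mono divide_right_mono) auto
  show ?thesis
  proof (cases "dot n g p \<le> dot n g q")
    case True
    then have "\<lfloor>(dot n g p + t + x) / \<delta>\<rfloor> < \<lfloor>(dot n g q - t + x) / \<delta>\<rfloor>"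
      using assms(2) by (simp add: robustly_separated_def min_def max_def split: if_splits)
    moreover have "\<lfloor>(dot n g a + x) / \<delta>\<rfloor> \<le> \<lfloor>(dot n g p + t + x) / \<delta>\<rfloor>"
      using assms(3) by (intro mono) (simp add: dot_diff_right)
    moreover have "\<lfloor>(dot n g q - t + x) / \<delta>\<rfloor> \<le> \<lfloor>(dot n g b + x) / \<delta>\<rfloor>"
      using assms(4) by (intro mono) (simp add: dot_diff_right abs_le_iff)
    ultimately show ?thesis by linarith
  next
    case False
    then have "\<lfloor>(dot n g q + t + x) / \<delta>\<rfloor> < \<lfloor>(dot n g p - t + x) / \<delta>\<rfloor>"
      using assms(2) by (simp add: robustly_separated_def min_def max_def)
    moreover have "\<lfloor>(dot n g b + x) / \<delta>\<rfloor> \<le> \<lfloor>(dot n g q + t + x) / \<delta>\<rfloor>"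
      using assms(4) by (intro mono) (simp add: dot_diff_right)
    moreover have "\<lfloor>(dot n g p - t + x) / \<delta>\<rfloor> \<le> \<lfloor>(dot n g a + x) / \<delta>\<rfloor>"
      using assms(3) by (intro mono) (simp add: dot_diff_right abs_le_iff)
    ultimately show ?thesis by linarith
  qed
qed

lemma measure_rows_fst:
  assumes "\<delta> > 0" "A \<in> sets (PiM {..<m} (\<lambda>_. gauss_vec n))"
  shows "{x \<in> space (rows_law m n \<delta>). fst x \<in> A} \<in> sets (rows_law m n \<delta>)"
    and "measure (rows_law m n \<delta>) {x \<in> space (rows_law m n \<delta>). fst x \<in> A} = measure (PiM {..<m} (\<lambda>_. gauss_vec n)) A"
proof -
  let ?G = "PiM {..<m} (\<lambda>_. gauss_vec n)" and ?D = "PiM {..<m} (\<lambda>_. uniform_measure lborel {0..\<delta>})"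
  interpret D: prob_space ?D using assms by (intro prob_space_PiM prob_space_dither)
  have eq: "{x \<in> space (rows_law m n \<delta>). fst x \<in> A} = A \<times> space ?D"
    using sets.sets_into_space[OF assms(2)] unfolding rows_law_def by (auto simp: space_pair_measure)
  show "{x \<in> space (rows_law m n \<delta>). fst x \<in> A} \<in> sets (rows_law m n \<delta>)"
    unfolding eq unfolding rows_law_def using assms(2) by (intro pair_measureI) auto
  show "measure (rows_law m n \<delta>) {x \<in> space (rows_law m n \<delta>). fst x \<in> A} = measure ?G A"
    unfolding eq unfolding rows_law_def using assms(2) by (simp add: measure_def D.emeasure_pair_measure_Times D.emeasure_space_1)
qed

text \<open>These are the three consequences of the sample size that the coarse case uses: the range
  of \<open>ball_deviation\<close>, its failure probability, and the union bound over pairs of net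
  points. Both failures are compared with \<open>exp (- (1 + ln (1 / \<eta>)))\<close>, where
  \<open>exp (- 1) \<le> 1 / 2\<close> produces the share \<open>\<eta> / 2\<close>.\<close>

lemma net_size_bounds:
  fixes m n :: nat and \<sigma> \<delta> \<eta> r :: real
  assumes n: "1 \<le> n" and \<delta>: "0 < \<sigma>" "\<sigma> < 8 * \<delta>" and \<eta>: "0 < \<eta>" "\<eta> < 1" and r: "0 \<le> r"
    and hyp: "2 ^ 20 * (n * (1 + ln (1 + r * m / (\<delta> * n))) + ln (1 / \<eta>)) \<le> m * (\<sigma> / \<delta>)\<^sup>2"
  defines "\<epsilon> \<equiv> \<sigma>\<^sup>2 / (2 ^ 14 * \<delta>)"
  shows "n \<le> m" and "exp (- 2 * real m * (\<epsilon> / (\<sigma> / 16))\<^sup>2) \<le> \<eta> / 2"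
    and "((exp 1 * (5 + 2 * r / \<epsilon>)) ^ n)\<^sup>2 * exp (- (m * (\<sigma> / (32 * \<delta>)) / 4)) \<le> \<eta> / 2"
proof -
  have "\<delta> > 0" using \<delta> by simp
  define \<beta> where "\<beta> = \<sigma> / \<delta>"
  have \<beta>: "0 < \<beta>" "\<beta> < 8" using \<delta> \<open>\<delta> > 0\<close> by (auto simp: \<beta>_def field_simps)
  define L where "L = ln (1 + r * m / (\<delta> * n))"
  have arg: "1 \<le> 1 + r * m / (\<delta> * n)" using r \<open>\<delta> > 0\<close> by simp
  then have L: "0 \<le> L" by (simp add: L_def)
  define l where "l = ln (1 / \<eta>)"
  have l: "0 \<le> l" using \<eta> by (simp add: l_def)
  have expl: "exp (- (1 + l)) \<le> \<eta> / 2"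
  proof -
    have "exp (- (1 + l)) = exp (- 1) * exp (- l)" by (simp add: exp_add[symmetric])
    also have "exp (- l) = \<eta>" using \<eta> by (simp add: l_def ln_div)
    also have "exp (- 1 :: real) \<le> 1 / 2" using exp_ge_add_one_self[of "1::real"] by (simp add: exp_minus field_simps)
    finally show ?thesis using \<eta> by simp
  qed
  have h: "2 ^ 20 * (n * (1 + L) + l) \<le> m * \<beta>\<^sup>2" using hyp by (simp add: L_def l_def \<beta>_def)
  have nL: "real n \<le> n * (1 + L)" "0 \<le> n * L" using L by (auto simp: algebra_simps)
  have n1: "1 \<le> real n" using n by simp
  have "\<beta>\<^sup>2 \<le> 8\<^sup>2" using \<beta> by (intro power_mono) auto
  then have "m * \<beta>\<^sup>2 \<le> real m * 64" by (intro mult_left_mono) auto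
  then show "n \<le> m" using h nL l by simp
  have et: "\<epsilon> / (\<sigma> / 16) = \<beta> / 1024"
    using \<delta> \<open>\<delta> > 0\<close> by (simp add: \<epsilon>_def \<beta>_def field_simps power2_eq_square)
  have "- 2 * real m * (\<beta> / 1024)\<^sup>2 = - (m * \<beta>\<^sup>2) / 2 ^ 19" by (simp add: power_divide)
  also have "\<dots> \<le> - (1 + l)" using h nL l n1 by (simp add: field_simps)
  finally have "exp (- 2 * real m * (\<beta> / 1024)\<^sup>2) \<le> exp (- (1 + l))" by simp
  then show "exp (- 2 * real m * (\<epsilon> / (\<sigma> / 16))\<^sup>2) \<le> \<eta> / 2" unfolding et using expl by linarith
  \<comment> \<open>The net precision is exchanged for the number of measurements:
    \<open>1 / \<epsilon>\<close> is bounded by \<open>m / (\<delta> * n)\<close>, after which the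
    logarithm of the net size is at most \<open>n * (4 + L)\<close>.\<close>
  have "2 ^ 14 * real n \<le> m * \<beta>\<^sup>2" using h nL l by simp
  then have inv: "1 / \<epsilon> \<le> m / (\<delta> * n)"
    using \<delta> \<open>\<delta> > 0\<close> n1 by (simp add: \<epsilon>_def \<beta>_def field_simps power2_eq_square)
  have "r / \<epsilon> \<le> r * m / (\<delta> * n)" using mult_left_mono[OF inv r] by simp
  moreover have "5 + 2 * a \<le> 5 * (1 + b)" if "a \<le> b" "1 \<le> 1 + b" for a b :: real using that by simp
  ultimately have "5 + 2 * (r / \<epsilon>) \<le> 5 * (1 + r * m / (\<delta> * n))" using arg by blast
  then have "5 + 2 * r / \<epsilon> \<le> 5 * (1 + r * m / (\<delta> * n))" by simp
  also have "\<dots> = 5 * exp L" using arg by (simp add: L_def)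
  also have "\<dots> \<le> exp 3 * exp L"
  proof -
    have "(2::real) ^ 3 \<le> exp 1 ^ 3" using exp_ge_add_one_self[of "1::real"] by (intro power_mono) auto
    moreover have "exp 1 ^ 3 = exp (3::real)" using exp_of_nat_mult[of 3 "1::real"] by simp
    ultimately have "8 \<le> exp (3::real)" by simp
    then show ?thesis by (intro mult_right_mono) auto
  qed
  finally have "exp 1 * (5 + 2 * r / \<epsilon>) \<le> exp 1 * (exp 3 * exp L)" by (intro mult_left_mono) auto
  also have "\<dots> = exp (4 + L)" unfolding mult_exp_exp by (simp add: add.commute)
  finally have "(exp 1 * (5 + 2 * r / \<epsilon>)) ^ n \<le> exp (4 + L) ^ n"
    using r \<delta> \<open>\<delta> > 0\<close> by (intro power_mono) (auto simp: \<epsilon>_def)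
  also have "\<dots> = exp (n * (4 + L))" by (rule exp_of_nat_mult[symmetric])
  finally have "((exp 1 * (5 + 2 * r / \<epsilon>)) ^ n)\<^sup>2 \<le> (exp (n * (4 + L)))\<^sup>2"
    using r \<delta> \<open>\<delta> > 0\<close> by (intro power_mono zero_le_power) (auto simp: \<epsilon>_def)
  also have "\<dots> = exp (2 * (n * (4 + L)))" by (rule exp_double[symmetric])
  finally have sq: "((exp 1 * (5 + 2 * r / \<epsilon>)) ^ n)\<^sup>2 \<le> exp (2 * (n * (4 + L)))" .
  have "((exp 1 * (5 + 2 * r / \<epsilon>)) ^ n)\<^sup>2 * exp (- (m * (\<sigma> / (32 * \<delta>)) / 4)) \<le> exp (2 * (n * (4 + L))) * exp (- (m * (\<sigma> / (32 * \<delta>)) / 4))"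
    using sq by (intro mult_right_mono) auto
  also have "\<dots> = exp (2 * (n * (4 + L)) - m * \<beta> / 128)" unfolding mult_exp_exp by (intro arg_cong[where f=exp]) (simp add: \<beta>_def)
  also have "\<dots> \<le> exp (- (1 + l))"
  proof -
    \<comment> \<open>The tail exponent of the union bound is linear in \<open>\<beta>\<close>, the
      hypothesis is quadratic; \<open>\<beta> < 8\<close> converts one into the other.\<close>
    have "\<beta> * \<beta> \<le> 8 * \<beta>" using \<beta> by (intro mult_right_mono) auto
    then have "m * \<beta>\<^sup>2 \<le> m * (8 * \<beta>)" unfolding power2_eq_square by (intro mult_left_mono) auto
    then have "2 ^ 20 * (n * (1 + L) + l) \<le> m * \<beta> * 8" using h by linarith
    moreover have "n * (1 + L) = n + n * L" "n * (4 + L) = 4 * real n + n * L" by (auto simp: algebra_simps)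
    moreover have "2 * (4 * N + a) + (1 + l) \<le> X / 128"
      if "2 ^ 20 * (N + a + l) \<le> X * 8" "1 \<le> N" "0 \<le> a" "0 \<le> l" for N a l X :: real
    proof -
      have "1024 * N + 1024 * a + 1024 * l \<le> X / 128" using that(1) by simp
      moreover have "2 * (4 * N + a) = 8 * N + 2 * a" by simp
      ultimately show ?thesis using that(2-4) by linarith
    qed
    ultimately have "2 * (n * (4 + L)) + (1 + l) \<le> m * \<beta> / 128" using nL(2) n1 l by metis
    then show ?thesis by simp
  qed
  also note expl
  finally show "((exp 1 * (5 + 2 * r / \<epsilon>)) ^ n)\<^sup>2 * exp (- (m * (\<sigma> / (32 * \<delta>)) / 4)) \<le> \<eta> / 2" .
qed

text \<open>If \<open>x\<close> and \<open>y\<close> shared a cell in every row, each row that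
  robustly separates their net points would need a displacement beyond \<open>t\<close> at
  \<open>x\<close> or at \<open>y\<close>. As
  \<open>\<epsilon> / t = \<sigma> / (1024 * \<delta>)\<close>, the two displacement budgets add up
  to exactly \<open>m * (\<sigma> / (32 * \<delta>)) / 4\<close>, the count that the net pair
  strictly exceeds.\<close>

lemma separation_coarse:
  fixes m n :: nat and \<sigma> \<delta> \<eta> r :: real
  assumes n: "1 \<le> n" and \<delta>: "0 < \<sigma>" "\<sigma> < 8 * \<delta>" and \<eta>: "0 < \<eta>" "\<eta> < 1" and r: "0 \<le> r"
    and hyp: "2 ^ 20 * (n * (1 + ln (1 + r * m / (\<delta> * n))) + ln (1 / \<eta>)) \<le> m * (\<sigma> / \<delta>)\<^sup>2"
    and C1: "\<And>x. x \<in> C1 \<Longrightarrow> enorm n (\<lambda>i. x i - c1 i) \<le> \<rho>1" and \<rho>1: "0 \<le> \<rho>1" "\<rho>1 \<le> r + \<sigma>\<^sup>2 / (2 ^ 14 * \<delta>)"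
    and C2: "\<And>x. x \<in> C2 \<Longrightarrow> enorm n (\<lambda>i. x i - c2 i) \<le> \<rho>2" and \<rho>2: "0 \<le> \<rho>2" "\<rho>2 \<le> r + \<sigma>\<^sup>2 / (2 ^ 14 * \<delta>)"
    and dist: "\<And>x y. x \<in> C1 \<Longrightarrow> y \<in> C2 \<Longrightarrow> \<sigma> \<le> enorm n (\<lambda>i. x i - y i)"
  obtains A where "A \<in> sets (rows_law m n \<delta>)" "measure (rows_law m n \<delta>) A \<le> \<eta>"
    "\<And>v w x y. (v, w) \<in> space (rows_law m n \<delta>) \<Longrightarrow> (v, w) \<notin> A \<Longrightarrow> x \<in> C1 \<Longrightarrow> y \<in> C2 \<Longrightarrow>
      \<exists>i<m. \<lfloor>(dot n (v i) x + w i) / \<delta>\<rfloor> \<noteq> \<lfloor>(dot n (v i) y + w i) / \<delta>\<rfloor>"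
proof -
  have "\<delta> > 0" using \<delta> by simp
  let ?M = "rows_law m n \<delta>"
  interpret prob_space ?M using \<open>\<delta> > 0\<close> by (rule prob_space_rows_law)
  define \<epsilon> where "\<epsilon> = \<sigma>\<^sup>2 / (2 ^ 14 * \<delta>)"
  have \<epsilon>: "0 < \<epsilon>" using \<delta> \<open>\<delta> > 0\<close> by (simp add: \<epsilon>_def)
  note nb = net_size_bounds[OF n \<delta> \<eta> r hyp, folded \<epsilon>_def]
  define t where "t = \<sigma> / 16"
  have t: "0 < t" using \<delta> by (simp add: t_def)
  have et: "\<epsilon> / t = \<sigma> / \<delta> / 1024"
    using \<delta> \<open>\<delta> > 0\<close> by (simp add: \<epsilon>_def t_def field_simps power2_eq_square)
  have e4: "\<epsilon> \<le> \<sigma> / 4"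
  proof -
    have "\<epsilon> = (\<sigma> / \<delta> / 1024) * t" using et t by (simp add: field_simps)
    also have "\<dots> \<le> 1 * t" using \<delta> \<open>\<delta> > 0\<close> t by (intro mult_right_mono) (auto simp: field_simps)
    finally show ?thesis using \<delta> by (simp add: t_def)
  qed
  \<comment> \<open>Radii up to \<open>r + \<epsilon>\<close> are allowed, which turns the 3 of
    \<open>ball_net\<close> into 5.\<close>
  define K where "K = (exp 1 * (5 + 2 * r / \<epsilon>)) ^ n"
  have "K \<ge> 0" using r \<epsilon> by (simp add: K_def)
  have net_le: "(exp 1 * (3 + 2 * \<rho> / \<epsilon>)) ^ n \<le> K" if "0 \<le> \<rho>" "\<rho> \<le> r + \<epsilon>" for \<rho>
  proof -
    have "\<rho> / \<epsilon> \<le> (r + \<epsilon>) / \<epsilon>" using that \<epsilon> by (intro divide_right_mono) auto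
    also have "\<dots> = r / \<epsilon> + 1" using \<epsilon> by (simp add: add_divide_distrib)
    finally have "3 + 2 * \<rho> / \<epsilon> \<le> 5 + 2 * r / \<epsilon>" by simp
    then show ?thesis using that \<epsilon> unfolding K_def by (intro power_mono mult_left_mono) auto
  qed
  obtain N1 where N1: "finite N1" "real (card N1) \<le> (exp 1 * (3 + 2 * \<rho>1 / \<epsilon>)) ^ n"
    "\<And>x. enorm n (\<lambda>i. x i - c1 i) \<le> \<rho>1 \<Longrightarrow> \<exists>p\<in>N1. enorm n (\<lambda>i. x i - p i) \<le> \<epsilon>"
    using ball_net[OF n \<rho>1(1) \<epsilon>, of c1] by blast
  obtain N2 where N2: "finite N2" "real (card N2) \<le> (exp 1 * (3 + 2 * \<rho>2 / \<epsilon>)) ^ n"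
    "\<And>x. enorm n (\<lambda>i. x i - c2 i) \<le> \<rho>2 \<Longrightarrow> \<exists>p\<in>N2. enorm n (\<lambda>i. x i - p i) \<le> \<epsilon>"
    using ball_net[OF n \<rho>2(1) \<epsilon>, of c2] by blast
  \<comment> \<open>Net points need not belong to the sets, so some pairs may be close. Only pairs
    at distance at least \<open>\<sigma> / 2\<close> enter the union bound;
    \<open>\<epsilon> \<le> \<sigma> / 4\<close> ensures that the net points chosen for any
    \<open>x\<close> and \<open>y\<close> form such a pair.\<close>
  define P where "P = {z \<in> N1 \<times> N2. \<sigma> / 2 \<le> enorm n (\<lambda>i. fst z i - snd z i)}"
  have "finite P" using N1(1) N2(1) by (simp add: P_def)
  have cP: "real (card P) \<le> K\<^sup>2"
  proof -
    have "card P \<le> card (N1 \<times> N2)" using N1(1) N2(1) by (intro card_mono) (auto simp: P_def)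
    then have "real (card P) \<le> real (card N1) * real (card N2)"
      by (simp add: card_cartesian_product flip: of_nat_mult)
    also have "\<dots> \<le> K * K"
      using N1(2) N2(2) net_le[OF \<rho>1[folded \<epsilon>_def]] net_le[OF \<rho>2[folded \<epsilon>_def]] \<open>K \<ge> 0\<close>
      by (intro mult_mono) auto
    finally show ?thesis by (simp add: power2_eq_square)
  qed
  obtain A0 where A0: "A0 \<in> sets (PiM {..<m} (\<lambda>_. gauss_vec n))"
    "measure (PiM {..<m} (\<lambda>_. gauss_vec n)) A0 \<le> exp (- 2 * real m * (\<epsilon> / t)\<^sup>2)"
    "\<And>v e. v \<in> space (PiM {..<m} (\<lambda>_. gauss_vec n)) \<Longrightarrow> v \<notin> A0 \<Longrightarrow> enorm n e \<le> \<epsilon> \<Longrightarrow>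
      (\<Sum>i<m. min 1 (\<bar>dot n (v i) e\<bar> / t)) \<le> 4 * real m * (\<epsilon> / t)"
    using ball_deviation[OF n nb(1) \<epsilon> t] by blast
  define A1 where "A1 = {x \<in> space ?M. fst x \<in> A0}"
  define R where "R z = {x \<in> space ?M. (\<Sum>i<m. indicator (robustly_separated n \<delta> t (fst z) (snd z)) (fst x i, snd x i))
    \<le> m * (\<sigma> / (32 * \<delta>)) / 4}" for z
  have mA1: "A1 \<in> sets ?M" unfolding A1_def by (rule measure_rows_fst[OF \<open>\<delta> > 0\<close> A0(1)])
  have mR: "R z \<in> sets ?M" for z unfolding R_def rows_law_def by measurable
  have pR: "measure ?M (R z) \<le> exp (- (m * (\<sigma> / (32 * \<delta>)) / 4))" if "z \<in> P" for z
    unfolding R_def rows_law_def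
    using that \<delta> \<open>\<delta> > 0\<close> robustly_separated_prob[OF \<delta>, of n "fst z" "snd z"]
    by (intro lower_tail_count prob_space_gauss_vec prob_space_dither sets_robustly_separated) (auto simp: P_def t_def)
  define A where "A = A1 \<union> (\<Union>z\<in>P. R z)"
  have "measure ?M A \<le> measure ?M A1 + measure ?M (\<Union>z\<in>P. R z)"
    unfolding A_def using mA1 mR \<open>finite P\<close> by (intro measure_Un_le) auto
  also have "measure ?M (\<Union>z\<in>P. R z) \<le> (\<Sum>z\<in>P. measure ?M (R z))"
    using mR \<open>finite P\<close> by (intro measure_UNION_le) auto
  also have "\<dots> \<le> (\<Sum>z\<in>P. exp (- (m * (\<sigma> / (32 * \<delta>)) / 4)))" by (intro sum_mono pR)
  also have "\<dots> \<le> K\<^sup>2 * exp (- (m * (\<sigma> / (32 * \<delta>)) / 4))" using cP by (auto intro: mult_right_mono)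
  also have "\<dots> \<le> \<eta> / 2" using nb(3) by (simp add: K_def)
  also have "measure ?M A1 \<le> \<eta> / 2"
    using measure_rows_fst(2)[OF \<open>\<delta> > 0\<close> A0(1)] A0(2) nb(2) by (simp add: A1_def t_def)
  finally have "measure ?M A \<le> \<eta>" by simp
  moreover have "A \<in> sets ?M" unfolding A_def using mA1 mR \<open>finite P\<close> by (intro sets.Un sets.finite_UN)
  moreover have "\<exists>i<m. \<lfloor>(dot n (v i) x + w i) / \<delta>\<rfloor> \<noteq> \<lfloor>(dot n (v i) y + w i) / \<delta>\<rfloor>"
    if vw: "(v, w) \<in> space ?M" "(v, w) \<notin> A" and x: "x \<in> C1" and y: "y \<in> C2" for v w x y
  proof (rule ccontr)
    assume same: "\<not> ?thesis"
    obtain p where p: "p \<in> N1" "enorm n (\<lambda>i. x i - p i) \<le> \<epsilon>" using N1(3)[OF C1[OF x]] by blast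
    obtain q where q: "q \<in> N2" "enorm n (\<lambda>i. y i - q i) \<le> \<epsilon>" using N2(3)[OF C2[OF y]] by blast
    have "enorm n (\<lambda>i. x i - y i) \<le> enorm n (\<lambda>i. (x i - p i) + (p i - q i)) + enorm n (\<lambda>i. q i - y i)"
      using enorm_triangle[of n "\<lambda>i. (x i - p i) + (p i - q i)" "\<lambda>i. q i - y i"] by simp
    also have "\<dots> \<le> enorm n (\<lambda>i. x i - p i) + enorm n (\<lambda>i. p i - q i) + enorm n (\<lambda>i. q i - y i)"
      by (intro add_right_mono enorm_triangle)
    finally have "\<sigma> / 2 \<le> enorm n (\<lambda>i. p i - q i)"
      using dist[OF x y] p(2) q(2) e4 enorm_minus_commute[of n q y] by linarith
    then have "(p, q) \<in> P" using p q by (simp add: P_def)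
    then have "(v, w) \<notin> R (p, q)" "(v, w) \<notin> A1" using vw by (auto simp: A_def)
    then have many: "m * (\<sigma> / (32 * \<delta>)) / 4 < (\<Sum>i<m. indicator (robustly_separated n \<delta> t p q) (v i, w i))"
      and v: "v \<in> space (PiM {..<m} (\<lambda>_. gauss_vec n))" "v \<notin> A0"
      using vw(1) by (auto simp: R_def A1_def rows_law_def space_pair_measure)
    have "(\<Sum>i<m. indicator (robustly_separated n \<delta> t p q) (v i, w i))
      \<le> (\<Sum>i<m. min 1 (\<bar>dot n (v i) (\<lambda>i. x i - p i)\<bar> / t) + min 1 (\<bar>dot n (v i) (\<lambda>i. y i - q i)\<bar> / t))"
    proof (intro sum_mono)
      fix i assume "i \<in> {..<m}"
      then have fl: "\<lfloor>(dot n (v i) x + w i) / \<delta>\<rfloor> = \<lfloor>(dot n (v i) y + w i) / \<delta>\<rfloor>" using same by auto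
      let ?a = "\<bar>dot n (v i) (\<lambda>i. x i - p i)\<bar>" and ?b = "\<bar>dot n (v i) (\<lambda>i. y i - q i)\<bar>"
      have nn: "0 \<le> min 1 (?a / t)" "0 \<le> min 1 (?b / t)" using t by auto
      show "indicator (robustly_separated n \<delta> t p q) (v i, w i) \<le> min 1 (?a / t) + min 1 (?b / t)"
      proof (cases "(v i, w i) \<in> robustly_separated n \<delta> t p q")
        case True
        then have "t < ?a \<or> t < ?b" using robustly_separated_floor[OF \<open>\<delta> > 0\<close> True] fl by force
        then have "min 1 (?a / t) = 1 \<or> min 1 (?b / t) = 1" using t by (auto simp: min_def field_simps)
        then show ?thesis using nn True by auto
      qed (use nn in auto)
    qed
    also have "\<dots> \<le> 4 * real m * (\<epsilon> / t) + 4 * real m * (\<epsilon> / t)"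
      unfolding sum.distrib using A0(3)[OF v p(2)] A0(3)[OF v q(2)] by (rule add_mono)
    also have "\<dots> = m * (\<sigma> / (32 * \<delta>)) / 4" unfolding et by simp
    finally show False using many by simp
  qed
  ultimately show ?thesis using that by blast
qed

text \<open>A row exceeding 1/8 along the normalised difference puts the two measurements more than
  \<open>\<sigma> / 8 \<ge> \<delta>\<close> apart, and numbers more than one cell width apart lie
  in different cells for every value of the dither.\<close>

lemma separation_fine:
  fixes m n :: nat and \<sigma> \<delta> \<eta> :: real
  assumes \<delta>: "0 < \<delta>" "8 * \<delta> \<le> \<sigma>" and "1 \<le> m" "0 < \<eta>"
    and S: "S \<noteq> {}" "\<And>z. z \<in> S \<Longrightarrow> enorm n z = 1" "mean_width n S < \<infinity>"
    and W: "2 ^ 14 * (enn2real (mean_width n S))\<^sup>2 \<le> m" "2 * ln (1 / \<eta>) \<le> m"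
    and dist: "\<And>x y. x \<in> C1 \<Longrightarrow> y \<in> C2 \<Longrightarrow> \<sigma> \<le> enorm n (\<lambda>i. x i - y i)"
    and dir: "\<And>x y. x \<in> C1 \<Longrightarrow> y \<in> C2 \<Longrightarrow> (\<lambda>i. 1 / enorm n (\<lambda>i. x i - y i) * (x i - y i)) \<in> S"
  obtains A where "A \<in> sets (rows_law m n \<delta>)" "measure (rows_law m n \<delta>) A \<le> \<eta>"
    "\<And>v w x y. (v, w) \<in> space (rows_law m n \<delta>) \<Longrightarrow> (v, w) \<notin> A \<Longrightarrow> x \<in> C1 \<Longrightarrow> y \<in> C2 \<Longrightarrow>
      \<exists>i<m. \<lfloor>(dot n (v i) x + w i) / \<delta>\<rfloor> \<noteq> \<lfloor>(dot n (v i) y + w i) / \<delta>\<rfloor>"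
proof -
  obtain A0 where A0: "A0 \<in> sets (PiM {..<m} (\<lambda>_. gauss_vec n))" "measure (PiM {..<m} (\<lambda>_. gauss_vec n)) A0 \<le> \<eta>"
    "\<And>v z. v \<in> space (PiM {..<m} (\<lambda>_. gauss_vec n)) \<Longrightarrow> v \<notin> A0 \<Longrightarrow> z \<in> S \<Longrightarrow> \<exists>i<m. 1 / 8 < \<bar>dot n (v i) z\<bar>"
    by (rule cone_escape[OF assms(3) S(1) assms(4) S(2,3) W]) (assumption, rule that, blast+)
  let ?A = "{x \<in> space (rows_law m n \<delta>). fst x \<in> A0}"
  have "\<exists>i<m. \<lfloor>(dot n (v i) x + w i) / \<delta>\<rfloor> \<noteq> \<lfloor>(dot n (v i) y + w i) / \<delta>\<rfloor>"
    if vw: "(v, w) \<in> space (rows_law m n \<delta>)" "(v, w) \<notin> ?A" and x: "x \<in> C1" and y: "y \<in> C2" for v w x y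
  proof -
    let ?r = "enorm n (\<lambda>i. x i - y i)"
    have r: "8 * \<delta> \<le> ?r" using dist[OF x y] \<delta> by simp
    then have "?r > 0" using \<delta> by linarith
    have v: "v \<in> space (PiM {..<m} (\<lambda>_. gauss_vec n))" "v \<notin> A0"
      using vw by (auto simp: rows_law_def space_pair_measure)
    obtain i where i: "i < m" "1 / 8 < \<bar>dot n (v i) (\<lambda>i. 1 / ?r * (x i - y i))\<bar>"
      using A0(3)[OF v dir[OF x y]] by blast
    have eq: "\<bar>dot n (v i) (\<lambda>i. 1 / ?r * (x i - y i))\<bar> = \<bar>dot n (v i) x - dot n (v i) y\<bar> / ?r"
      unfolding dot_scale_right using \<open>?r > 0\<close> by (simp add: dot_diff_right abs_mult)
    have "?r / 8 < \<bar>dot n (v i) x - dot n (v i) y\<bar>" using i(2)[unfolded eq] \<open>?r > 0\<close> by (simp add: field_simps)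
    then have "\<delta> < \<bar>dot n (v i) x - dot n (v i) y\<bar>" using r by linarith
    then have "1 < \<bar>(dot n (v i) x + w i) / \<delta> - (dot n (v i) y + w i) / \<delta>\<bar>"
      using \<delta> by (simp add: diff_divide_distrib[symmetric])
    then show ?thesis using i(1) by (intro exI[of _ i]) linarith
  qed
  then show ?thesis
    using that[of ?A] measure_rows_fst[OF \<delta>(1) A0(1)] A0(2) by auto
qed

section \<open>Transfer to the law of the theorem, and assembly\<close>

lemma map_law_prob_ge:
  assumes \<delta>: "\<delta> > 0" and C: "compact C1" "compact C2"
    and A: "A \<in> sets (rows_law m n \<delta>)" "measure (rows_law m n \<delta>) A \<le> \<eta>"
    and sep: "\<And>v w x y. (v, w) \<in> space (rows_law m n \<delta>) \<Longrightarrow> (v, w) \<notin> A \<Longrightarrow> x \<in> C1 \<Longrightarrow> y \<in> C2 \<Longrightarrow>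
      \<exists>i<m. \<lfloor>(dot n (v i) x + w i) / \<delta>\<rfloor> \<noteq> \<lfloor>(dot n (v i) y + w i) / \<delta>\<rfloor>"
  shows "1 - \<eta> \<le> \<P>(\<omega> in map_law m n \<delta>. quant_map m n \<delta> \<omega> ` C1 \<inter> quant_map m n \<delta> \<omega> ` C2 = {})"
proof -
  let ?M = "map_law m n \<delta>" and ?N = "rows_law m n \<delta>"
  let ?f = "\<lambda>(v, w). (\<lambda>k\<in>{..<m} \<times> {..<n}. v (fst k) (snd k), w)"
  let ?E = "{\<omega> \<in> space ?M. quant_map m n \<delta> \<omega> ` C1 \<inter> quant_map m n \<delta> \<omega> ` C2 = {}}"
  interpret N: prob_space ?N using \<delta> by (rule prob_space_rows_law)
  \<comment> \<open>A non-measurable set has \<open>measure\<close> 0, so measurability is a genuine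
    part of the lower bound.\<close>
  have E: "?E \<in> sets ?M" by (rule sets_quant_map_disjoint[OF \<delta> C])
  have "(\<lambda>x. \<lambda>k\<in>{..<m} \<times> {..<n}. fst x (fst k) (snd k)) \<in> measurable ?N (PiM ({..<m} \<times> {..<n}) (\<lambda>_. std))"
    unfolding rows_law_def gauss_vec_def
    by (rule measurable_compose[OF measurable_fst measurable_PiM_flatten]) auto
  then have f: "?f \<in> measurable ?N ?M"
    unfolding map_law_def case_prod_unfold rows_law_def by (intro measurable_Pair) auto
  have "measure ?M ?E = measure (distr ?N ?M ?f) ?E" using map_law_eq_distr[OF \<delta>, of m n] by simp
  also have "\<dots> = measure ?N (?f -` ?E \<inter> space ?N)" by (rule measure_distr[OF f E])
  also have "\<dots> \<ge> measure ?N (space ?N - A)"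
  proof (intro N.finite_measure_mono subsetI)
    fix z assume z: "z \<in> space ?N - A"
    obtain v w where vw: "z = (v, w)" by (cases z)
    have "quant_map m n \<delta> (?f z) x \<noteq> quant_map m n \<delta> (?f z) y" if "x \<in> C1" "y \<in> C2" for x y
      using sep[of v w x y] z that unfolding vw quant_map_eq_iff[OF \<delta>] by (auto simp: dot_rows simp del: restrict_apply)
    then have "quant_map m n \<delta> (?f z) ` C1 \<inter> quant_map m n \<delta> (?f z) ` C2 = {}" by blast
    then show "z \<in> ?f -` ?E \<inter> space ?N" using z measurable_space[OF f] by auto
  qed (rule measurable_sets[OF f E])
  also have "measure ?N (space ?N - A) = 1 - measure ?N A" by (rule N.prob_compl[OF A(1)])
  finally show ?thesis using A(2) by simp
qed

theorem proposition2:
  shows "\<exists>C::real. C > 0 \<and>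
    (\<forall>(m::nat) (n::nat) (\<delta>::real) (\<eta>::real) C1 C2.
      1 \<le> m \<longrightarrow> 1 \<le> n \<longrightarrow> 0 < \<delta> \<longrightarrow> 0 < \<eta> \<longrightarrow> \<eta> < 1 \<longrightarrow>
      C1 \<noteq> {} \<longrightarrow> closedin (Euclidean_space n) C1 \<longrightarrow> convex_fun C1 \<longrightarrow> cheb_rad n C1 < \<infinity> \<longrightarrow>
      C2 \<noteq> {} \<longrightarrow> closedin (Euclidean_space n) C2 \<longrightarrow> convex_fun C2 \<longrightarrow> cheb_rad n C2 < \<infinity> \<longrightarrow>
      C1 \<inter> C2 = {} \<longrightarrow>
      (let r = enn2real (cheb_rad n C1 + cheb_rad n C2);
           D = diff_set C1 C2;
           \<sigma> = (LEAST s. s \<in> enorm n ` D);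
           w = enn2real (mean_width n (cone_over D \<inter> unit_sphere n))
       in real m \<ge> C * (w\<^sup>2 + real n * (\<delta>\<^sup>2 / \<sigma>\<^sup>2)) *
              (1 + ln (1 + r * real m / (\<delta> * real n)) + inverse (w\<^sup>2) * ln (1 / \<eta>))
          \<longrightarrow> \<P>(\<omega> in map_law m n \<delta>.
                quant_map m n \<delta> \<omega> ` C1 \<inter> quant_map m n \<delta> \<omega> ` C2 = {}) \<ge> 1 - \<eta>))"
proof (rule exI[of _ "2 ^ 20"], intro conjI allI impI)
  show "0 < (2 ^ 20 :: real)" by simp
  fix m n :: nat and \<delta> \<eta> :: real and C1 C2 :: "(nat \<Rightarrow> real) set"
  assume m: "1 \<le> m" and n: "1 \<le> n" and \<delta>: "0 < \<delta>" and \<eta>: "0 < \<eta>" "\<eta> < 1"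
    and C1: "C1 \<noteq> {}" "closedin (Euclidean_space n) C1" "convex_fun C1" "cheb_rad n C1 < \<infinity>"
    and C2: "C2 \<noteq> {}" "closedin (Euclidean_space n) C2" "convex_fun C2" "cheb_rad n C2 < \<infinity>"
    and disj: "C1 \<inter> C2 = {}"
  define r where "r = enn2real (cheb_rad n C1 + cheb_rad n C2)"
  define D where "D = diff_set C1 C2"
  define \<sigma> where "\<sigma> = (LEAST s. s \<in> enorm n ` D)"
  define S where "S = cone_over D \<inter> unit_sphere n"
  define w where "w = enn2real (mean_width n S)"
  define L where "L = ln (1 + r * m / (\<delta> * n))"
  define l where "l = ln (1 / \<eta>)"
  have R: "C1 \<subseteq> RR n" "C2 \<subseteq> RR n" using C1(2) C2(2) by (auto dest: closedin_subset)
  have K: "compact C1" "compact C2" using C1 C2 by (auto intro: compact_if_cheb_rad_finite)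
  note ld = least_distance[OF K(1) C1(1) R(1) K(2) C2(1) R(2) disj, folded D_def, folded \<sigma>_def]
  \<comment> \<open>All distances are at least \<open>\<sigma> > 0\<close>, so differences can be
    normalised; this also shows that \<open>S\<close> is not empty.\<close>
  have dir: "(\<lambda>i. 1 / enorm n (\<lambda>i. x i - y i) * (x i - y i)) \<in> S" if "x \<in> C1" "y \<in> C2" for x y
  proof -
    let ?z = "\<lambda>i. x i - y i"
    have z: "0 < enorm n ?z" using ld(2)[OF that] ld(1) by linarith
    have "?z \<in> D" using that by (auto simp: D_def diff_set_def)
    then have "(\<lambda>i. 1 / enorm n ?z * ?z i) \<in> cone_over D"
      unfolding cone_over_def by (intro CollectI exI[of _ "1 / enorm n ?z"] exI[of _ ?z]) auto
    moreover have "enorm n (\<lambda>i. 1 / enorm n ?z * ?z i) = 1"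
      using z by (subst enorm_scale) simp
    moreover have "(\<lambda>i. 1 / enorm n ?z * ?z i) \<in> RR n"
      using that R by (auto simp: topspace_Euclidean_space subset_iff)
    ultimately show ?thesis by (simp add: S_def unit_sphere_def)
  qed
  then have Sne: "S \<noteq> {}" using C1(1) C2(1) by blast
  have unit: "enorm n z = 1" if "z \<in> S" for z using that by (simp add: S_def unit_sphere_def)
  have mw: "mean_width n S \<le> ennreal (1 * sqrt n)" using unit by (intro mean_width_le n) auto
  then have fin: "mean_width n S < \<infinity>" by (rule le_less_trans) simp
  have "w \<le> enn2real (ennreal (1 * sqrt n))" unfolding w_def by (intro enn2real_mono mw) simp
  then have "w \<le> sqrt n" by simp
  moreover have w: "0 < w"
  proof -
    obtain z where "z \<in> S" using Sne by blast
    then have "0 < mean_width n S" using unit by (intro mean_width_pos[of z]) auto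
    then show ?thesis unfolding w_def using fin by (simp add: enn2real_positive_iff)
  qed
  ultimately have wn: "w\<^sup>2 \<le> n" using power_mono[of w "sqrt n" 2] by simp
  have r: "0 \<le> r" by (simp add: r_def)
  have L: "0 \<le> L" using r \<delta> by (simp add: L_def)
  have l: "0 \<le> l" using \<eta> by (simp add: l_def)
  have "1 - \<eta> \<le> \<P>(\<omega> in map_law m n \<delta>. quant_map m n \<delta> \<omega> ` C1 \<inter> quant_map m n \<delta> \<omega> ` C2 = {})"
    if hyp: "2 ^ 20 * (w\<^sup>2 + n * (\<delta>\<^sup>2 / \<sigma>\<^sup>2)) * (1 + L + inverse (w\<^sup>2) * l) \<le> m"
  proof -
    have big: "0 \<le> 1 + L + inverse (w\<^sup>2) * l" using L l by simp
    show ?thesis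
    proof (cases "8 * \<delta> \<le> \<sigma>")
      case True
      \<comment> \<open>Only the width term of the first factor is kept; as \<open>w\<close> is
        positive, \<open>w^2\<close> cancels \<open>inverse (w^2)\<close> and a pure multiple of
        \<open>ln (1 / \<eta>)\<close> remains.\<close>
      have "2 ^ 20 * w\<^sup>2 * (1 + L + inverse (w\<^sup>2) * l) \<le> 2 ^ 20 * (w\<^sup>2 + n * (\<delta>\<^sup>2 / \<sigma>\<^sup>2)) * (1 + L + inverse (w\<^sup>2) * l)"
        using big by (intro mult_right_mono) auto
      also note hyp
      also have "2 ^ 20 * w\<^sup>2 * (1 + L + inverse (w\<^sup>2) * l) = 2 ^ 20 * w\<^sup>2 + 2 ^ 20 * w\<^sup>2 * L + 2 ^ 20 * l"
        using w by (simp add: field_simps)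
      finally have "2 ^ 20 * w\<^sup>2 + 2 ^ 20 * w\<^sup>2 * L + 2 ^ 20 * l \<le> m" .
      moreover have "2 ^ 14 * a \<le> x" "2 * c \<le> x"
        if "2 ^ 20 * a + b + 2 ^ 20 * c \<le> x" "0 \<le> a" "0 \<le> b" "0 \<le> c" for a b c x :: real
        using that by simp_all
      ultimately have W: "2 ^ 14 * w\<^sup>2 \<le> m" "2 * l \<le> m"
        using L l by (meson mult_nonneg_nonneg zero_le_numeral zero_le_power zero_le_power2)+
      obtain A where A: "A \<in> sets (rows_law m n \<delta>)" "measure (rows_law m n \<delta>) A \<le> \<eta>"
        "\<And>v w x y. (v, w) \<in> space (rows_law m n \<delta>) \<Longrightarrow> (v, w) \<notin> A \<Longrightarrow> x \<in> C1 \<Longrightarrow> y \<in> C2 \<Longrightarrow>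
          \<exists>i<m. \<lfloor>(dot n (v i) x + w i) / \<delta>\<rfloor> \<noteq> \<lfloor>(dot n (v i) y + w i) / \<delta>\<rfloor>"
        using separation_fine[OF \<delta> True m \<eta>(1) Sne unit fin W[unfolded w_def l_def] ld(2) dir] by blast
      show ?thesis by (rule map_law_prob_ge[OF \<delta> K A])
    next
      case False
      \<comment> \<open>Only the dimension term is kept, and \<open>inverse (w^2)\<close> is
        weakened to \<open>1 / n\<close> by \<open>w^2 \<le> n\<close>. Multiplication by
        \<open>(\<sigma> / \<delta>)^2\<close> then leaves the form that
        \<open>separation_coarse\<close> asks for.\<close>
      have "2 ^ 20 * (n * (\<delta>\<^sup>2 / \<sigma>\<^sup>2)) * (1 + L + 1 / n * l) \<le> 2 ^ 20 * (w\<^sup>2 + n * (\<delta>\<^sup>2 / \<sigma>\<^sup>2)) * (1 + L + inverse (w\<^sup>2) * l)"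
      proof (intro mult_mono add_mono)
        show "1 / n \<le> inverse (w\<^sup>2)" using wn w by (simp add: inverse_eq_divide frac_le)
      qed (use L l in auto)
      also note hyp
      finally have "2 ^ 20 * (n * (\<delta>\<^sup>2 / \<sigma>\<^sup>2)) * (1 + L + 1 / n * l) * (\<sigma> / \<delta>)\<^sup>2 \<le> m * (\<sigma> / \<delta>)\<^sup>2"
        by (intro mult_right_mono) auto
      also have "2 ^ 20 * (n * (\<delta>\<^sup>2 / \<sigma>\<^sup>2)) * (1 + L + 1 / n * l) * (\<sigma> / \<delta>)\<^sup>2 = 2 ^ 20 * (n * (1 + L) + l)"
        using n \<delta> ld(1) by (simp add: field_simps)
      finally have h: "2 ^ 20 * (n * (1 + L) + l) \<le> m * (\<sigma> / \<delta>)\<^sup>2" .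
      \<comment> \<open>The slack in the covering radii is the net precision itself, so it changes
        the net size only through an additive constant in its base.\<close>
      have \<epsilon>: "0 < \<sigma>\<^sup>2 / (2 ^ 14 * \<delta>)" using ld(1) \<delta> by simp
      have rr: "r = enn2real (cheb_rad n C1) + enn2real (cheb_rad n C2)"
        unfolding r_def using C1(4) C2(4) by (intro enn2real_plus) auto
      obtain c1 \<rho>1 where c1: "0 \<le> \<rho>1" "\<rho>1 < enn2real (cheb_rad n C1) + \<sigma>\<^sup>2 / (2 ^ 14 * \<delta>)"
        "\<And>x. x \<in> C1 \<Longrightarrow> enorm n (\<lambda>i. x i - c1 i) \<le> \<rho>1"
        by (rule cheb_rad_cover[OF C1(4) \<epsilon>]) blast
      obtain c2 \<rho>2 where c2: "0 \<le> \<rho>2" "\<rho>2 < enn2real (cheb_rad n C2) + \<sigma>\<^sup>2 / (2 ^ 14 * \<delta>)"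
        "\<And>x. x \<in> C2 \<Longrightarrow> enorm n (\<lambda>i. x i - c2 i) \<le> \<rho>2"
        by (rule cheb_rad_cover[OF C2(4) \<epsilon>]) blast
      have \<rho>: "\<rho>1 \<le> r + \<sigma>\<^sup>2 / (2 ^ 14 * \<delta>)" "\<rho>2 \<le> r + \<sigma>\<^sup>2 / (2 ^ 14 * \<delta>)"
        using c1(2) c2(2) enn2real_nonneg[of "cheb_rad n C1"] enn2real_nonneg[of "cheb_rad n C2"] rr by linarith+
      have "\<sigma> < 8 * \<delta>" using False by simp
      obtain A where A: "A \<in> sets (rows_law m n \<delta>)" "measure (rows_law m n \<delta>) A \<le> \<eta>"
        "\<And>v w x y. (v, w) \<in> space (rows_law m n \<delta>) \<Longrightarrow> (v, w) \<notin> A \<Longrightarrow> x \<in> C1 \<Longrightarrow> y \<in> C2 \<Longrightarrow>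
          \<exists>i<m. \<lfloor>(dot n (v i) x + w i) / \<delta>\<rfloor> \<noteq> \<lfloor>(dot n (v i) y + w i) / \<delta>\<rfloor>"
        using separation_coarse[OF n ld(1) \<open>\<sigma> < 8 * \<delta>\<close> \<eta> r h[unfolded L_def l_def] c1(3,1) \<rho>(1) c2(3,1) \<rho>(2) ld(2)] by blast
      show ?thesis by (rule map_law_prob_ge[OF \<delta> K A])
    qed
  qed
  then show "let r = enn2real (cheb_rad n C1 + cheb_rad n C2);
           D = diff_set C1 C2;
           \<sigma> = (LEAST s. s \<in> enorm n ` D);
           w = enn2real (mean_width n (cone_over D \<inter> unit_sphere n))
       in real m \<ge> 2 ^ 20 * (w\<^sup>2 + real n * (\<delta>\<^sup>2 / \<sigma>\<^sup>2)) *
              (1 + ln (1 + r * real m / (\<delta> * real n)) + inverse (w\<^sup>2) * ln (1 / \<eta>))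
          \<longrightarrow> \<P>(\<omega> in map_law m n \<delta>.
                quant_map m n \<delta> \<omega> ` C1 \<inter> quant_map m n \<delta> \<omega> ` C2 = {}) \<ge> 1 - \<eta>"
    unfolding Let_def L_def l_def w_def S_def \<sigma>_def D_def r_def by blast
qed

end
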